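(* Let $(Q,N,C_1,\dots,C_N)$ be a random vector with $N\in\{0,1,2,\dots\}\cup\{\infty\}$, $C_i\ge 0$ for all $i$, and $P(|Q|>0)>0$. Let $Z_N=\sum_{i=1}^N C_i$ and suppose $\overline{G}(x)=P(Z_N>x)\in\mathcal{R}_{-\alpha}$ with $\alpha>1$, that $E[|Q|^{\alpha+\epsilon}]<\infty$ and $\rho_{\alpha+\epsilon}<\infty$ for some $\epsilon>0$, and that $E[Q]>0$. Assume $\rho\vee\rho_\alpha<1$. Then $$P(R>x)\sim \frac{(E[Q])^\alpha}{(1-\rho)^\alpha(1-\rho_\alpha)}\,P(Z_N>x)\qquad\text{as } x\to\infty,$$ where $R=\sum_{n=0}^\infty W_n$ is the random variable constructed on the weighted branching tree.
   Context: The components of $(Q,N,C_1,\dots,C_N)$ may be arbitrarily dependent, and $Q$ is real-valued. When $N=\infty$, sums $\sum_{i=1}^N$ run over all $i\ge1$. Weighted branching tree: let $U=\bigcup_{k\ge0}\{1,2,3,\dots\}^k$ be the set of finite sequences of positive integers, with $\emptyset$ the empty sequence (root); for $\mathbf{i}=(i_1,\dots,i_n)\in U$ write $(\mathbf{i},j)=(i_1,\dots,i_n,j)$. To each node $\mathbf{i}$ assign an i.i.d. copy $(Q_{\mathbf i},N_{\mathbf i},C_{(\mathbf i,1)},\dots,C_{(\mathbf i,N_{\mathbf i})})$ of $(Q,N,C_1,\dots,C_N)$, the root's vector being $(Q,N,C_1,\dots,C_N)$ itself. Let $A_0=\{\emptyset\}$ and $A_n=\{(\mathbf i,j):\mathbf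 i\in A_{n-1},\ 1\le j<N_{\mathbf i}+1\}$ for $n\ge1$ (the $n$th generation). Set $\Pi_\emptyset=1$ and $\Pi_{(\mathbf i,j)}=C_{(\mathbf i,j)}\Pi_{\mathbf i}$. Define $W_n=\sum_{\mathbf i\in A_n}Q_{\mathbf i}\Pi_{\mathbf i}$ for $n\ge0$ (so $W_0=Q$) and $R=\sum_{n=0}^\infty W_n$. Notation: $\rho_\beta=E\left[\sum_{i=1}^N C_i^\beta\right]$ for $\beta>0$, $\rho=\rho_1$, $x\vee y=\max\{x,y\}$. $f(x)\sim g(x)$ means $\lim_{x\to\infty}f(x)/g(x)=1$. $f\in\mathcal{R}_{-\alpha}$ means $f(x)=x^{-\alpha}L(x)$ for some slowly varying $L$, i.e. $L:[0,\infty)\to(0,\infty)$ with $\lim_{x\to\infty}L(\lambda x)/L(x)=1$ for every $\lambda>0$. *)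

theory Defs
  imports "HOL-Probability.Probability" "HOL-Library.Landau_Symbols"
begin

text \<open>
  A random vector \<open>(Q, N, C\<^sub>1, \<dots>, C\<^sub>N)\<close> of random, possibly infinite, length is given by
  \<open>Q\<close>, \<open>N\<close> and a sequence \<open>C\<close> whose entries \<open>C j\<close> are meaningful for \<open>1 \<le> j \<le> N\<close> only.
  Padding the remaining entries with 0 loses nothing, because \<open>N\<close> is itself a component,
  and it leaves the values \<open>C j\<close> with \<open>j > N\<close> completely unconstrained.
\<close>

definition branch_space :: "(real \<times> enat \<times> (nat \<Rightarrow> real)) measure" where
  "branch_space = borel \<Otimes>\<^sub>M count_space UNIV \<Otimes>\<^sub>M PiM UNIV (\<lambda>_. borel)"

definition branch_vector ::
    "('a \<Rightarrow> real) \<Rightarrow> ('a \<Rightarrow> enat) \<Rightarrow> (nat \<Rightarrow> 'a \<Rightarrow> real) \<Rightarrow> 'a \<Rightarrow> real \<times> enat \<times> (nat \<Rightarrow> real)" where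
  "branch_vector Q N C \<omega> =
     (Q \<omega>, N \<omega>, \<lambda>j. if 1 \<le> j \<and> enat j \<le> N \<omega> then C j \<omega> else 0)"

text \<open>The sum \<open>c\<^sub>1 + \<dots> + c\<^sub>n\<close>, over all \<open>j \<ge> 1\<close> if \<open>n = \<infinity>\<close>; nonnegative terms, possibly infinite value.\<close>

definition branch_sum :: "enat \<Rightarrow> (nat \<Rightarrow> ennreal) \<Rightarrow> ennreal" where
  "branch_sum n c = (\<Sum>j. if 1 \<le> j \<and> enat j \<le> n then c j else 0)"

definition Z_sum :: "('a \<Rightarrow> enat) \<Rightarrow> (nat \<Rightarrow> 'a \<Rightarrow> real) \<Rightarrow> 'a \<Rightarrow> ennreal" where
  "Z_sum N C \<omega> = branch_sum (N \<omega>) (\<lambda>j. ennreal (C j \<omega>))"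

definition rho :: "'a measure \<Rightarrow> ('a \<Rightarrow> enat) \<Rightarrow> (nat \<Rightarrow> 'a \<Rightarrow> real) \<Rightarrow> real \<Rightarrow> ennreal" where
  "rho M N C \<beta> = (\<integral>\<^sup>+ \<omega>. branch_sum (N \<omega>) (\<lambda>j. ennreal (C j \<omega> powr \<beta>)) \<partial>M)"

text \<open>Nodes are finite sequences of positive integers; the child \<open>(i, j)\<close> of \<open>i\<close> is \<open>i @ [j]\<close>.\<close>

definition tree_nodes :: "nat list set" where
  "tree_nodes = lists {1..}"

abbreviation node_vector ::
    "(nat list \<Rightarrow> 'a \<Rightarrow> real) \<Rightarrow> (nat list \<Rightarrow> 'a \<Rightarrow> enat) \<Rightarrow> (nat list \<Rightarrow> 'a \<Rightarrow> real)
      \<Rightarrow> nat list \<Rightarrow> 'a \<Rightarrow> real \<times> enat \<times> (nat \<Rightarrow> real)" where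
  "node_vector Qt Nt Ct i \<equiv> branch_vector (Qt i) (Nt i) (\<lambda>j. Ct (i @ [j]))"

definition weighted_branching_tree ::
    "'a measure \<Rightarrow> ('a \<Rightarrow> real) \<Rightarrow> ('a \<Rightarrow> enat) \<Rightarrow> (nat \<Rightarrow> 'a \<Rightarrow> real)
      \<Rightarrow> (nat list \<Rightarrow> 'a \<Rightarrow> real) \<Rightarrow> (nat list \<Rightarrow> 'a \<Rightarrow> enat) \<Rightarrow> (nat list \<Rightarrow> 'a \<Rightarrow> real) \<Rightarrow> bool" where
  "weighted_branching_tree M Q N C Qt Nt Ct \<longleftrightarrow>
     (\<forall>\<omega>\<in>space M. node_vector Qt Nt Ct [] \<omega> = branch_vector Q N C \<omega>) \<and>
     prob_space.indep_vars M (\<lambda>_. branch_space) (node_vector Qt Nt Ct) tree_nodes \<and>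
     (\<forall>i\<in>tree_nodes. distr M branch_space (node_vector Qt Nt Ct i)
                      = distr M branch_space (branch_vector Q N C))"

fun generation :: "(nat list \<Rightarrow> 'a \<Rightarrow> enat) \<Rightarrow> nat \<Rightarrow> 'a \<Rightarrow> nat list set" where
  "generation Nt 0 \<omega> = {[]}"
| "generation Nt (Suc n) \<omega> =
     {i @ [j] | i j. i \<in> generation Nt n \<omega> \<and> 1 \<le> j \<and> enat j < Nt i \<omega> + 1}"

definition path_weight :: "(nat list \<Rightarrow> 'a \<Rightarrow> real) \<Rightarrow> nat list \<Rightarrow> 'a \<Rightarrow> real" where
  "path_weight Ct i \<omega> = (\<Prod>k=1..length i. Ct (take k i) \<omega>)"

lemma path_weight_Nil: "path_weight Ct [] \<omega> = 1"
  by (simp add: path_weight_def)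

lemma path_weight_snoc: "path_weight Ct (i @ [j]) \<omega> = Ct (i @ [j]) \<omega> * path_weight Ct i \<omega>"
  by (simp add: path_weight_def)

text \<open>
  The sum over a generation is unconditional, since an infinite generation carries no canonical order.
  If it does not converge, \<^const>\<open>infsum\<close> returns 0; likewise \<^const>\<open>suminf\<close> is
  arbitrary for a divergent series.  When \<open>E|Q| < \<infinity>\<close> and \<open>\<rho> < 1\<close>, both sums converge absolutely
  almost surely.
\<close>

definition W_tree ::
    "(nat list \<Rightarrow> 'a \<Rightarrow> real) \<Rightarrow> (nat list \<Rightarrow> 'a \<Rightarrow> enat) \<Rightarrow> (nat list \<Rightarrow> 'a \<Rightarrow> real)
      \<Rightarrow> nat \<Rightarrow> 'a \<Rightarrow> real" where
  "W_tree Qt Nt Ct n \<omega> = (\<Sum>\<^sub>\<infinity>i\<in>generation Nt n \<omega>. Qt i \<omega> * path_weight Ct i \<omega>)"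

definition R_tree ::
    "(nat list \<Rightarrow> 'a \<Rightarrow> real) \<Rightarrow> (nat list \<Rightarrow> 'a \<Rightarrow> enat) \<Rightarrow> (nat list \<Rightarrow> 'a \<Rightarrow> real) \<Rightarrow> 'a \<Rightarrow> real" where
  "R_tree Qt Nt Ct \<omega> = (\<Sum>n. W_tree Qt Nt Ct n \<omega>)"

definition slowly_varying :: "(real \<Rightarrow> real) \<Rightarrow> bool" where
  "slowly_varying L \<longleftrightarrow>
     (\<forall>x\<ge>0. L x > 0) \<and> (\<forall>c>0. ((\<lambda>x. L (c * x) / L x) \<longlongrightarrow> 1) at_top)"

text \<open>The representation is required for \<open>x > 0\<close> only, as \<open>x powr a\<close> is not meaningful at 0 for \<open>a < 0\<close>.\<close>

definition regularly_varying :: "real \<Rightarrow> (real \<Rightarrow> real) \<Rightarrow> bool" where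
  "regularly_varying a f \<longleftrightarrow> (\<exists>L. slowly_varying L \<and> (\<forall>x>0. f x = x powr a * L x))"

end

theory Submission
  imports Defs "HOL-Real_Asymp.Real_Asymp"
begin

text \<open>
  Let \<open>Z = C\<^sub>1 + \<dots> + C\<^sub>N\<close> and \<open>G(x) = P(Z > x)\<close>.  Splitting the tree at its root shows that the sum
  \<open>R\<close> over the tree satisfies \<open>R = Q + \<Sum> C\<^sub>j R\<^sub>j\<close>, where the sums \<open>R\<^sub>j\<close> over the branches are
  i.i.d. copies of \<open>R\<close>, independent of the root vector
  (\<open>tree_law_decomposition\<close>, \<open>tree_sum_recursion\<close>).  In particular \<open>E R = E Q / (1 - \<rho>)\<close>.
  There are two likely ways for \<open>R\<close> to exceed a high level \<open>x\<close>.  Either a single summand \<open>C\<^sub>j R\<^sub>j\<close>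
  exceeds \<open>x\<close>, or \<open>Z\<close> is so large that already the conditional mean \<open>E[R] Z\<close> of the sum exceeds \<open>x\<close>.
  If \<open>P(R > x)\<close> is asymptotic to \<open>a G(x)\<close>, the first way has probability about \<open>a \<rho>\<^sub>\<alpha> G(x)\<close>, and the
  second one has probability about \<open>(E R)\<^sup>\<alpha> G(x)\<close>.  So \<open>a = a \<rho>\<^sub>\<alpha> + (E R)\<^sup>\<alpha>\<close>, that is,
  \<open>a = (E R)\<^sup>\<alpha> / (1 - \<rho>\<^sub>\<alpha>)\<close>.

  The proof works with asymptotic bounds instead of limits.  The lemmas \<open>upper_step\<close> and \<open>lower_step\<close> say
  that an asymptotic upper or lower bound \<open>a G(x)\<close> for \<open>P(R > x)\<close> can be replaced by \<open>a' G(x)\<close>,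
  for every \<open>a'\<close> strictly on the correct side of \<open>a \<rho>\<^sub>\<alpha> + (E R)\<^sup>\<alpha>\<close>.  Since \<open>\<rho>\<^sub>\<alpha> < 1\<close>, the map
  \<open>a \<mapsto> a \<rho>\<^sub>\<alpha> + (E R)\<^sup>\<alpha>\<close> is a contraction, and both bounds are driven to its fixed point
  (\<open>fixed_point_tail\<close>), as soon as \<open>P(|R| > x) \<le> K G(x)\<close> for some constant \<open>K\<close>.

  The steps rest on one estimate for a fixed sequence of weights: the probability that
  the sum exceeds its conditional mean by \<open>\<delta> x\<close> although no summand \<open>C\<^sub>j R\<^sub>j\<close> exceeds \<open>\<kappa> x\<close> is at most
  a high power of \<open>1/x\<close> if \<open>\<kappa>\<close> is small (\<open>fuk_nagaev\<close>); applied to \<open>-R\<^sub>j\<close>, the same estimate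
  bounds the deviations below the mean.  It needs a moment of order \<open>p\<close> with
  \<open>1 < p < \<alpha>\<close>, \<open>p \<le> 2\<close>, and weights with \<open>\<Sum> C\<^sub>j\<^sup>p \<le> x\<^bsup>p - \<gamma>\<^esup>\<close>; the latter fails with probability
  \<open>o(G(x))\<close>, because \<open>\<rho>\<^bsub>\<alpha> + \<epsilon>\<^esub>\<close> is finite (\<open>bad_negligible\<close>).  Potter's bounds (\<open>potter\<close>) justify the
  limit of \<open>E[\<Sum> G(x / C\<^sub>j)] / G(x)\<close> by dominated convergence (\<open>kernel_limit\<close>).

  The constant \<open>K\<close> comes from the same upper estimate.  Its error terms depend on the law of the summands
  only through their mean, their \<open>p\<close>-th moment and, linearly, the constant of a tail bound, so it can be applied by induction on \<open>n\<close> to the sums of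
  absolute values over the first \<open>n\<close> generations with one and the same \<open>K\<close>
  (\<open>tail_constant\<close>, \<open>uniform_domination\<close>).  The \<open>p\<close>-th moments are controlled in the same way
  (\<open>moment_constant\<close>), using \<open>\<rho>\<^sub>p < 1\<close>.
\<close>

section \<open>Regularly varying tails\<close>

lemma dyadic_bracket:
  fixes t :: real
  assumes "1 \<le> t"
  obtains n :: nat where "2 ^ n \<le> t" "t < 2 ^ Suc n"
proof -
  obtain N where N: "t < 2 ^ N" using real_arch_pow[of 2 t] by auto
  define k where "k = (LEAST k. t < (2::real) ^ k)"
  have k: "t < 2 ^ k" unfolding k_def by (rule LeastI[of _ N]) (rule N)
  have "k \<noteq> 0" using k assms by (intro notI) simp
  then obtain n where n: "k = Suc n" by (cases k) auto
  have "\<not> t < 2 ^ n"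
    using not_less_Least[of n "\<lambda>k. t < (2::real) ^ k"] n unfolding k_def by auto
  with k n show thesis by (intro that[of n]) auto
qed

text \<open>
  Monotonicity is what makes the limits along single factors \<open>c\<close> effective: bounds along the powers
  of 2 extend to all scales.
\<close>

locale regular_tail =
  fixes G :: "real \<Rightarrow> real" and \<alpha> :: real
  assumes index_pos: "\<alpha> > 0"
    and tail_antimono: "\<And>x y. 0 < x \<Longrightarrow> x \<le> y \<Longrightarrow> G y \<le> G x"
    and tail_pos: "\<And>x. 0 < x \<Longrightarrow> 0 < G x"
    and tail_le_1: "\<And>x. G x \<le> 1"
    and tail_rv: "\<And>c. c > 0 \<Longrightarrow> ((\<lambda>x. G (c * x) / G x) \<longlongrightarrow> c powr (- \<alpha>)) at_top"
begin

lemma doubling: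
  assumes "\<beta>1 < \<alpha>" "\<alpha> < \<beta>2"
  obtains x0 where "x0 \<ge> 1"
    "\<And>x n. x \<ge> x0 \<Longrightarrow> G (2 ^ n * x) \<le> (2 ^ n) powr (- \<beta>1) * G x"
    "\<And>x n. x \<ge> x0 \<Longrightarrow> (2 ^ n) powr (- \<beta>2) * G x \<le> G (2 ^ n * x)"
proof -
  have lim: "((\<lambda>x. G (2 * x) / G x) \<longlongrightarrow> 2 powr (- \<alpha>)) at_top" by (rule tail_rv) simp
  have "2 powr (- \<alpha>) < 2 powr (- \<beta>1)" "2 powr (- \<beta>2) < 2 powr (- \<alpha>)"
    using assms by auto
  then have "\<forall>\<^sub>F x in at_top. G (2 * x) / G x < 2 powr (- \<beta>1)"
    "\<forall>\<^sub>F x in at_top. 2 powr (- \<beta>2) < G (2 * x) / G x"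
    using order_tendstoD[OF lim] by auto
  then have "\<forall>\<^sub>F x in at_top. G (2 * x) / G x < 2 powr (- \<beta>1) \<and> 2 powr (- \<beta>2) < G (2 * x) / G x"
    by eventually_elim simp
  then obtain x1 where x1: "\<And>x. x \<ge> x1 \<Longrightarrow> G (2 * x) / G x < 2 powr (- \<beta>1) \<and> 2 powr (- \<beta>2) < G (2 * x) / G x"
    unfolding eventually_at_top_linorder by auto
  define x0 where "x0 = max 1 x1"
  have one: "G (2 * x) \<le> 2 powr (- \<beta>1) * G x" "2 powr (- \<beta>2) * G x \<le> G (2 * x)" if "x \<ge> x0" for x
    using x1[of x] that tail_pos[of x] unfolding x0_def by (auto simp: field_simps)
  have up: "G (2 ^ n * x) \<le> (2 ^ n) powr (- \<beta>1) * G x" if x: "x \<ge> x0" for x n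
  proof (induction n)
    case 0 show ?case by simp
  next
    case (Suc n)
    have x0': "1 \<le> x0" by (simp add: x0_def)
    have "1 * x \<le> 2 ^ n * x" using x x0' by (intro mult_right_mono) auto
    then have "x0 \<le> 2 ^ n * x" using x by simp
    from one(1)[OF this] have "G (2 ^ Suc n * x) \<le> 2 powr (- \<beta>1) * G (2 ^ n * x)"
      by (simp add: mult.assoc)
    also have "\<dots> \<le> 2 powr (- \<beta>1) * ((2 ^ n) powr (- \<beta>1) * G x)"
      by (intro mult_left_mono Suc) auto
    also have "\<dots> = (2 ^ Suc n) powr (- \<beta>1) * G x" by (simp add: powr_mult)
    finally show ?case .
  qed
  have low: "(2 ^ n) powr (- \<beta>2) * G x \<le> G (2 ^ n * x)" if x: "x \<ge> x0" for x n
  proof (induction n)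
    case 0 show ?case by simp
  next
    case (Suc n)
    have x0': "1 \<le> x0" by (simp add: x0_def)
    have "1 * x \<le> 2 ^ n * x" using x x0' by (intro mult_right_mono) auto
    then have *: "x0 \<le> 2 ^ n * x" using x by simp
    have "(2 ^ Suc n) powr (- \<beta>2) * G x = 2 powr (- \<beta>2) * ((2 ^ n) powr (- \<beta>2) * G x)"
      by (simp add: powr_mult)
    also have "\<dots> \<le> 2 powr (- \<beta>2) * G (2 ^ n * x)" by (intro mult_left_mono Suc) auto
    also have "\<dots> \<le> G (2 ^ Suc n * x)" using one(2)[OF *] by (simp add: mult.assoc)
    finally show ?case .
  qed
  show thesis by (rule that[of x0]) (use up low in \<open>auto simp: x0_def\<close>)
qed

text \<open>
  Potter's bounds, in a form that holds for all \<open>c > 0\<close>.  For \<open>c\<close> so large that \<open>x / c\<close> leaves the range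
  where the limit is effective, the trivial bound \<open>G \<le> 1\<close> competes with the lower bound for \<open>G x\<close>
  that comes from iterating the doubling estimate.
\<close>

lemma potter:
  assumes b: "0 < \<beta>1" "\<beta>1 < \<alpha>" "\<alpha> < \<beta>2"
  obtains A x0 where "A > 0" "x0 \<ge> 1"
    "\<And>x c. x \<ge> x0 \<Longrightarrow> c > 0 \<Longrightarrow> G (x / c) \<le> A * (c powr \<beta>1 + c powr \<beta>2) * G x"
proof -
  obtain x0 where x0: "x0 \<ge> 1" and up: "\<And>x n. x \<ge> x0 \<Longrightarrow> G (2 ^ n * x) \<le> (2 ^ n) powr (- \<beta>1) * G x"
    and low: "\<And>x n. x \<ge> x0 \<Longrightarrow> (2 ^ n) powr (- \<beta>2) * G x \<le> G (2 ^ n * x)"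
    using doubling[OF b(2,3)] by blast
  define A where "A = 2 powr \<beta>1 + 2 powr \<beta>2 * (1 + 1 / G x0)"
  have Gx0: "G x0 > 0" using x0 by (intro tail_pos) auto
  have A: "A > 0" unfolding A_def using Gx0 by (intro add_pos_pos mult_pos_pos) (auto intro: add_pos_pos)
  have "G (x / c) \<le> A * (c powr \<beta>1 + c powr \<beta>2) * G x" if x: "x \<ge> x0" and c: "c > 0" for x c
  proof -
    have xp: "x > 0" using x x0 by simp
    have Gx: "G x > 0" by (rule tail_pos[OF xp])
    show ?thesis
    proof (cases "c \<le> 1")
      case True
      then obtain n where n: "2 ^ n \<le> 1 / c" "1 / c < 2 ^ Suc n"
        using dyadic_bracket[of "1 / c"] c by auto
      have "G (x / c) \<le> G (2 ^ n * x)"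
        using n(1) xp mult_right_mono[OF n(1), of x] by (intro tail_antimono) auto
      also have "\<dots> \<le> (2 ^ n) powr (- \<beta>1) * G x" by (rule up[OF x])
      also have "\<dots> \<le> (1 / (2 * c)) powr (- \<beta>1) * G x"
        using n(2) b c Gx by (intro mult_right_mono powr_mono2') (auto simp: field_simps)
      also have "\<dots> = 2 powr \<beta>1 * c powr \<beta>1 * G x"
        using c by (simp add: powr_minus powr_divide powr_mult field_simps)
      also have "\<dots> \<le> A * (c powr \<beta>1 + c powr \<beta>2) * G x"
        using Gx Gx0 unfolding A_def by (intro mult_right_mono mult_mono) auto
      finally show ?thesis .
    next
      case False
      then obtain n where n: "2 ^ n \<le> c" "c < 2 ^ Suc n" using dyadic_bracket[of c] by auto
      define k where "k = Suc n"
      have k: "c < 2 ^ k" "2 ^ k \<le> 2 * c" using n by (auto simp: k_def)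
      have kp: "(2 ^ k) powr \<beta>2 \<le> 2 powr \<beta>2 * c powr \<beta>2"
        using powr_mono2[of \<beta>2 "2 ^ k" "2 * c"] k b c by (simp add: powr_mult)
      have main: "G (x / c) \<le> 2 powr \<beta>2 * c powr \<beta>2 * (1 + 1 / G x0) * G x"
      proof (cases "x / 2 ^ k \<ge> x0")
        case True
        have "G (x / c) \<le> G (x / 2 ^ k)" using k c xp by (intro tail_antimono divide_left_mono) auto
        also have "\<dots> \<le> (2 ^ k) powr \<beta>2 * G x"
        proof -
          have "(2 ^ k) powr \<beta>2 * ((2 ^ k) powr (- \<beta>2) * G (x / 2 ^ k)) \<le> (2 ^ k) powr \<beta>2 * G x"
            using low[OF True, of k] by (intro mult_left_mono) auto
          then show ?thesis by (simp add: powr_minus field_simps)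
        qed
        also have "\<dots> \<le> 2 powr \<beta>2 * c powr \<beta>2 * (1 + 1 / G x0) * G x"
        proof (intro mult_right_mono)
          have "(2 ^ k) powr \<beta>2 * 1 \<le> (2 powr \<beta>2 * c powr \<beta>2) * (1 + 1 / G x0)"
            using kp Gx0 by (intro mult_mono) auto
          then show "(2 ^ k) powr \<beta>2 \<le> 2 powr \<beta>2 * c powr \<beta>2 * (1 + 1 / G x0)" by simp
        qed (use Gx in auto)
        finally show ?thesis .
      next
        case False
        then have "x \<le> 2 ^ k * x0" by (simp add: field_simps)
        then have "G (2 ^ k * x0) \<le> G x" using xp by (intro tail_antimono) auto
        with low[of x0 k] have "(2 ^ k) powr (- \<beta>2) * G x0 \<le> G x" by simp
        then have "1 \<le> (2 ^ k) powr \<beta>2 * (1 / G x0) * G x"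
          using Gx0 by (simp add: powr_minus field_simps)
        also have "\<dots> \<le> 2 powr \<beta>2 * c powr \<beta>2 * (1 + 1 / G x0) * G x"
          using kp Gx0 Gx by (intro mult_right_mono mult_mono) auto
        finally show ?thesis using tail_le_1[of "x / c"] by linarith
      qed
      also have "\<dots> = (2 powr \<beta>2 * (1 + 1 / G x0)) * c powr \<beta>2 * G x" by simp
      also have "\<dots> \<le> A * (c powr \<beta>1 + c powr \<beta>2) * G x"
        using Gx Gx0 unfolding A_def by (intro mult_right_mono mult_mono) auto
      finally show ?thesis .
    qed
  qed
  then show thesis using A x0 by (intro that[of A x0]) auto
qed

lemma tail_upper_power:
  assumes b: "0 < \<beta>" "\<beta> < \<alpha>"
  obtains A where "A > 0" "\<And>x. x > 0 \<Longrightarrow> G x \<le> A * x powr (- \<beta>)"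
proof -
  obtain A x0 where A: "A > 0" "x0 \<ge> 1"
    and P: "\<And>x c. x \<ge> x0 \<Longrightarrow> c > 0 \<Longrightarrow> G (x / c) \<le> A * (c powr \<beta> + c powr (\<alpha> + 1)) * G x"
    using potter[OF b, of "\<alpha> + 1"] by auto
  have "G x \<le> (2 * A + 1) * x0 powr \<beta> * x powr (- \<beta>)" if x: "x > 0" for x
  proof (cases "x \<ge> x0")
    case True
    define c where "c = x0 / x"
    have c: "0 < c" "c \<le> 1" using True x A by (auto simp: c_def)
    have "G x = G (x0 / c)" using A x by (simp add: c_def)
    also have "\<dots> \<le> A * (c powr \<beta> + c powr (\<alpha> + 1)) * G x0" by (rule P) (use c in auto)
    also have "\<dots> \<le> A * (c powr \<beta> + c powr (\<alpha> + 1)) * 1"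
      using A by (intro mult_left_mono tail_le_1) auto
    also have "\<dots> \<le> A * (c powr \<beta> + c powr \<beta>)"
    proof -
      have "c powr (\<alpha> + 1) \<le> c powr \<beta>" using c b by (intro powr_mono') auto
      then show ?thesis using A by simp
    qed
    also have "\<dots> = 2 * A * (x0 powr \<beta> * x powr (- \<beta>))"
      using A x by (simp add: c_def powr_divide powr_minus field_simps)
    also have "\<dots> \<le> (2 * A + 1) * (x0 powr \<beta> * x powr (- \<beta>))"
      by (intro mult_right_mono) auto
    finally show ?thesis by (simp add: mult.assoc)
  next
    case False
    have "1 \<le> (x0 / x) powr \<beta>" using False x b by (intro ge_one_powr_ge_zero) auto
    also have "\<dots> = 1 * (x0 powr \<beta> * x powr (- \<beta>))" using A x by (simp add: powr_divide powr_minus field_simps)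
    also have "\<dots> \<le> (2 * A + 1) * (x0 powr \<beta> * x powr (- \<beta>))" using A by (intro mult_right_mono) auto
    finally show ?thesis using tail_le_1[of x] by (simp add: mult.assoc)
  qed
  then show thesis using A by (intro that[of "(2 * A + 1) * x0 powr \<beta>"]) auto
qed

lemma power_negligible:
  assumes b: "\<alpha> < \<beta>"
  shows "((\<lambda>x. x powr (- \<beta>) / G x) \<longlongrightarrow> 0) at_top"
proof -
  define b2 where "b2 = (\<alpha> + \<beta>) / 2"
  have b2: "\<alpha> < b2" "b2 < \<beta>" using b by (auto simp: b2_def)
  obtain A x0 where A: "A > 0" "x0 \<ge> 1"
    and P: "\<And>x c. x \<ge> x0 \<Longrightarrow> c > 0 \<Longrightarrow> G (x / c) \<le> A * (c powr (\<alpha> / 2) + c powr b2) * G x"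
    using potter[of "\<alpha> / 2" b2] b2 index_pos by auto
  have G1: "G 1 > 0" by (rule tail_pos) simp
  have bound: "x powr (- \<beta>) / G x \<le> 2 * A / G 1 * x powr (b2 - \<beta>)" if x: "x \<ge> x0" for x
  proof -
    have x1: "x \<ge> 1" using x A by simp
    have Gx: "G x > 0" using x1 by (intro tail_pos) auto
    have "x powr (\<alpha> / 2) \<le> x powr b2" using x1 b2 index_pos by (intro powr_mono) auto
    have "G 1 = G (x / x)" using x1 by simp
    also have "\<dots> \<le> A * (x powr (\<alpha> / 2) + x powr b2) * G x" by (rule P) (use x x1 in auto)
    also have "\<dots> \<le> A * (x powr b2 + x powr b2) * G x"
      using \<open>x powr (\<alpha> / 2) \<le> x powr b2\<close> A Gx by (intro mult_left_mono mult_right_mono) auto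
    finally have "1 / G x \<le> 2 * A / G 1 * x powr b2" using Gx G1 by (simp add: field_simps)
    then have "x powr (- \<beta>) * (1 / G x) \<le> x powr (- \<beta>) * (2 * A / G 1 * x powr b2)"
      by (intro mult_left_mono) auto
    also have "\<dots> = 2 * A / G 1 * x powr (b2 - \<beta>)" by (simp add: powr_diff powr_minus field_simps)
    finally show ?thesis by simp
  qed
  have lim: "((\<lambda>x. 2 * A / G 1 * x powr (b2 - \<beta>)) \<longlongrightarrow> 0) at_top"
    using b2 by (intro tendsto_mult_right_zero tendsto_neg_powr filterlim_ident) auto
  show ?thesis
  proof (rule tendsto_sandwich[OF _ _ tendsto_const lim])
    show "\<forall>\<^sub>F x in at_top. 0 \<le> x powr (- \<beta>) / G x"
      using eventually_gt_at_top[of 0] by eventually_elim (auto intro!: divide_nonneg_pos tail_pos)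
    show "\<forall>\<^sub>F x in at_top. x powr (- \<beta>) / G x \<le> 2 * A / G 1 * x powr (b2 - \<beta>)"
      using eventually_ge_at_top[of x0] by eventually_elim (rule bound)
  qed
qed

end

section \<open>Contraction of asymptotic constants\<close>

text \<open>
  The set of constants \<open>a\<close> for which \<open>H \<le> a G\<close> holds eventually is upward closed, and by the step
  hypothesis its infimum cannot lie above the fixed point \<open>b / (1 - \<theta>)\<close> of \<open>a \<mapsto> a \<theta> + b\<close>.
  The second lemma is the mirror image with suprema.
\<close>

lemma eventually_le_improve:
  fixes H G :: "real \<Rightarrow> real"
  assumes theta: "0 \<le> \<theta>" "\<theta> < 1" and b: "0 \<le> b" and G: "\<And>x. x > 0 \<Longrightarrow> G x > 0" and H: "\<And>x. H x \<ge> 0"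
    and K: "\<forall>\<^sub>F x in at_top. H x \<le> K * G x"
    and step: "\<And>a a'. 0 \<le> a \<Longrightarrow> \<forall>\<^sub>F x in at_top. H x \<le> a * G x \<Longrightarrow> a' > a * \<theta> + b \<Longrightarrow> \<forall>\<^sub>F x in at_top. H x \<le> a' * G x"
    and a: "a > b / (1 - \<theta>)"
  shows "\<forall>\<^sub>F x in at_top. H x \<le> a * G x"
proof -
  define S where "S = {a. \<forall>\<^sub>F x in at_top. H x \<le> a * G x}"
  have nonneg: "0 \<le> a" if "a \<in> S" for a
  proof -
    have "\<forall>\<^sub>F x in at_top. H x \<le> a * G x" using that by (simp add: S_def)
    then have "\<forall>\<^sub>F x::real in at_top. 0 \<le> a"
      using eventually_gt_at_top[of 0]
    proof eventually_elim
      case (elim x)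
      then have "0 \<le> a * G x" using H[of x] by linarith
      then show ?case using G[of x] elim by (simp add: zero_le_mult_iff)
    qed
    then show ?thesis by (simp add: eventually_const)
  qed
  have bdd: "bdd_below S" using nonneg by (auto simp: bdd_below_def)
  have ne: "S \<noteq> {}" using K by (auto simp: S_def)
  define i where "i = Inf S"
  have i0: "0 \<le> i" unfolding i_def using ne nonneg by (intro cInf_greatest) auto
  have up: "a' \<in> S" if "a \<in> S" "a \<le> a'" for a a'
  proof -
    have "\<forall>\<^sub>F x in at_top. H x \<le> a * G x" using that by (simp add: S_def)
    then show ?thesis unfolding S_def mem_Collect_eq using eventually_gt_at_top[of 0]
    proof eventually_elim
      case (elim x)
      then show ?case using G[of x] mult_right_mono[OF that(2), of "G x"] by linarith
    qed
  qed
  have "i \<le> b / (1 - \<theta>)"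
  proof (rule ccontr)
    assume "\<not> i \<le> b / (1 - \<theta>)"
    then have lt: "i * \<theta> + b < i" using theta by (simp add: field_simps)
    define e where "e = (i - (i * \<theta> + b)) / 3"
    have e: "e > 0" using lt by (simp add: e_def)
    obtain a where a: "a \<in> S" "a < i + e"
      using cInf_lessD[OF ne, of "i + e"] e by (auto simp: i_def)
    have a0: "0 \<le> a" using nonneg a by simp
    have "a * \<theta> \<le> (i + e) * \<theta>" using a theta by (intro mult_right_mono) auto
    also have "\<dots> \<le> i * \<theta> + e" using theta e by (simp add: algebra_simps)
    finally have "a * \<theta> + b < i - e" using e by (simp add: e_def field_simps)
    then have "i - e \<in> S" using step[of a "i - e"] a a0 by (simp add: S_def)
    then have "i \<le> i - e" unfolding i_def using bdd by (intro cInf_lower)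
    then show False using e by simp
  qed
  with a have "Inf S < a" by (simp add: i_def)
  then obtain a1 where "a1 \<in> S" "a1 < a" using cInf_lessD[OF ne] by auto
  then have "a \<in> S" using up by auto
  then show ?thesis by (simp add: S_def)
qed

lemma eventually_ge_improve:
  fixes H G :: "real \<Rightarrow> real"
  assumes theta: "0 \<le> \<theta>" "\<theta> < 1" and b: "0 \<le> b" and G: "\<And>x. x > 0 \<Longrightarrow> G x > 0" and H: "\<And>x. H x \<ge> 0"
    and K: "\<forall>\<^sub>F x in at_top. H x \<le> K * G x"
    and step: "\<And>a a'. 0 \<le> a \<Longrightarrow> \<forall>\<^sub>F x in at_top. a * G x \<le> H x \<Longrightarrow> a' < a * \<theta> + b \<Longrightarrow> \<forall>\<^sub>F x in at_top. a' * G x \<le> H x"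
    and a: "a < b / (1 - \<theta>)"
  shows "\<forall>\<^sub>F x in at_top. a * G x \<le> H x"
proof -
  define S where "S = {a. 0 \<le> a \<and> (\<forall>\<^sub>F x in at_top. a * G x \<le> H x)}"
  have le: "a \<le> K" if "a \<in> S" for a
  proof -
    have "\<forall>\<^sub>F x in at_top. a * G x \<le> H x" using that by (simp add: S_def)
    then have "\<forall>\<^sub>F x::real in at_top. a \<le> K"
      using eventually_gt_at_top[of 0] K
    proof eventually_elim
      case (elim x)
      then have "a * G x \<le> K * G x" by linarith
      then show ?case using G[of x] elim by simp
    qed
    then show ?thesis by (simp add: eventually_const)
  qed
  have bdd: "bdd_above S" using le by (auto simp: bdd_above_def)
  have zero: "0 \<in> S" using H by (auto simp: S_def)
  then have ne: "S \<noteq> {}" by auto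
  define i where "i = Sup S"
  have i0: "0 \<le> i" unfolding i_def using zero bdd by (intro cSup_upper)
  have "i \<ge> b / (1 - \<theta>)"
  proof (rule ccontr)
    assume "\<not> i \<ge> b / (1 - \<theta>)"
    then have lt: "i < i * \<theta> + b" using theta by (simp add: field_simps)
    define e where "e = ((i * \<theta> + b) - i) / 3"
    have e: "e > 0" using lt by (simp add: e_def)
    obtain a where a: "a \<in> S" "i - e < a"
      using less_cSupD[OF ne, of "i - e"] e by (auto simp: i_def)
    have "(i - e) * \<theta> \<le> a * \<theta>" using a theta by (intro mult_right_mono) auto
    moreover have "i * \<theta> - e \<le> (i - e) * \<theta>" using theta e by (simp add: algebra_simps)
    ultimately have "i + e < a * \<theta> + b" using e by (simp add: e_def field_simps)
    then have "i + e \<in> S" using step[of a "i + e"] a i0 e by (simp add: S_def)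
    then have "i + e \<le> i" unfolding i_def using bdd by (intro cSup_upper)
    then show False using e by simp
  qed
  with a have "a < Sup S" by (simp add: i_def)
  then obtain a1 where a1: "a1 \<in> S" "a < a1" using less_cSupD[OF ne] by auto
  then have "\<forall>\<^sub>F x in at_top. a1 * G x \<le> H x" by (simp add: S_def)
  then show ?thesis using eventually_gt_at_top[of 0]
  proof eventually_elim
    case (elim x)
    then show ?case using G[of x] mult_right_mono[of a a1 "G x"] a1 by linarith
  qed
qed

section \<open>Weighted sums of i.i.d. random variables\<close>

text \<open>
  This replaces the second-order Taylor estimate of \<open>exp\<close> when only a moment of order \<open>p \<le> 2\<close> is
  available.
\<close>

lemma exp_le_quadratic_power:
  fixes u v p :: real
  assumes "v \<le> u" "1 \<le> u" "1 < p" "p \<le> 2"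
  shows "exp v \<le> 1 + v + exp u * \<bar>v\<bar> powr p"
proof -
  consider "\<bar>v\<bar> \<le> 1" | "v > 1" | "v < -1" by linarith
  then show ?thesis
  proof cases
    case 1
    obtain t where t: "\<bar>t\<bar> \<le> \<bar>v\<bar>" "exp v = (\<Sum>m<2. v ^ m / fact m) + exp t / fact 2 * v ^ 2"
      using Maclaurin_exp_le[of v 2] by auto
    have sq: "v ^ 2 \<le> \<bar>v\<bar> powr p"
    proof (cases "v = 0")
      case False
      then have "v ^ 2 = \<bar>v\<bar> powr 2" by (simp add: powr_numeral)
      also have "\<dots> \<le> \<bar>v\<bar> powr p" using 1 assms False by (intro powr_mono') auto
      finally show ?thesis .
    qed auto
    have "exp v = 1 + v + exp t / 2 * v ^ 2"
      using t(2) by (simp add: numeral_2_eq_2)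
    also have "exp t / 2 * v ^ 2 \<le> exp u * v ^ 2"
    proof (intro mult_right_mono)
      have "exp t \<le> exp u" using t(1) 1 assms by auto
      then show "exp t / 2 \<le> exp u" using exp_gt_zero[of u] by linarith
    qed auto
    also have "exp u * v ^ 2 \<le> exp u * \<bar>v\<bar> powr p" using sq by (intro mult_left_mono) auto
    finally show ?thesis by simp
  next
    case 2
    have "exp v \<le> exp u * 1" using assms by simp
    also have "\<dots> \<le> exp u * \<bar>v\<bar> powr p" using 2 assms by (intro mult_left_mono ge_one_powr_ge_zero) auto
    finally show ?thesis using 2 by linarith
  next
    case 3
    have "1 \<le> exp u" using assms by simp
    have "\<bar>v\<bar> powr 1 \<le> \<bar>v\<bar> powr p" using 3 assms by (intro powr_mono) auto
    then have "1 * \<bar>v\<bar> \<le> exp u * \<bar>v\<bar> powr p" using 3 \<open>1 \<le> exp u\<close> by (intro mult_mono) auto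
    moreover have "exp v \<le> 1" using 3 by simp
    ultimately show ?thesis using 3 by linarith
  qed
qed

text \<open>
  Each of the fractions \<open>s = a / (a + b)\<close> and \<open>1 - s\<close> is at most its \<open>r\<close>-th power.
\<close>

lemma powr_add_subadditive:
  fixes a b r :: real
  assumes "0 \<le> a" "0 \<le> b" "0 < r" "r \<le> 1"
  shows "(a + b) powr r \<le> a powr r + b powr r"
proof (cases "a + b = 0")
  case False
  then have s: "a + b > 0" using assms by auto
  have *: "t / (a + b) * (a + b) powr r \<le> t powr r" if "0 \<le> t" "t \<le> a + b" for t
  proof (cases "t = 0")
    case False
    have "(t / (a + b)) powr 1 \<le> (t / (a + b)) powr r" using s that False assms by (intro powr_mono') auto
    then have "t / (a + b) * (a + b) powr r \<le> (t / (a + b)) powr r * (a + b) powr r"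
      using s that by (intro mult_right_mono) auto
    also have "\<dots> = t powr r" using s that by (simp add: powr_divide)
    finally show ?thesis .
  qed auto
  have "(a + b) powr r = a / (a + b) * (a + b) powr r + b / (a + b) * (a + b) powr r"
    using s by (simp add: distrib_right[symmetric] add_divide_distrib[symmetric])
  also have "\<dots> \<le> a powr r + b powr r" using assms by (intro add_mono *) auto
  finally show ?thesis .
qed (use assms in auto)

lemma summable_powr_of_summable:
  fixes c :: "nat \<Rightarrow> real"
  assumes "summable c" "\<And>j. 0 \<le> c j" "1 \<le> p"
  shows "summable (\<lambda>j. c j powr p)"
proof (rule summable_comparison_test_ev[OF _ assms(1)])
  have "\<forall>\<^sub>F j in sequentially. c j < 1"
    using order_tendstoD(2)[OF summable_LIMSEQ_zero[OF assms(1)]] by simp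
  then show "\<forall>\<^sub>F j in sequentially. norm (c j powr p) \<le> c j"
  proof eventually_elim
    case (elim j)
    have "c j powr p \<le> c j powr 1"
    proof (cases "c j = 0")
      case False
      then show ?thesis using elim assms(2)[of j] assms(3) by (intro powr_mono') auto
    qed auto
    then show ?case using assms(2)[of j] by simp
  qed
qed

text \<open>
  A finite sum of absolute values off one index makes the whole series absolutely convergent, so
  splitting off one term is legitimate on every such sample point.
\<close>

lemma suminf_off_index:
  fixes a :: "nat \<Rightarrow> real"
  assumes le: "(\<Sum>j. ennreal (if j = k then 0 else \<bar>a j\<bar>)) \<le> ennreal y" and y: "0 \<le> y"
  shows "summable (\<lambda>j. \<bar>a j\<bar>)" "\<bar>(\<Sum>j. a j) - a k\<bar> \<le> y"
proof -
  let ?b = "\<lambda>j. if j = k then 0 else \<bar>a j\<bar>"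
  have sb: "summable ?b"
    using le by (intro summable_suminf_not_top) (auto simp: top_unique)
  have sb': "summable (\<lambda>j. if j = k then 0 else a j)"
    by (rule summable_rabs_cancel) (use sb in \<open>simp add: if_distrib[of abs] cong: if_cong\<close>)
  show sa: "summable (\<lambda>j. \<bar>a j\<bar>)"
    by (rule iffD1[OF summable_cong sb]) (use eventually_gt_at_top[of k] in eventually_elim, auto)
  have "suminf ?b \<le> y"
    using le y sb by (subst (asm) suminf_ennreal2) (auto simp: suminf_nonneg)
  moreover have "(\<Sum>j. a j) - a k = (\<Sum>j. if j = k then 0 else a j)"
  proof -
    have s: "summable a" using sa by (rule summable_rabs_cancel)
    have "(\<Sum>j. if j = k then 0 else a j) = (\<Sum>j. a j - (if j = k then a k else 0))"
      by (intro suminf_cong) auto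
    also have "\<dots> = (\<Sum>j. a j) - (\<Sum>j. if j = k then a k else 0)"
      by (intro suminf_diff[symmetric] s sums_summable[OF sums_single])
    also have "(\<Sum>j. if j = k then a k else 0) = a k" by (rule sums_unique[OF sums_single, symmetric])
    finally show ?thesis by simp
  qed
  moreover have "\<bar>\<Sum>j. if j = k then 0 else a j\<bar> \<le> (\<Sum>j. \<bar>if j = k then 0 else a j\<bar>)"
    by (intro summable_rabs) (use sb in \<open>simp add: if_distrib[of abs] cong: if_cong\<close>)
  ultimately show "\<bar>(\<Sum>j. a j) - a k\<bar> \<le> y" by (simp add: if_distrib[of abs] cong: if_cong)
qed

locale iid_sequence = prob_space L for L :: "'l measure"
begin

abbreviation "PL \<equiv> PiM UNIV (\<lambda>_::nat. L)"

sublocale PL: prob_space PL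
  by (intro prob_space_PiM) unfold_locales

text \<open>
  Resampling the coordinate \<open>k\<close> preserves the product measure, hence that coordinate is independent of
  everything that does not look at it.
\<close>

lemma nn_integral_split_coordinate:
  fixes h :: "'l \<Rightarrow> ennreal" and u :: "(nat \<Rightarrow> 'l) \<Rightarrow> ennreal"
  assumes [measurable]: "h \<in> borel_measurable L" "u \<in> borel_measurable PL"
    and u: "\<And>g x. u (g(k := x)) = u g"
  shows "(\<integral>\<^sup>+g. h (g k) * u g \<partial>PL) = (\<integral>\<^sup>+x. h x \<partial>L) * (\<integral>\<^sup>+g. u g \<partial>PL)"
proof -
  interpret P2: pair_sigma_finite L PL ..
  have eq: "distr (L \<Otimes>\<^sub>M PL) PL (\<lambda>(x, X). X(k := x)) = PL"
    using distr_pair_PiM_eq_PiM[of UNIV "\<lambda>_. L" k] prob_space_axioms by simp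
  have m[measurable]: "(\<lambda>(x, X). X(k := x)) \<in> (L \<Otimes>\<^sub>M PL) \<rightarrow>\<^sub>M PL"
    using measurable_compose[OF measurable_pair_swap', OF measurable_add_dim[of k UNIV "\<lambda>_. L"]]
    by (simp add: case_prod_beta')
  have "(\<integral>\<^sup>+g. h (g k) * u g \<partial>PL) = (\<integral>\<^sup>+g. h (g k) * u g \<partial>distr (L \<Otimes>\<^sub>M PL) PL (\<lambda>(x, X). X(k := x)))"
    by (simp only: eq)
  also have "\<dots> = (\<integral>\<^sup>+z. h (fst z) * u (snd z) \<partial>(L \<Otimes>\<^sub>M PL))"
    by (subst nn_integral_distr) (auto simp: case_prod_beta u)
  also have "\<dots> = (\<integral>\<^sup>+x. \<integral>\<^sup>+g. h x * u g \<partial>PL \<partial>L)"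
    by (subst PL.nn_integral_fst[symmetric]) auto
  also have "\<dots> = (\<integral>\<^sup>+x. h x \<partial>L) * (\<integral>\<^sup>+g. u g \<partial>PL)"
    by (simp add: nn_integral_cmult nn_integral_multc)
  finally show ?thesis .
qed

lemma nn_integral_coordinate:
  fixes h :: "'l \<Rightarrow> ennreal"
  assumes [measurable]: "h \<in> borel_measurable L"
  shows "(\<integral>\<^sup>+g. h (g k) \<partial>PL) = (\<integral>\<^sup>+x. h x \<partial>L)"
  using nn_integral_split_coordinate[OF assms, of "\<lambda>_. 1" k] by (simp add: PL.emeasure_space_1)

lemma nn_integral_prod_coordinates:
  fixes h :: "nat \<Rightarrow> 'l \<Rightarrow> ennreal"
  assumes [measurable]: "\<And>j. h j \<in> borel_measurable L"
  shows "(\<integral>\<^sup>+g. (\<Prod>j<n. h j (g j)) \<partial>PL) = (\<Prod>j<n. \<integral>\<^sup>+x. h j x \<partial>L)"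
proof (induction n)
  case 0
  then show ?case by (simp add: PL.emeasure_space_1)
next
  case (Suc n)
  have "(\<integral>\<^sup>+g. (\<Prod>j<Suc n. h j (g j)) \<partial>PL) = (\<integral>\<^sup>+g. h n (g n) * (\<Prod>j<n. h j (g j)) \<partial>PL)"
    by (simp add: mult.commute)
  also have "\<dots> = (\<integral>\<^sup>+x. h n x \<partial>L) * (\<integral>\<^sup>+g. (\<Prod>j<n. h j (g j)) \<partial>PL)"
    by (rule nn_integral_split_coordinate) auto
  finally show ?case using Suc by (simp add: mult.commute)
qed

lemma nn_integral_weighted_sum:
  assumes [measurable]: "X \<in> borel_measurable L"
  shows "(\<integral>\<^sup>+g. (\<Sum>j. ennreal (c j) * X (g j)) \<partial>PL) = (\<Sum>j. ennreal (c j)) * (\<integral>\<^sup>+x. X x \<partial>L)"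
proof -
  have "(\<integral>\<^sup>+g. (\<Sum>j. ennreal (c j) * X (g j)) \<partial>PL) = (\<Sum>j. \<integral>\<^sup>+g. ennreal (c j) * X (g j) \<partial>PL)"
    by (intro nn_integral_suminf) auto
  also have "\<dots> = (\<Sum>j. ennreal (c j) * (\<integral>\<^sup>+x. X x \<partial>L))"
    by (simp add: nn_integral_cmult nn_integral_coordinate)
  finally show ?thesis by simp
qed

lemma AE_summable_weighted:
  fixes X :: "'l \<Rightarrow> real"
  assumes [measurable]: "integrable L X" and c: "\<And>j. 0 \<le> c j" "summable c"
  shows "AE g in PL. summable (\<lambda>j. c j * \<bar>X (g j)\<bar>)"
proof -
  have "(\<integral>\<^sup>+g. (\<Sum>j. ennreal (c j) * ennreal \<bar>X (g j)\<bar>) \<partial>PL) = (\<Sum>j. ennreal (c j)) * (\<integral>\<^sup>+x. ennreal \<bar>X x\<bar> \<partial>L)"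
    by (rule nn_integral_weighted_sum) auto
  also have "\<dots> < \<infinity>"
    using assms by (auto simp: integrable_iff_bounded ennreal_mult_less_top suminf_ennreal2)
  finally have "AE g in PL. (\<Sum>j. ennreal (c j) * ennreal \<bar>X (g j)\<bar>) \<noteq> \<infinity>"
    by (intro nn_integral_noteq_infinite) auto
  then show ?thesis
  proof eventually_elim
    case (elim g)
    have "(\<Sum>j. ennreal (c j) * ennreal \<bar>X (g j)\<bar>) = (\<Sum>j. ennreal (c j * \<bar>X (g j)\<bar>))"
      using c by (simp add: ennreal_mult)
    then show ?case using elim c by (intro summable_suminf_not_top) auto
  qed
qed

text \<open>
  The bound of Fuk and Nagaev: \<open>s\<close> is the parameter of the exponential Markov inequality, \<open>b\<close> the
  truncation level, \<open>\<mu>\<close> the deviation and \<open>B\<close> a bound for the \<open>p\<close>-th absolute moment.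
\<close>

definition fn_bound :: "real \<Rightarrow> real \<Rightarrow> (nat \<Rightarrow> real) \<Rightarrow> real \<Rightarrow> real \<Rightarrow> real \<Rightarrow> real" where
  "fn_bound p B c s b \<mu> = exp (- (s * \<mu>) + exp (s * b) * s powr p * B * (\<Sum>j. c j powr p))"

lemma truncated_exponential_moment:
  fixes X :: "'l \<Rightarrow> real"
  assumes X: "integrable L X" "integral\<^sup>L L X \<le> m"
    and Xp: "integrable L (\<lambda>x. \<bar>X x\<bar> powr p)" "(\<integral>x. \<bar>X x\<bar> powr p \<partial>L) \<le> B"
    and p: "1 < p" "p \<le> 2" and a: "0 \<le> a" and s: "0 < s" "1 \<le> s * b"
  shows "(\<integral>\<^sup>+x. ennreal (if a * X x \<le> b then exp (s * (a * X x - m * a)) else 0) \<partial>L)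
    \<le> ennreal (exp (exp (s * b) * s powr p * B * a powr p))"
proof -
  have [measurable]: "X \<in> borel_measurable L" using X by auto
  let ?e = "exp (s * b) * (s * a) powr p"
  let ?f = "\<lambda>x. exp (- (s * m * a)) * (1 + s * a * X x + ?e * \<bar>X x\<bar> powr p)"
  have pt: "(if a * X x \<le> b then exp (s * (a * X x - m * a)) else 0) \<le> ?f x" for x
  proof -
    have e: "(s * a) powr p * \<bar>X x\<bar> powr p = \<bar>s * (a * X x)\<bar> powr p"
      using s a by (simp add: powr_mult abs_mult mult.assoc)
    show ?thesis
    proof (cases "a * X x \<le> b")
      case True
      then have "s * (a * X x) \<le> s * b" using s by simp
      from exp_le_quadratic_power[OF this s(2) p]
      have "exp (s * (a * X x)) \<le> 1 + s * a * X x + ?e * \<bar>X x\<bar> powr p"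
        by (simp add: e mult.assoc)
      then have "exp (- (s * m * a)) * exp (s * (a * X x)) \<le> ?f x" by (intro mult_left_mono) auto
      then show ?thesis using True by (simp add: exp_add[symmetric] algebra_simps)
    next
      case False
      then have "s * b \<le> s * (a * X x)" using s by simp
      then have "0 \<le> s * a * X x" using s(2) by (simp add: mult.assoc)
      then have "0 \<le> 1 + s * a * X x + ?e * \<bar>X x\<bar> powr p" by simp
      then have "0 \<le> ?f x" by (intro mult_nonneg_nonneg) auto
      then show ?thesis using False by simp
    qed
  qed
  have f0: "0 \<le> ?f x" for x using pt[of x] by (auto split: if_splits intro: order_trans[OF _ pt[of x]])
  have int: "integrable L ?f"
    using X Xp by (intro integrable_mult_right Bochner_Integration.integrable_add) auto
  have "(\<integral>\<^sup>+x. ennreal (if a * X x \<le> b then exp (s * (a * X x - m * a)) else 0) \<partial>L) \<le> (\<integral>\<^sup>+x. ennreal (?f x) \<partial>L)"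
    by (intro nn_integral_mono ennreal_leI pt)
  also have "\<dots> = ennreal (\<integral>x. ?f x \<partial>L)" using int f0 by (intro nn_integral_eq_integral) auto
  also have "(\<integral>x. ?f x \<partial>L) = exp (- (s * m * a)) * (1 + s * a * integral\<^sup>L L X + ?e * (\<integral>x. \<bar>X x\<bar> powr p \<partial>L))"
    using X Xp by (simp add: prob_space)
  also have "\<dots> \<le> exp (- (s * m * a)) * (1 + s * a * m + ?e * B)"
    using X Xp s a by (intro mult_left_mono add_mono mult_nonneg_nonneg) auto
  also have "\<dots> \<le> exp (- (s * m * a)) * exp (s * a * m + ?e * B)"
    using exp_ge_add_one_self[of "s * a * m + ?e * B"] by (intro mult_left_mono) (auto simp: add.assoc)
  also have "\<dots> = exp (exp (s * b) * s powr p * B * a powr p)"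
    using s a by (simp add: exp_add[symmetric] powr_mult algebra_simps)
  finally show ?thesis by (simp add: ennreal_leI)
qed

text \<open>
  The exponential Markov inequality for the summands below the level \<open>b\<close>.  The partial products have
  expectations bounded by the product of \<open>truncated_exponential_moment\<close>, and Fatou's lemma passes to
  the infinite series.
\<close>

lemma fuk_nagaev:
  fixes X :: "'l \<Rightarrow> real"
  assumes X: "integrable L X" "integral\<^sup>L L X \<le> m"
    and Xp: "integrable L (\<lambda>x. \<bar>X x\<bar> powr p)" "(\<integral>x. \<bar>X x\<bar> powr p \<partial>L) \<le> B"
    and p: "1 < p" "p \<le> 2" and c: "\<And>j. 0 \<le> c j" "summable c" and s: "0 < s" "1 \<le> s * b"
  shows "emeasure PL {g\<in>space PL. (\<forall>j. c j * X (g j) \<le> b) \<and> (\<Sum>j. c j * X (g j)) - m * (\<Sum>j. c j) > \<mu>}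
    \<le> ennreal (fn_bound p B c s b \<mu>)"
proof -
  have [measurable]: "X \<in> borel_measurable L" using X by auto
  let ?E = "{g\<in>space PL. (\<forall>j. c j * X (g j) \<le> b) \<and> (\<Sum>j. c j * X (g j)) - m * (\<Sum>j. c j) > \<mu>}"
  have [measurable]: "?E \<in> sets PL" by measurable
  define f where "f j x = ennreal (if c j * X x \<le> b then exp (s * (c j * X x - m * c j)) else 0)" for j x
  have [measurable]: "f j \<in> borel_measurable L" for j unfolding f_def by measurable
  have B0: "0 \<le> B" by (rule order_trans[OF _ Xp(2)]) simp
  define K where "K = exp (s * b) * s powr p * B"
  have K0: "0 \<le> K" unfolding K_def using B0 by simp
  have sp: "summable (\<lambda>j. c j powr p)" using c p by (intro summable_powr_of_summable) auto
  let ?T = "ennreal (exp (K * (\<Sum>j. c j powr p)))"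
  have le: "(\<integral>\<^sup>+g. (\<Prod>j<n. f j (g j)) \<partial>PL) \<le> ?T" for n
  proof -
    have "(\<integral>\<^sup>+g. (\<Prod>j<n. f j (g j)) \<partial>PL) = (\<Prod>j<n. \<integral>\<^sup>+x. f j x \<partial>L)"
      by (rule nn_integral_prod_coordinates) simp
    also have "\<dots> \<le> (\<Prod>j<n. ennreal (exp (K * c j powr p)))"
    proof (induction n)
      case (Suc n)
      have "(\<integral>\<^sup>+x. f n x \<partial>L) \<le> ennreal (exp (K * c n powr p))"
        unfolding f_def K_def by (rule truncated_exponential_moment[OF X Xp p c(1) s])
      then show ?case using Suc by (auto intro!: mult_mono)
    qed simp
    also have "\<dots> = ennreal (exp (\<Sum>j<n. K * c j powr p))"
      by (simp add: prod_ennreal exp_sum)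
    also have "\<dots> \<le> ?T"
      using sp K0 by (intro ennreal_leI exp_le_cancel_iff[THEN iffD2])
        (auto simp: sum_distrib_left[symmetric] intro!: mult_left_mono sum_le_suminf)
    finally show ?thesis .
  qed
  have "AE g in PL. ennreal (exp (s * \<mu>)) * indicator ?E g \<le> liminf (\<lambda>n. \<Prod>j<n. f j (g j))"
    using AE_summable_weighted[OF X(1) c]
  proof eventually_elim
    case (elim g)
    show ?case
    proof (cases "g \<in> ?E")
      case True
      have sm: "summable (\<lambda>j. c j * X (g j))"
        using elim c by (intro summable_rabs_cancel[of "\<lambda>j. c j * X (g j)"]) (simp add: abs_mult)
      have "(\<lambda>n. \<Sum>j<n. c j * X (g j) - m * c j) \<longlonglongrightarrow> (\<Sum>j. c j * X (g j)) - m * (\<Sum>j. c j)"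
        using sums_diff[OF summable_sums[OF sm] sums_mult[OF summable_sums[OF c(2)], of m]] by (simp add: sums_def)
      then have "(\<lambda>n. ennreal (exp (s * (\<Sum>j<n. c j * X (g j) - m * c j)))) \<longlonglongrightarrow> ennreal (exp (s * ((\<Sum>j. c j * X (g j)) - m * (\<Sum>j. c j))))"
        by (intro tendsto_ennrealI tendsto_exp tendsto_mult tendsto_const)
      moreover have "(\<Prod>j<n. f j (g j)) = ennreal (exp (s * (\<Sum>j<n. c j * X (g j) - m * c j)))" for n
        using True unfolding f_def by (simp add: prod_ennreal exp_sum sum_distrib_left)
      ultimately have "liminf (\<lambda>n. \<Prod>j<n. f j (g j)) = ennreal (exp (s * ((\<Sum>j. c j * X (g j)) - m * (\<Sum>j. c j))))"
        by (simp add: lim_imp_Liminf)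
      then show ?thesis using True s by (auto intro!: ennreal_leI)
    qed auto
  qed
  then have "(\<integral>\<^sup>+g. ennreal (exp (s * \<mu>)) * indicator ?E g \<partial>PL) \<le> (\<integral>\<^sup>+g. liminf (\<lambda>n. \<Prod>j<n. f j (g j)) \<partial>PL)"
    by (rule nn_integral_mono_AE)
  also have "\<dots> \<le> liminf (\<lambda>n. \<integral>\<^sup>+g. (\<Prod>j<n. f j (g j)) \<partial>PL)"
    by (rule nn_integral_liminf) simp
  also have "\<dots> \<le> ?T" by (rule Liminf_le) (auto intro!: always_eventually le)
  finally have "ennreal (exp (s * \<mu>)) * emeasure PL ?E \<le> ?T"
    by (simp add: nn_integral_cmult)
  then have "ennreal (exp (- (s * \<mu>))) * (ennreal (exp (s * \<mu>)) * emeasure PL ?E) \<le> ennreal (exp (- (s * \<mu>))) * ?T"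
    by (intro mult_left_mono) auto
  then show ?thesis
    by (simp add: mult.assoc[symmetric] ennreal_mult[symmetric] exp_add[symmetric] fn_bound_def K_def)
qed

text \<open>
  In the analysis of one big jump \<open>c\<^sub>k X\<^sub>k\<close>, \<open>rest\<close> bounds the contribution of all other summands.
\<close>

definition rest :: "('l \<Rightarrow> real) \<Rightarrow> (nat \<Rightarrow> real) \<Rightarrow> nat \<Rightarrow> (nat \<Rightarrow> 'l) \<Rightarrow> ennreal" where
  "rest X c k g = (\<Sum>j. ennreal (if j = k then 0 else \<bar>c j * X (g j)\<bar>))"

text \<open>
  The expected number of summands above \<open>y\<close>, that is, the union bound for the presence of such a
  summand.
\<close>

definition jump_mass :: "('l \<Rightarrow> real) \<Rightarrow> (nat \<Rightarrow> real) \<Rightarrow> real \<Rightarrow> ennreal" where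
  "jump_mass X c y = (\<Sum>k. emeasure L {x\<in>space L. c k * X x > y})"

lemma measurable_rest[measurable]:
  assumes [measurable]: "X \<in> borel_measurable L"
  shows "rest X c k \<in> borel_measurable PL"
  unfolding rest_def by (intro borel_measurable_suminf_order) (auto split: if_split)

lemma emeasure_rest_le:
  assumes X: "integrable L X" and c: "\<And>j. 0 \<le> c j" "summable c" and y: "0 < y"
  shows "emeasure PL {g\<in>space PL. rest X c k g > ennreal y} \<le> ennreal ((\<integral>x. \<bar>X x\<bar> \<partial>L) * (\<Sum>j. c j) / y)"
proof -
  have [measurable]: "X \<in> borel_measurable L" using X by auto
  have "(\<integral>\<^sup>+g. rest X c k g \<partial>PL) \<le> (\<integral>\<^sup>+g. (\<Sum>j. ennreal (c j) * ennreal \<bar>X (g j)\<bar>) \<partial>PL)"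
    unfolding rest_def using c
    by (intro nn_integral_mono suminf_le) (auto simp: abs_mult ennreal_mult)
  also have "\<dots> = (\<Sum>j. ennreal (c j)) * (\<integral>\<^sup>+x. ennreal \<bar>X x\<bar> \<partial>L)"
    by (rule nn_integral_weighted_sum) simp
  also have "\<dots> = ennreal ((\<Sum>j. c j) * (\<integral>x. \<bar>X x\<bar> \<partial>L))"
    using X c by (simp add: suminf_ennreal2 nn_integral_eq_integral ennreal_mult suminf_nonneg)
  finally have le: "(\<integral>\<^sup>+g. rest X c k g \<partial>PL) \<le> ennreal ((\<Sum>j. c j) * (\<integral>x. \<bar>X x\<bar> \<partial>L))" .
  have "emeasure PL {g\<in>space PL. rest X c k g > ennreal y} \<le> emeasure PL {g\<in>space PL. 1 \<le> ennreal (1 / y) * rest X c k g}"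
  proof (intro emeasure_mono subsetI)
    fix g assume g: "g \<in> {g\<in>space PL. rest X c k g > ennreal y}"
    have "1 = ennreal (1 / y) * ennreal y" using y by (simp add: ennreal_mult[symmetric])
    also have "\<dots> \<le> ennreal (1 / y) * rest X c k g" using g by (intro mult_left_mono) auto
    finally show "g \<in> {g\<in>space PL. 1 \<le> ennreal (1 / y) * rest X c k g}" using g by auto
  qed auto
  also have "\<dots> \<le> ennreal (1 / y) * (\<integral>\<^sup>+g. rest X c k g * indicator (space PL) g \<partial>PL)"
    by (rule nn_integral_Markov_inequality) auto
  also have "\<dots> = ennreal (1 / y) * (\<integral>\<^sup>+g. rest X c k g \<partial>PL)"
    by (simp cong: nn_integral_cong)
  also have "\<dots> \<le> ennreal (1 / y) * ennreal ((\<Sum>j. c j) * (\<integral>x. \<bar>X x\<bar> \<partial>L))"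
    by (intro mult_left_mono le) auto
  also have "\<dots> = ennreal ((\<integral>x. \<bar>X x\<bar> \<partial>L) * (\<Sum>j. c j) / y)"
    using y c by (simp add: ennreal_mult[symmetric] suminf_nonneg mult.commute)
  finally show ?thesis .
qed

lemma rest_fun_upd: "rest X c k (g(k := x)) = rest X c k g"
  unfolding rest_def by (intro suminf_cong) auto

text \<open>
  A jump of the summand \<open>k\<close> is independent of the other summands.
\<close>

lemma emeasure_jump_and_rest:
  assumes [measurable]: "X \<in> borel_measurable L" "Measurable.pred borel P"
  shows "emeasure PL {g\<in>space PL. c k * X (g k) > y \<and> P (rest X c k g)}
    = emeasure L {x\<in>space L. c k * X x > y} * emeasure PL {g\<in>space PL. P (rest X c k g)}"
proof -
  let ?A = "{x\<in>space L. c k * X x > y}" and ?B = "{g\<in>space PL. P (rest X c k g)}"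
  have [measurable]: "?A \<in> sets L" "?B \<in> sets PL" by measurable
  have "emeasure PL {g\<in>space PL. c k * X (g k) > y \<and> P (rest X c k g)}
    = (\<integral>\<^sup>+g. indicator {g\<in>space PL. c k * X (g k) > y \<and> P (rest X c k g)} g \<partial>PL)"
    by (subst nn_integral_indicator) auto
  also have "\<dots> = (\<integral>\<^sup>+g. (if c k * X (g k) > y then 1 else 0) * (if P (rest X c k g) then 1 else 0) \<partial>PL)"
    by (intro nn_integral_cong) (auto simp: indicator_def)
  also have "\<dots> = (\<integral>\<^sup>+x. (if c k * X x > y then 1 else 0) \<partial>L) * (\<integral>\<^sup>+g. (if P (rest X c k g) then 1 else 0) \<partial>PL)"
    by (rule nn_integral_split_coordinate[where h = "\<lambda>x. if c k * X x > y then 1 else 0"]) (auto simp: rest_fun_upd)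
  also have "(\<integral>\<^sup>+x. (if c k * X x > y then 1 else 0) \<partial>L) = (\<integral>\<^sup>+x. indicator ?A x \<partial>L)"
    by (intro nn_integral_cong) (auto simp: indicator_def)
  also have "(\<integral>\<^sup>+g. (if P (rest X c k g) then 1 else 0) \<partial>PL) = (\<integral>\<^sup>+g. indicator ?B g \<partial>PL)"
    by (intro nn_integral_cong) (auto simp: indicator_def)
  finally show ?thesis by simp
qed

text \<open>
  If the mean \<open>m \<Sum> c\<^sub>j\<close> stays below \<open>(1 - 2 \<delta>) x\<close>, the sum can exceed \<open>x\<close> in three ways: without any
  summand above \<open>b\<close>, which is a large deviation; by one summand above \<open>(1 - 2 \<delta>) x\<close>; or by a
  summand above \<open>b\<close> together with a contribution larger than \<open>\<delta> x\<close> of the others.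
\<close>

lemma upper_tail_fixed_weights:
  fixes X :: "'l \<Rightarrow> real"
  assumes X: "integrable L X" "integral\<^sup>L L X \<le> m"
    and Xp: "integrable L (\<lambda>x. \<bar>X x\<bar> powr p)" "(\<integral>x. \<bar>X x\<bar> powr p \<partial>L) \<le> B"
    and p: "1 < p" "p \<le> 2" and c: "\<And>j. 0 \<le> c j" "summable c" and s: "0 < s" "1 \<le> s * b"
    and d: "0 < \<delta>" "0 < x" and q: "q \<le> \<delta> * x" and mean: "m * (\<Sum>j. c j) \<le> (1 - 2 * \<delta>) * x"
    and r: "\<And>k. emeasure PL {g\<in>space PL. rest X c k g > ennreal (\<delta> * x)} \<le> r"
  shows "emeasure PL {g\<in>space PL. q + (\<Sum>j. c j * X (g j)) > x}
    \<le> ennreal (fn_bound p B c s b (\<delta> * x)) + jump_mass X c ((1 - 2 * \<delta>) * x) + jump_mass X c b * r"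
proof -
  have [measurable]: "X \<in> borel_measurable L" using X by auto
  let ?S = "\<lambda>g. \<Sum>j. c j * X (g j)"
  let ?E0 = "{g\<in>space PL. (\<forall>j. c j * X (g j) \<le> b) \<and> ?S g - m * (\<Sum>j. c j) > \<delta> * x}"
  let ?E1 = "\<lambda>k. {g\<in>space PL. c k * X (g k) > (1 - 2 * \<delta>) * x}"
  let ?E2 = "\<lambda>k. {g\<in>space PL. c k * X (g k) > b \<and> rest X c k g > ennreal (\<delta> * x)}"
  have sub: "{g\<in>space PL. q + ?S g > x} \<subseteq> (?E0 \<union> (\<Union>k. ?E1 k)) \<union> (\<Union>k. ?E2 k)"
  proof
    fix g assume g: "g \<in> {g\<in>space PL. q + ?S g > x}"
    then have S: "?S g > (1 - \<delta>) * x" using q by (simp add: algebra_simps)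
    show "g \<in> (?E0 \<union> (\<Union>k. ?E1 k)) \<union> (\<Union>k. ?E2 k)"
    proof (rule ccontr)
      assume n: "\<not> ?thesis"
      have gs: "g \<in> space PL" using g by simp
      have n0: "g \<notin> ?E0" using n by blast
      have n1: "c k * X (g k) \<le> (1 - 2 * \<delta>) * x" for k
        using n gs by (simp add: not_less)
      have n2: "rest X c k g \<le> ennreal (\<delta> * x)" if "c k * X (g k) > b" for k
      proof -
        have "g \<notin> ?E2 k" using n by blast
        then show ?thesis using gs that by (simp add: not_less)
      qed
      have "?S g - m * (\<Sum>j. c j) > \<delta> * x" using S mean by (simp add: algebra_simps)
      then obtain k where "c k * X (g k) > b" using n0 gs by (auto simp: not_le)
      then have "rest X c k g \<le> ennreal (\<delta> * x)" by (rule n2)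
      then have "\<bar>?S g - c k * X (g k)\<bar> \<le> \<delta> * x"
        using d unfolding rest_def by (intro suminf_off_index) auto
      then show False using S n1[of k] by (simp add: algebra_simps)
    qed
  qed
  have "emeasure PL {g\<in>space PL. q + ?S g > x} \<le> emeasure PL ((?E0 \<union> (\<Union>k. ?E1 k)) \<union> (\<Union>k. ?E2 k))"
    by (intro emeasure_mono sub) measurable
  also have "\<dots> \<le> emeasure PL (?E0 \<union> (\<Union>k. ?E1 k)) + emeasure PL (\<Union>k. ?E2 k)"
    by (intro emeasure_subadditive) measurable
  also have "\<dots> \<le> (emeasure PL ?E0 + emeasure PL (\<Union>k. ?E1 k)) + emeasure PL (\<Union>k. ?E2 k)"
    by (intro add_right_mono emeasure_subadditive) measurable
  also have "\<dots> \<le> (ennreal (fn_bound p B c s b (\<delta> * x)) + (\<Sum>k. emeasure PL (?E1 k))) + (\<Sum>k. emeasure PL (?E2 k))"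
    by (intro add_mono fuk_nagaev[OF X Xp p c s] emeasure_subadditive_countably) (auto simp: image_subset_iff)
  also have "(\<Sum>k. emeasure PL (?E1 k)) = jump_mass X c ((1 - 2 * \<delta>) * x)"
    unfolding jump_mass_def using emeasure_jump_and_rest[where P = "\<lambda>_. True"] by (simp add: PL.emeasure_space_1)
  also have "(\<Sum>k. emeasure PL (?E2 k)) \<le> (\<Sum>k. emeasure L {x\<in>space L. c k * X x > b} * r)"
    by (intro suminf_le) (auto simp: emeasure_jump_and_rest[where P = "\<lambda>z. z > _"] intro!: mult_left_mono r)
  also have "\<dots> = jump_mass X c b * r" unfolding jump_mass_def by simp
  finally show ?thesis by (simp add: add_mono)
qed

text \<open>
  The events that the summand \<open>k\<close> alone exceeds \<open>(1 + 2 \<delta>) x\<close> and all others together stay below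
  \<open>\<delta> x\<close> are disjoint for different \<open>k\<close>, so their probabilities add up.
\<close>

lemma lower_tail_one_jump:
  fixes X :: "'l \<Rightarrow> real"
  assumes X[measurable]: "X \<in> borel_measurable L" and d: "0 < \<delta>" "0 < x" and q: "- (\<delta> * x) \<le> q"
    and r: "\<And>k. r \<le> emeasure PL {g\<in>space PL. rest X c k g \<le> ennreal (\<delta> * x)}"
  shows "jump_mass X c ((1 + 2 * \<delta>) * x) * r \<le> emeasure PL {g\<in>space PL. q + (\<Sum>j. c j * X (g j)) > x}"
proof -
  let ?S = "\<lambda>g. \<Sum>j. c j * X (g j)"
  let ?E = "\<lambda>k. {g\<in>space PL. c k * X (g k) > (1 + 2 * \<delta>) * x \<and> rest X c k g \<le> ennreal (\<delta> * x)}"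
  have disj: "disjoint_family ?E"
  proof (unfold disjoint_family_on_def, intro ballI impI)
    fix k l :: nat assume kl: "k \<noteq> l"
    show "?E k \<inter> ?E l = {}"
    proof (rule ccontr)
      assume "?E k \<inter> ?E l \<noteq> {}"
      then obtain g where g: "c k * X (g k) > (1 + 2 * \<delta>) * x" "rest X c l g \<le> ennreal (\<delta> * x)" by auto
      have "ennreal (c k * X (g k)) \<le> ennreal (if k = l then 0 else \<bar>c k * X (g k)\<bar>)"
        using kl by (auto intro!: ennreal_leI)
      also have "\<dots> = (\<Sum>j\<in>{k}. ennreal (if j = l then 0 else \<bar>c j * X (g j)\<bar>))" by simp
      also have "\<dots> \<le> rest X c l g" unfolding rest_def by (rule sum_le_suminf) auto
      finally have "ennreal (c k * X (g k)) \<le> ennreal (\<delta> * x)" using g(2) by (rule order_trans)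
      then have "c k * X (g k) \<le> \<delta> * x" using d by (simp add: ennreal_le_iff)
      moreover have "\<delta> * x \<le> (1 + 2 * \<delta>) * x" using d by (intro mult_right_mono) auto
      ultimately show False using g(1) by linarith
    qed
  qed
  have "jump_mass X c ((1 + 2 * \<delta>) * x) * r = (\<Sum>k. emeasure L {y\<in>space L. c k * X y > (1 + 2 * \<delta>) * x} * r)"
    unfolding jump_mass_def by simp
  also have "\<dots> \<le> (\<Sum>k. emeasure PL (?E k))"
    by (intro suminf_le) (auto simp: emeasure_jump_and_rest[where P = "\<lambda>z. z \<le> _"] intro!: mult_left_mono r)
  also have "\<dots> = emeasure PL (\<Union>k. ?E k)"
    by (intro suminf_emeasure disj) (auto simp: image_subset_iff)
  also have "\<dots> \<le> emeasure PL {g\<in>space PL. q + ?S g > x}"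
  proof (intro emeasure_mono subsetI)
    fix g assume "g \<in> (\<Union>k. ?E k)"
    then obtain k where g: "g \<in> space PL" "c k * X (g k) > (1 + 2 * \<delta>) * x" "rest X c k g \<le> ennreal (\<delta> * x)" by auto
    have "\<bar>?S g - c k * X (g k)\<bar> \<le> \<delta> * x"
      using d g(3) unfolding rest_def by (intro suminf_off_index) auto
    then show "g \<in> {g\<in>space PL. q + ?S g > x}" using g q by (simp add: algebra_simps)
  qed measurable
  finally show ?thesis .
qed

text \<open>
  If the mean exceeds \<open>(1 + 2 \<delta>) x\<close>, the sum can miss \<open>x\<close> only by a downward deviation, which is an
  upward deviation for the variables \<open>-X\<^sub>j\<close>.
\<close>

lemma lower_tail_large_mean:
  fixes X :: "'l \<Rightarrow> real"
  assumes X: "integrable L X" "m \<le> integral\<^sup>L L X"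
    and Xp: "integrable L (\<lambda>x. \<bar>X x\<bar> powr p)" "(\<integral>x. \<bar>X x\<bar> powr p \<partial>L) \<le> B"
    and p: "1 < p" "p \<le> 2" and c: "\<And>j. 0 \<le> c j" "summable c" and s: "0 < s" "1 \<le> s * b"
    and q: "- (\<delta> * x) \<le> q" and mean: "(1 + 2 * \<delta>) * x < m * (\<Sum>j. c j)"
  shows "emeasure PL {g\<in>space PL. \<not> q + (\<Sum>j. c j * X (g j)) > x}
    \<le> ennreal (fn_bound p B c s b (\<delta> * x)) + jump_mass (\<lambda>x. - X x) c b"
proof -
  have [measurable]: "X \<in> borel_measurable L" using X by auto
  let ?S = "\<lambda>g. \<Sum>j. c j * X (g j)"
  let ?E0 = "{g\<in>space PL. (\<forall>j. c j * - X (g j) \<le> b) \<and> (\<Sum>j. c j * - X (g j)) - - m * (\<Sum>j. c j) > \<delta> * x}"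
  let ?E1 = "\<lambda>k. {g\<in>space PL. c k * - X (g k) > b}"
  have "AE g in PL. g \<in> {g\<in>space PL. \<not> q + ?S g > x} \<longrightarrow> g \<in> ?E0 \<union> (\<Union>k. ?E1 k)"
    using AE_summable_weighted[OF X(1) c]
  proof eventually_elim
    case (elim g)
    have sm: "summable (\<lambda>j. c j * X (g j))"
      using elim c by (intro summable_rabs_cancel[of "\<lambda>j. c j * X (g j)"]) (simp add: abs_mult)
    have "(\<Sum>j. c j * - X (g j)) = - ?S g" using suminf_minus[OF sm] by simp
    then show ?case using q mean by (auto simp: algebra_simps not_le)
  qed
  then have "emeasure PL {g\<in>space PL. \<not> q + ?S g > x} \<le> emeasure PL (?E0 \<union> (\<Union>k. ?E1 k))"
    by (rule emeasure_mono_AE) measurable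
  also have "\<dots> \<le> emeasure PL ?E0 + emeasure PL (\<Union>k. ?E1 k)"
    by (intro emeasure_subadditive) measurable
  also have "\<dots> \<le> ennreal (fn_bound p B c s b (\<delta> * x)) + (\<Sum>k. emeasure PL (?E1 k))"
    using X Xp by (intro add_mono fuk_nagaev[OF _ _ _ _ p c s] emeasure_subadditive_countably) (auto simp: image_subset_iff)
  also have "(\<Sum>k. emeasure PL (?E1 k)) = jump_mass (\<lambda>x. - X x) c b"
    unfolding jump_mass_def using emeasure_jump_and_rest[where P = "\<lambda>_. True" and X = "\<lambda>x. - X x"] by (simp add: PL.emeasure_space_1)
  finally show ?thesis .
qed

text \<open>
  Jensen's inequality for a concave power, up to the factor 2: where \<open>t > a\<close>, the power \<open>t\<^sup>r\<close> is at
  most \<open>a\<^bsup>r - 1\<^esup> t\<close>.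
\<close>

lemma nn_integral_powr_le:
  fixes f :: "'b \<Rightarrow> real"
  assumes M: "prob_space M" and [measurable]: "f \<in> borel_measurable M" and f: "\<And>x. 0 \<le> f x"
    and a: "0 < a" "(\<integral>\<^sup>+x. ennreal (f x) \<partial>M) \<le> ennreal a" and r: "0 \<le> r" "r \<le> 1"
  shows "(\<integral>\<^sup>+x. ennreal (f x powr r) \<partial>M) \<le> ennreal (2 * a powr r)"
proof -
  interpret M: prob_space M by fact
  have pt: "t powr r \<le> a powr r + a powr (r - 1) * t" if "0 \<le> t" for t
  proof (cases "t \<le> a")
    case True
    then have "t powr r \<le> a powr r" using that r by (intro powr_mono2) auto
    then show ?thesis using that by (simp add: add_increasing2)
  next
    case False
    have "t powr r = t powr (r - 1) * t" using False a powr_mult_base[of t "r - 1"] by (simp add: mult.commute)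
    also have "\<dots> \<le> a powr (r - 1) * t" using False a r by (intro mult_right_mono powr_mono2') auto
    finally show ?thesis by (simp add: add_increasing)
  qed
  have "(\<integral>\<^sup>+x. ennreal (f x powr r) \<partial>M) \<le> (\<integral>\<^sup>+x. ennreal (a powr r) + ennreal (a powr (r - 1)) * ennreal (f x) \<partial>M)"
    using pt[OF f] f by (intro nn_integral_mono) (simp add: ennreal_plus[symmetric] ennreal_mult[symmetric] del: ennreal_plus)
  also have "\<dots> = ennreal (a powr r) + ennreal (a powr (r - 1)) * (\<integral>\<^sup>+x. ennreal (f x) \<partial>M)"
    by (simp add: nn_integral_add nn_integral_cmult M.emeasure_space_1)
  also have "\<dots> \<le> ennreal (a powr r) + ennreal (a powr (r - 1)) * ennreal a"
    by (intro add_left_mono mult_left_mono a) auto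
  also have "\<dots> = ennreal (2 * a powr r)"
    using a by (simp add: ennreal_plus[symmetric] ennreal_mult[symmetric] powr_mult_base mult.commute[of _ a] del: ennreal_plus)
  finally show ?thesis .
qed

text \<open>
  Write \<open>y\<close> for the sum of the \<open>y\<^sub>i = c\<^sub>i X\<^sub>i\<close>.  Then \<open>y\<^sup>p = \<Sum> y\<^sub>i y\<^bsup>p - 1\<^esup> \<le> \<Sum> y\<^sub>i\<^sup>p + \<Sum> y\<^sub>i r\<^sub>i\<^bsup>p - 1\<^esup>\<close>,
  where \<open>r\<^sub>i\<close> is the sum without \<open>y\<^sub>i\<close>, because \<open>p - 1 \<le> 1\<close>.  In the second sum the factors are
  independent.  The constant 1 in front of \<open>\<Sum> c\<^sub>i\<^sup>p\<close> is what matters: it makes the estimate contract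
  when \<open>\<rho>\<^sub>p < 1\<close>.
\<close>

lemma powr_moment_fixed_weights:
  fixes X :: "'l \<Rightarrow> real"
  assumes [measurable]: "X \<in> borel_measurable L" and X: "\<And>x. 0 \<le> X x" "(\<integral>\<^sup>+x. ennreal (X x) \<partial>L) \<le> ennreal m"
    and m: "0 < m" and p: "1 < p" "p \<le> 2" and c: "\<And>j. 0 \<le> c j" "summable c"
  shows "(\<integral>\<^sup>+g. ennreal ((\<Sum>j. c j * X (g j)) powr p) \<partial>PL)
    \<le> (\<Sum>j. ennreal (c j powr p)) * (\<integral>\<^sup>+x. ennreal (X x powr p) \<partial>L) + ennreal (2 * m powr p * (\<Sum>j. c j) powr p)"
proof (cases "(\<Sum>j. c j) = 0")
  case True
  then have "c j = 0" for j using suminf_eq_zero_iff[OF c(2,1)] by auto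
  then show ?thesis by simp
next
  case False
  define Z where "Z = (\<Sum>j. c j)"
  have Z: "Z > 0" unfolding Z_def using False suminf_nonneg[OF c(2,1)] by simp
  have intX: "integrable L X" using X by (intro integrableI_nonneg) (auto simp: top_unique intro: le_less_trans)
  define e where "e = (\<integral>\<^sup>+x. ennreal (X x powr p) \<partial>L)"
  define R where "R i g = (\<Sum>j. if j = i then 0 else c j * X (g j))" for i g
  have [measurable]: "R i \<in> borel_measurable PL" for i
    unfolding R_def by (intro borel_measurable_suminf) (auto split: if_split)
  define R' where "R' i g = \<bar>R i g\<bar>" for i g
  have [measurable]: "R' i \<in> borel_measurable PL" for i unfolding R'_def by measurable
  have R'upd: "R' i (g(i := x)) = R' i g" for i g x
    unfolding R'_def R_def by (intro arg_cong[where f = abs] suminf_cong) auto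
  have sumr: "AE g in PL. summable (\<lambda>j. c j * X (g j))"
    using AE_summable_weighted[OF intX c] X by simp
  have pt: "AE g in PL. ennreal ((\<Sum>j. c j * X (g j)) powr p)
    \<le> (\<Sum>i. ennreal (c i powr p) * ennreal (X (g i) powr p) + ennreal (c i) * (ennreal (X (g i)) * ennreal (R' i g powr (p - 1))))"
    using sumr
  proof eventually_elim
    case (elim g)
    let ?y = "\<lambda>j. c j * X (g j)"
    let ?S = "\<Sum>j. ?y j"
    have y0: "0 \<le> ?y j" for j using c X by simp
    have S0: "0 \<le> ?S" using elim y0 by (intro suminf_nonneg) auto
    have Ri: "?S = ?y i + R' i g" for i
    proof -
      have s: "summable (\<lambda>j. if j = i then 0 else ?y j)"
        by (rule summable_comparison_test[OF _ elim]) (use y0 in auto)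
      have "0 \<le> R i g" unfolding R_def using y0 by (intro suminf_nonneg s) auto
      have "?S = (\<Sum>j. (if j = i then ?y i else 0) + (if j = i then 0 else ?y j))"
        by (intro suminf_cong) auto
      also have "\<dots> = ?y i + R i g"
        unfolding R_def using sums_unique[OF sums_add[OF sums_single[of i "\<lambda>_. ?y i"] summable_sums[OF s]]] by simp
      finally show ?thesis using \<open>0 \<le> R i g\<close> by (simp add: R'_def)
    qed
    have "ennreal (?S powr p) = ennreal (?S * ?S powr (p - 1))"
      using S0 by (cases "?S = 0") (auto simp: powr_mult_base)
    also have "\<dots> = (\<Sum>i. ennreal (?y i)) * ennreal (?S powr (p - 1))"
      using S0 y0 elim by (simp add: ennreal_mult suminf_ennreal2)
    also have "\<dots> = (\<Sum>i. ennreal (?y i) * ennreal (?S powr (p - 1)))" by simp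
    also have "\<dots> \<le> (\<Sum>i. ennreal (c i powr p) * ennreal (X (g i) powr p) + ennreal (c i) * (ennreal (X (g i)) * ennreal (R' i g powr (p - 1))))"
    proof (intro suminf_le)
      fix i
      have "?y i * ?S powr (p - 1) \<le> ?y i * (?y i powr (p - 1) + R' i g powr (p - 1))"
        using y0 p by (subst Ri[of i], intro mult_left_mono powr_add_subadditive) (auto simp: R'_def)
      also have "\<dots> = ?y i powr p + c i * (X (g i) * R' i g powr (p - 1))"
      proof -
        have "?y i * ?y i powr (p - 1) = ?y i powr p" using y0[of i] by (cases "?y i = 0") (auto simp: powr_mult_base)
        then show ?thesis by (simp add: distrib_left mult.assoc)
      qed
      also have "\<dots> = c i powr p * X (g i) powr p + c i * (X (g i) * R' i g powr (p - 1))"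
        using c X by (simp add: powr_mult)
      finally have "ennreal (?y i * ?S powr (p - 1)) \<le> ennreal \<dots>" by (rule ennreal_leI)
      then show "ennreal (?y i) * ennreal (?S powr (p - 1)) \<le> ennreal (c i powr p) * ennreal (X (g i) powr p) + ennreal (c i) * (ennreal (X (g i)) * ennreal (R' i g powr (p - 1)))"
        using y0 c X by (simp add: ennreal_plus[symmetric] ennreal_mult[symmetric] del: ennreal_plus)
    qed auto
    finally show ?case .
  qed
  have ER: "(\<integral>\<^sup>+g. ennreal (R' i g) \<partial>PL) \<le> ennreal (m * Z)" for i
  proof -
    have "AE g in PL. ennreal (R' i g) \<le> (\<Sum>j. ennreal (c j) * ennreal (X (g j)))"
      using sumr
    proof eventually_elim
      case (elim g)
      have y0: "0 \<le> c j * X (g j)" for j using c X by simp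
      have s: "summable (\<lambda>j. if j = i then 0 else c j * X (g j))"
        by (rule summable_comparison_test[OF _ elim]) (use y0 in auto)
      have "R' i g = R i g" unfolding R'_def R_def using y0 by (intro abs_of_nonneg suminf_nonneg s) auto
      also have "\<dots> \<le> (\<Sum>j. c j * X (g j))" unfolding R_def using y0 by (intro suminf_le s elim) auto
      finally have "ennreal (R' i g) \<le> ennreal (\<Sum>j. c j * X (g j))" by (rule ennreal_leI)
      also have "\<dots> = (\<Sum>j. ennreal (c j) * ennreal (X (g j)))"
        using y0 c X elim by (subst suminf_ennreal2[symmetric]) (auto simp: ennreal_mult)
      finally show ?case .
    qed
    then have "(\<integral>\<^sup>+g. ennreal (R' i g) \<partial>PL) \<le> (\<integral>\<^sup>+g. (\<Sum>j. ennreal (c j) * ennreal (X (g j))) \<partial>PL)"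
      by (rule nn_integral_mono_AE)
    also have "\<dots> = (\<Sum>j. ennreal (c j)) * (\<integral>\<^sup>+x. ennreal (X x) \<partial>L)"
      by (rule nn_integral_weighted_sum) simp
    also have "\<dots> \<le> ennreal Z * ennreal m"
      using c X unfolding Z_def by (intro mult_mono) (auto simp: suminf_ennreal2)
    also have "\<dots> = ennreal (m * Z)" using Z m by (simp add: ennreal_mult mult.commute)
    finally show ?thesis .
  qed
  have ERp: "(\<integral>\<^sup>+g. ennreal (R' i g powr (p - 1)) \<partial>PL) \<le> ennreal (2 * (m * Z) powr (p - 1))" for i
    using p m Z by (intro nn_integral_powr_le[OF PL.prob_space_axioms _ _ _ ER]) (auto simp: R'_def)
  have "(\<integral>\<^sup>+g. ennreal ((\<Sum>j. c j * X (g j)) powr p) \<partial>PL)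
    \<le> (\<integral>\<^sup>+g. (\<Sum>i. ennreal (c i powr p) * ennreal (X (g i) powr p) + ennreal (c i) * (ennreal (X (g i)) * ennreal (R' i g powr (p - 1)))) \<partial>PL)"
    by (rule nn_integral_mono_AE[OF pt])
  also have "\<dots> = (\<Sum>i. \<integral>\<^sup>+g. ennreal (c i powr p) * ennreal (X (g i) powr p) + ennreal (c i) * (ennreal (X (g i)) * ennreal (R' i g powr (p - 1))) \<partial>PL)"
    by (rule nn_integral_suminf) measurable
  also have "\<dots> = (\<Sum>i. ennreal (c i powr p) * e + ennreal (c i) * ((\<integral>\<^sup>+x. ennreal (X x) \<partial>L) * (\<integral>\<^sup>+g. ennreal (R' i g powr (p - 1)) \<partial>PL)))"
  proof (intro suminf_cong)
    fix i
    have 1: "(\<integral>\<^sup>+g. ennreal (X (g i) powr p) \<partial>PL) = e"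
      unfolding e_def by (rule nn_integral_coordinate) simp
    have 2: "(\<integral>\<^sup>+g. ennreal (X (g i)) * ennreal (R' i g powr (p - 1)) \<partial>PL)
      = (\<integral>\<^sup>+x. ennreal (X x) \<partial>L) * (\<integral>\<^sup>+g. ennreal (R' i g powr (p - 1)) \<partial>PL)"
      by (rule nn_integral_split_coordinate) (auto simp: R'upd)
    show "(\<integral>\<^sup>+g. ennreal (c i powr p) * ennreal (X (g i) powr p) + ennreal (c i) * (ennreal (X (g i)) * ennreal (R' i g powr (p - 1))) \<partial>PL)
      = ennreal (c i powr p) * e + ennreal (c i) * ((\<integral>\<^sup>+x. ennreal (X x) \<partial>L) * (\<integral>\<^sup>+g. ennreal (R' i g powr (p - 1)) \<partial>PL))"
      by (subst nn_integral_add) (auto simp: nn_integral_cmult 1 2)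
  qed
  also have "\<dots> \<le> (\<Sum>i. ennreal (c i powr p) * e + ennreal (c i) * (ennreal m * ennreal (2 * (m * Z) powr (p - 1))))"
    by (intro suminf_le add_left_mono mult_left_mono mult_mono X ERp) auto
  also have "\<dots> = (\<Sum>i. ennreal (c i powr p) * e) + (\<Sum>i. ennreal (c i) * (ennreal m * ennreal (2 * (m * Z) powr (p - 1))))"
    by (intro suminf_add[symmetric] summableI)
  also have "\<dots> = (\<Sum>i. ennreal (c i powr p)) * e + ennreal Z * (ennreal m * ennreal (2 * (m * Z) powr (p - 1)))"
    using c by (simp add: Z_def suminf_ennreal2)
  also have "ennreal Z * (ennreal m * ennreal (2 * (m * Z) powr (p - 1))) = ennreal (2 * m powr p * Z powr p)"
  proof -
    have "Z * (m * (2 * (m * Z) powr (p - 1))) = 2 * ((m * Z) * (m * Z) powr (p - 1))" by simp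
    also have "\<dots> = 2 * m powr p * Z powr p" using m Z by (subst powr_mult_base) (auto simp: powr_mult)
    finally show ?thesis using m Z by (simp add: ennreal_mult[symmetric])
  qed
  finally show ?thesis by (simp add: Z_def e_def)
qed

end

section \<open>Random weights\<close>

text \<open>
  The number \<open>\<rho>\<^sub>\<beta>\<close> as an extended real.
\<close>

definition weight_moment :: "'v measure \<Rightarrow> (nat \<Rightarrow> 'v \<Rightarrow> real) \<Rightarrow> real \<Rightarrow> ennreal" where
  "weight_moment D c \<beta> = (\<integral>\<^sup>+v. (\<Sum>j. ennreal (c j v powr \<beta>)) \<partial>D)"

text \<open>
  With \<open>\<Sum> c\<^sub>j\<^sup>p = x\<^bsup>p - \<gamma>\<^esup>\<close>, truncation at \<open>\<kappa> x\<close> and deviation \<open>\<delta> x\<close>, choose \<open>s\<close> so that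
  \<open>exp (s \<kappa> x) = x\<^bsup>\<gamma> / 2\<^esup>\<close>.  The second term of the exponent then tends to 0, and the first one equals
  \<open>-(\<alpha> + 1) ln x\<close> by the choice of \<open>\<kappa>\<close>.
\<close>

lemma (in regular_tail) fuk_nagaev_negligible:
  assumes "0 < \<delta>" "0 < \<gamma>" "1 < p"
  defines "\<kappa> \<equiv> \<gamma> * \<delta> / (2 * (\<alpha> + 1))"
  defines "s \<equiv> \<lambda>x. \<gamma> / 2 * ln x / (\<kappa> * x)"
  shows "((\<lambda>x. exp (- (s x * (\<delta> * x)) + exp (s x * (\<kappa> * x)) * s x powr p * B * x powr (p - \<gamma>)) / G x) \<longlongrightarrow> 0) at_top"
proof -
  have k: "\<kappa> > 0" using assms index_pos by (simp add: \<kappa>_def)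
  have 1: "((\<lambda>x::real. exp (B * ((\<gamma> / (2 * \<kappa>)) * ln x) powr p * x powr (- (\<gamma> / 2)))) \<longlongrightarrow> exp 0) at_top"
  proof (rule tendsto_exp)
    define a b where "a = \<gamma> / (2 * \<kappa>)" and "b = \<gamma> / 2"
    have "a > 0" "b > 0" unfolding a_def b_def using k assms(2) by simp_all
    then have "((\<lambda>x::real. B * (a * ln x) powr p * x powr (- b)) \<longlongrightarrow> 0) at_top"
      by real_asymp
    then show "((\<lambda>x::real. B * ((\<gamma> / (2 * \<kappa>)) * ln x) powr p * x powr (- (\<gamma> / 2))) \<longlongrightarrow> 0) at_top"
      by (simp add: a_def b_def)
  qed
  have 2: "((\<lambda>x. x powr (- (\<alpha> + 1)) / G x) \<longlongrightarrow> 0) at_top" by (rule power_negligible) simp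
  have lim: "((\<lambda>x. x powr (- (\<alpha> + 1)) / G x * exp (B * ((\<gamma> / (2 * \<kappa>)) * ln x) powr p * x powr (- (\<gamma> / 2)))) \<longlongrightarrow> 0) at_top"
    using tendsto_mult[OF 2 1] by simp
  show ?thesis
  proof (rule Lim_transform_eventually[OF lim])
    show "\<forall>\<^sub>F x in at_top. x powr (- (\<alpha> + 1)) / G x * exp (B * ((\<gamma> / (2 * \<kappa>)) * ln x) powr p * x powr (- (\<gamma> / 2)))
      = exp (- (s x * (\<delta> * x)) + exp (s x * (\<kappa> * x)) * s x powr p * B * x powr (p - \<gamma>)) / G x"
      using eventually_gt_at_top[of 1]
    proof eventually_elim
      case (elim x)
      have "s x * (\<delta> * x) = (\<alpha> + 1) * ln x"
        using k elim assms index_pos by (simp add: s_def \<kappa>_def field_simps)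
      then have e1: "exp (- (s x * (\<delta> * x))) = x powr (- (\<alpha> + 1))"
        using elim by (simp add: powr_def algebra_simps)
      have "s x * (\<kappa> * x) = \<gamma> / 2 * ln x" using k elim by (simp add: s_def)
      then have e2: "exp (s x * (\<kappa> * x)) = x powr (\<gamma> / 2)" using elim by (simp add: powr_def)
      have "s x = (\<gamma> / (2 * \<kappa>) * ln x) / x" using k elim by (simp add: s_def)
      then have "s x powr p = ((\<gamma> / (2 * \<kappa>) * ln x) / x) powr p" by (simp only:)
      also have "\<dots> = (\<gamma> / (2 * \<kappa>) * ln x) powr p * x powr (- p)"
        using k elim assms(2) by (subst powr_divide) (simp_all add: powr_minus_divide)
      finally have e3: "s x powr p = (\<gamma> / (2 * \<kappa>) * ln x) powr p * x powr (- p)" .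
      have "exp (s x * (\<kappa> * x)) * s x powr p * B * x powr (p - \<gamma>)
        = B * (\<gamma> / (2 * \<kappa>) * ln x) powr p * (x powr (\<gamma> / 2) * x powr (- p) * x powr (p - \<gamma>))"
        unfolding e2 e3 by (simp add: mult_ac)
      also have "x powr (\<gamma> / 2) * x powr (- p) * x powr (p - \<gamma>) = x powr (- (\<gamma> / 2))"
        by (simp add: powr_add[symmetric])
      finally have e4: "exp (s x * (\<kappa> * x)) * s x powr p * B * x powr (p - \<gamma>)
        = B * (\<gamma> / (2 * \<kappa>) * ln x) powr p * x powr (- (\<gamma> / 2))" .
      show ?case unfolding exp_add e1 e4 by simp
    qed
  qed
qed

text \<open>
  The measure \<open>D\<close> is the law of the root vector, with \<open>q\<close> and \<open>c\<^sub>0, c\<^sub>1, \<dots>\<close> its components, and \<open>L\<close> carries a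
  single summand \<open>X\<close>.  The right-hand side of the recursion lives on the product of \<open>D\<close> with countably
  many copies of \<open>L\<close>.  Summability of the weights is required at every point; \<open>vec_weight\<close>
  below provides such a version.
\<close>

locale branching_law = iid_sequence L + D: prob_space D
  for L :: "'l measure" and D :: "'v measure" +
  fixes q :: "'v \<Rightarrow> real" and c :: "nat \<Rightarrow> 'v \<Rightarrow> real" and \<alpha> \<epsilon> p :: real
  assumes measurable_q[measurable]: "q \<in> borel_measurable D"
    and measurable_c[measurable]: "\<And>j. c j \<in> borel_measurable D"
    and c_nonneg: "\<And>j v. 0 \<le> c j v" and c_summable: "\<And>v. summable (\<lambda>j. c j v)"
    and alpha: "1 < \<alpha>" and eps: "0 < \<epsilon>" and p: "1 < p" "p \<le> 2" "p < \<alpha>"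
    and moment_1: "weight_moment D c 1 < 1"
    and moment_alpha: "weight_moment D c \<alpha> < 1"
    and moment_eps: "weight_moment D c (\<alpha> + \<epsilon>) < \<infinity>"
    and q_moment: "integrable D (\<lambda>v. \<bar>q v\<bar> powr (\<alpha> + \<epsilon>))"
    and tail: "regular_tail (\<lambda>x. \<P>(v in D. x < (\<Sum>j. c j v))) \<alpha>"
begin

abbreviation "DL \<equiv> D \<Otimes>\<^sub>M PL"
abbreviation "offspring X z \<equiv> (\<Sum>j. c j (fst z) * X (snd z j))"
abbreviation "mean_jumps X z \<equiv> \<integral>\<^sup>+v. jump_mass X (\<lambda>k. c k v) z \<partial>D"

definition Z :: "'v \<Rightarrow> real" where "Z v = (\<Sum>j. c j v)"
definition V :: "real \<Rightarrow> 'v \<Rightarrow> real" where "V \<beta> v = (\<Sum>j. c j v powr \<beta>)"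
definition G :: "real \<Rightarrow> real" where "G x = \<P>(v in D. x < Z v)"
definition \<rho> :: "real \<Rightarrow> real" where "\<rho> \<beta> = enn2real (weight_moment D c \<beta>)"

sublocale regular_tail G \<alpha>
  using tail by (simp add: G_def[abs_def] Z_def)

lemma measurable_Z[measurable]: "Z \<in> borel_measurable D" unfolding Z_def by measurable
lemma measurable_V[measurable]: "V \<beta> \<in> borel_measurable D" unfolding V_def by measurable

lemma measurable_G[measurable]: "G \<in> borel_measurable borel"
proof -
  have "mono (\<lambda>x. - G x)"
    unfolding G_def by (intro monoI le_imp_neg_le D.finite_measure_mono) auto
  then have "(\<lambda>x. - (- G x)) \<in> borel_measurable borel"
    by (intro borel_measurable_uminus borel_measurable_mono)
  then show ?thesis by simp
qed

lemma G_nonneg: "0 \<le> G x" by (simp add: G_def)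

lemma Z_nonneg: "0 \<le> Z v" unfolding Z_def by (intro suminf_nonneg c_summable c_nonneg)

lemma V_summable: "1 \<le> \<beta> \<Longrightarrow> summable (\<lambda>j. c j v powr \<beta>)"
  by (intro summable_powr_of_summable c_summable c_nonneg)

lemma ennreal_V: "1 \<le> \<beta> \<Longrightarrow> ennreal (V \<beta> v) = (\<Sum>j. ennreal (c j v powr \<beta>))"
  unfolding V_def by (subst suminf_ennreal2) (auto intro: V_summable)

lemma ennreal_Z: "ennreal (Z v) = (\<Sum>j. ennreal (c j v))"
  unfolding Z_def by (subst suminf_ennreal2) (auto intro: c_summable c_nonneg)

lemma nn_integral_V: "1 \<le> \<beta> \<Longrightarrow> (\<integral>\<^sup>+v. ennreal (V \<beta> v) \<partial>D) = weight_moment D c \<beta>"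
  by (simp add: ennreal_V weight_moment_def)

lemma nn_integral_Z: "(\<integral>\<^sup>+v. ennreal (Z v) \<partial>D) = weight_moment D c 1"
  using c_nonneg by (simp add: ennreal_Z weight_moment_def)

lemma rho_bounds: "0 \<le> \<rho> 1" "\<rho> 1 < 1" "0 \<le> \<rho> \<alpha>" "\<rho> \<alpha> < 1"
proof -
  have "enn2real x < 1" if "x < 1" for x :: ennreal
    using that by (cases x) (auto simp: ennreal_1[symmetric] ennreal_less_iff simp del: ennreal_1)
  then show "0 \<le> \<rho> 1" "\<rho> 1 < 1" "0 \<le> \<rho> \<alpha>" "\<rho> \<alpha> < 1"
    using moment_1 moment_alpha unfolding \<rho>_def by auto
qed

lemma weight_moment_eq: "weight_moment D c 1 = ennreal (\<rho> 1)" "weight_moment D c \<alpha> = ennreal (\<rho> \<alpha>)"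
  "weight_moment D c (\<alpha> + \<epsilon>) = ennreal (\<rho> (\<alpha> + \<epsilon>))"
proof -
  have "x = ennreal (enn2real x)" if "x < 1" for x :: ennreal
    using that by (cases x) auto
  then show "weight_moment D c 1 = ennreal (\<rho> 1)" "weight_moment D c \<alpha> = ennreal (\<rho> \<alpha>)"
    unfolding \<rho>_def using moment_1 moment_alpha by auto
qed (use moment_eps in \<open>auto simp: \<rho>_def less_top[symmetric]\<close>)

text \<open>
  The function \<open>\<beta> \<mapsto> \<rho>\<^sub>\<beta>\<close> is convex, and \<open>p\<close> lies between 1 and \<open>\<alpha>\<close>.
\<close>

lemma weight_moment_p: "weight_moment D c p < 1"
proof -
  define t where "t = (\<alpha> - p) / (\<alpha> - 1)"
  have t: "0 < t" "t < 1" using alpha p by (auto simp: t_def)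
  have pt: "p = t * 1 + (1 - t) * \<alpha>"
  proof -
    have "t * (\<alpha> - 1) = \<alpha> - p" using alpha by (simp add: t_def)
    then show ?thesis by (simp add: algebra_simps)
  qed
  have le: "a powr p \<le> t * a + (1 - t) * a powr \<alpha>" if "0 \<le> a" for a
  proof (cases "a = 0")
    case False
    then have "a powr p = a powr t * (a powr \<alpha>) powr (1 - t)"
      using that by (simp add: pt powr_add[symmetric] powr_powr mult.commute)
    also have "\<dots> \<le> t * a + (1 - t) * a powr \<alpha>"
      using t False that by (intro Youngs_inequality_0) auto
    finally show ?thesis .
  qed auto
  have "weight_moment D c p \<le> (\<integral>\<^sup>+v. (\<Sum>j. ennreal t * ennreal (c j v powr 1) + ennreal (1 - t) * ennreal (c j v powr \<alpha>)) \<partial>D)"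
    unfolding weight_moment_def using le t c_nonneg
    by (intro nn_integral_mono suminf_le) (auto simp: ennreal_mult[symmetric] ennreal_plus[symmetric] simp del: ennreal_plus intro!: ennreal_leI)
  also have "\<dots> = (\<integral>\<^sup>+v. (\<Sum>j. ennreal t * ennreal (c j v powr 1)) + (\<Sum>j. ennreal (1 - t) * ennreal (c j v powr \<alpha>)) \<partial>D)"
    by (intro nn_integral_cong suminf_add[symmetric] summableI)
  also have "\<dots> = ennreal t * weight_moment D c 1 + ennreal (1 - t) * weight_moment D c \<alpha>"
    unfolding weight_moment_def by (simp add: nn_integral_add nn_integral_cmult)
  also have "\<dots> = ennreal (t * \<rho> 1 + (1 - t) * \<rho> \<alpha>)"
    using t rho_bounds by (simp add: weight_moment_eq ennreal_mult[symmetric] ennreal_plus[symmetric] del: ennreal_plus)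
  also have "\<dots> < ennreal 1"
  proof (rule ennreal_lessI)
    have "t * \<rho> 1 < t * 1" "(1 - t) * \<rho> \<alpha> < (1 - t) * 1" using t rho_bounds by (intro mult_strict_left_mono; simp)+
    then show "t * \<rho> 1 + (1 - t) * \<rho> \<alpha> < 1" by (simp only: mult_1_right)
  qed simp
  finally show ?thesis by simp
qed

text \<open>
  Dyadic decomposition: \<open>P(Z > 2\<^sup>n)\<close> decays like \<open>2\<^bsup>-n b\<^esup>\<close> for every \<open>b < \<alpha>\<close>, in particular for
  some \<open>b > p\<close>.
\<close>

lemma Z_moment_p: "(\<integral>\<^sup>+v. ennreal (Z v powr p) \<partial>D) < \<infinity>"
proof -
  define b where "b = (p + \<alpha>) / 2"
  have b: "p < b" "b < \<alpha>" "0 < b" using p by (auto simp: b_def)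
  obtain A where A: "A > 0" "\<And>x. x > 0 \<Longrightarrow> G x \<le> A * x powr (- b)" using tail_upper_power[OF b(3,2)] by auto
  let ?I = "\<lambda>n. {v\<in>space D. 2 ^ n < Z v}"
  have pt: "ennreal (Z v powr p) \<le> 1 + (\<Sum>n. ennreal ((2 ^ Suc n) powr p) * indicator (?I n) v)" if v: "v \<in> space D" for v
  proof (cases "Z v \<le> 1")
    case True
    then have "Z v powr p \<le> 1 powr p" using Z_nonneg p by (intro powr_mono2) auto
    then have "ennreal (Z v powr p) \<le> 1" by (simp add: ennreal_le_1)
    then show ?thesis by (rule order_trans) simp
  next
    case False
    obtain N where N: "Z v < 2 ^ N" using real_arch_pow[of 2 "Z v"] by auto
    define k where "k = (LEAST k. Z v \<le> (2::real) ^ k)"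
    have k: "Z v \<le> 2 ^ k" unfolding k_def by (rule LeastI[of _ N]) (use N in simp)
    have "k \<noteq> 0" using k False by (intro notI) simp
    then obtain n where n: "k = Suc n" by (cases k) auto
    have n': "2 ^ n < Z v"
      using not_less_Least[of n "\<lambda>k. Z v \<le> (2::real) ^ k"] n unfolding k_def by auto
    have "Z v powr p \<le> (2 ^ Suc n) powr p" using k n Z_nonneg p by (intro powr_mono2) auto
    then have "ennreal (Z v powr p) \<le> (\<Sum>j\<in>{n}. ennreal ((2 ^ Suc j) powr p) * indicator (?I j) v)"
      using n' v by (auto intro!: ennreal_leI)
    also have "\<dots> \<le> (\<Sum>n. ennreal ((2 ^ Suc n) powr p) * indicator (?I n) v)"
      by (rule sum_le_suminf) auto
    finally show ?thesis by (rule order_trans) simp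
  qed
  have "(\<integral>\<^sup>+v. ennreal (Z v powr p) \<partial>D) \<le> (\<integral>\<^sup>+v. 1 + (\<Sum>n. ennreal ((2 ^ Suc n) powr p) * indicator (?I n) v) \<partial>D)"
    by (rule nn_integral_mono) (rule pt)
  also have "\<dots> = 1 + (\<Sum>n. ennreal ((2 ^ Suc n) powr p) * emeasure D (?I n))"
    by (simp add: nn_integral_add nn_integral_suminf nn_integral_cmult D.emeasure_space_1)
  also have "\<dots> \<le> 1 + (\<Sum>n. ennreal (2 powr p * A * (2 powr (p - b)) ^ n))"
  proof (intro add_left_mono suminf_le)
    fix n
    have e: "(2 ^ n) powr t = (2 powr t) ^ n" for t :: real
      by (simp add: powr_realpow[symmetric] powr_powr powr_powr mult.commute)
    have "ennreal ((2 ^ Suc n) powr p) * emeasure D (?I n) = ennreal ((2 ^ Suc n) powr p * G (2 ^ n))"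
      by (simp add: D.emeasure_eq_measure G_def ennreal_mult)
    also have "(2 ^ Suc n) powr p * G (2 ^ n) \<le> (2 ^ Suc n) powr p * (A * (2 ^ n) powr (- b))"
      by (intro mult_left_mono A) auto
    also have "\<dots> = 2 powr p * A * ((2 ^ n) powr p * (2 ^ n) powr (- b))" by (simp add: powr_mult)
    also have "(2 ^ n) powr p * (2 ^ n) powr (- b) = ((2 ^ n) powr (p - b) :: real)" by (simp add: powr_add[symmetric])
    also have "\<dots> = (2 powr (p - b)) ^ n" by (rule e)
    finally show "ennreal ((2 ^ Suc n) powr p) * emeasure D (?I n) \<le> ennreal (2 powr p * A * (2 powr (p - b)) ^ n)"
      by (simp add: ennreal_leI)
  qed auto
  also have "\<dots> < \<infinity>"
  proof -
    have "summable (\<lambda>n. 2 powr p * A * (2 powr (p - b)) ^ n)"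
      using b powr_less_mono[of "p - b" 0 2] by (intro summable_mult summable_geometric) auto
    then show ?thesis using A by (subst suminf_ennreal2) (auto simp: ennreal_add_less_top)
  qed
  finally show ?thesis .
qed

text \<open>
  The value \<open>G (z / a)\<close> bounds \<open>P(a X > z)\<close> up to a constant.  A zero weight produces no jump, which
  division by zero would not reflect.
\<close>

definition tail_at :: "real \<Rightarrow> real \<Rightarrow> real" where
  "tail_at a z = (if a = 0 then 0 else G (z / a))"

lemma tail_at_nonneg: "0 \<le> tail_at a z" by (simp add: tail_at_def G_nonneg)

lemma measurable_tail_at[measurable]: "tail_at a \<in> borel_measurable borel" "(\<lambda>a. tail_at a z) \<in> borel_measurable borel"
  unfolding tail_at_def by measurable

definition kernel :: "('v \<Rightarrow> real) \<Rightarrow> real \<Rightarrow> ennreal" where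
  "kernel w z = (\<integral>\<^sup>+v. ennreal (w v) * (\<Sum>k. ennreal (tail_at (c k v) z)) \<partial>D)"

text \<open>
  Dominated convergence on \<open>\<nat> \<times> D\<close>.  Potter's bounds with the exponents 1 and \<open>\<alpha> + \<epsilon>\<close> provide the
  integrable majorant, since \<open>\<rho>\<^sub>1\<close> and \<open>\<rho>\<^bsub>\<alpha> + \<epsilon>\<^esub>\<close> are finite.  The factor \<open>w\<close> allows to restrict to events;
  if it tends to 0 pointwise, the restricted kernel is \<open>o(G x)\<close>.
\<close>

lemma kernel_limit:
  assumes y: "0 < y" and w[measurable]: "\<And>x. w x \<in> borel_measurable D"
    and w01: "\<And>x v. 0 \<le> w x v" "\<And>x v. w x v \<le> 1" and lim: "\<And>v. ((\<lambda>x. w x v) \<longlongrightarrow> w0) at_top"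
  shows "((\<lambda>x. enn2real (kernel (w x) (y * x)) / G x) \<longlongrightarrow> w0 * \<rho> \<alpha> * y powr (- \<alpha>)) at_top"
    and "\<forall>\<^sub>F x in at_top. kernel (w x) (y * x) < \<infinity>"
proof -
  let ?M = "count_space (UNIV :: nat set) \<Otimes>\<^sub>M D"
  have nn: "(\<integral>\<^sup>+z. ennreal (u (fst z) (snd z)) \<partial>?M) = (\<integral>\<^sup>+v. (\<Sum>k. ennreal (u k v)) \<partial>D)"
    if [measurable]: "\<And>k. u k \<in> borel_measurable D" for u :: "nat \<Rightarrow> 'v \<Rightarrow> real"
  proof -
    have [measurable]: "(\<lambda>z. u (fst z) (snd z)) \<in> borel_measurable ?M"
      by (rule measurable_pair_measure_countable1) auto
    have "(\<integral>\<^sup>+z. ennreal (u (fst z) (snd z)) \<partial>?M) = (\<integral>\<^sup>+k. \<integral>\<^sup>+v. ennreal (u k v) \<partial>D \<partial>count_space UNIV)"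
      by (subst D.nn_integral_fst[symmetric]) auto
    also have "\<dots> = (\<Sum>k. \<integral>\<^sup>+v. ennreal (u k v) \<partial>D)" by (rule nn_integral_count_space_nat)
    also have "\<dots> = (\<integral>\<^sup>+v. (\<Sum>k. ennreal (u k v)) \<partial>D)" by (rule nn_integral_suminf[symmetric]) auto
    finally show ?thesis .
  qed
  have meas: "(\<lambda>z. u (fst z) (snd z)) \<in> borel_measurable ?M"
    if "\<And>k. u k \<in> borel_measurable D" for u :: "nat \<Rightarrow> 'v \<Rightarrow> real"
    by (rule measurable_pair_measure_countable1) (use that in auto)
  obtain A x0 where A: "A > 0" "x0 \<ge> 1"
    and P: "\<And>x a. x \<ge> x0 \<Longrightarrow> a > 0 \<Longrightarrow> G (x / a) \<le> A * (a powr 1 + a powr (\<alpha> + \<epsilon>)) * G x"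
    using potter[of 1 "\<alpha> + \<epsilon>"] alpha eps by auto
  let ?n = "\<lambda>x k v. w x v * tail_at (c k v) (y * x)"
  let ?f = "\<lambda>x k v. ?n x k v / G x"
  let ?g = "\<lambda>k v. A * (c k v / y + (c k v / y) powr (\<alpha> + \<epsilon>))"
  let ?flim = "\<lambda>k v. w0 * y powr (- \<alpha>) * c k v powr \<alpha>"
  have bound: "?f x k v \<le> ?g k v" if x: "x \<ge> x0" for x k v
  proof (cases "c k v = 0")
    case True
    then show ?thesis by (simp add: tail_at_def)
  next
    case False
    have cp: "c k v > 0" using False c_nonneg[of k v] by simp
    have Gx: "G x > 0" using x A by (intro tail_pos) auto
    have "?n x k v \<le> 1 * G (y * x / c k v)"
      using False w01 G_nonneg by (simp add: tail_at_def mult_left_le_one_le)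
    also have "\<dots> = G (x / (c k v / y))" by (simp add: mult.commute)
    also have "\<dots> \<le> A * ((c k v / y) powr 1 + (c k v / y) powr (\<alpha> + \<epsilon>)) * G x"
      using cp y by (intro P x) auto
    also have "(c k v / y) powr 1 = c k v / y" using cp y by simp
    finally show ?thesis using Gx by (simp add: field_simps)
  qed
  have f_nonneg: "0 \<le> ?n x k v" "0 \<le> ?f x k v" for x k v
    using w01 tail_at_nonneg G_nonneg by auto
  have g_nonneg: "0 \<le> ?g k v" for k v using A c_nonneg y by auto
  have gfin: "(\<integral>\<^sup>+v. (\<Sum>k. ennreal (?g k v)) \<partial>D) < \<infinity>"
  proof -
    have "ennreal (?g k v) = ennreal (A / y) * ennreal (c k v powr 1) + ennreal (A / y powr (\<alpha> + \<epsilon>)) * ennreal (c k v powr (\<alpha> + \<epsilon>))" for k v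
    proof -
      have "?g k v = A / y * c k v powr 1 + A / y powr (\<alpha> + \<epsilon>) * c k v powr (\<alpha> + \<epsilon>)"
        using y c_nonneg[of k v] by (simp add: powr_divide distrib_left)
      also have "ennreal \<dots> = ennreal (A / y) * ennreal (c k v powr 1) + ennreal (A / y powr (\<alpha> + \<epsilon>)) * ennreal (c k v powr (\<alpha> + \<epsilon>))"
        using A y by (subst ennreal_plus) (simp_all add: ennreal_mult[symmetric])
      finally show ?thesis .
    qed
    then have "(\<integral>\<^sup>+v. (\<Sum>k. ennreal (?g k v)) \<partial>D) =
      (\<integral>\<^sup>+v. (\<Sum>k. ennreal (A / y) * ennreal (c k v powr 1)) + (\<Sum>k. ennreal (A / y powr (\<alpha> + \<epsilon>)) * ennreal (c k v powr (\<alpha> + \<epsilon>))) \<partial>D)"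
      by (simp only:) (intro nn_integral_cong suminf_add[symmetric] summableI)
    also have "\<dots> = ennreal (A / y) * weight_moment D c 1 + ennreal (A / y powr (\<alpha> + \<epsilon>)) * weight_moment D c (\<alpha> + \<epsilon>)"
      unfolding weight_moment_def by (simp add: nn_integral_add nn_integral_cmult)
    also have "\<dots> < \<infinity>" by (simp add: weight_moment_eq ennreal_mult_less_top ennreal_add_less_top)
    finally show ?thesis .
  qed
  have gm: "(\<lambda>z. ?g (fst z) (snd z)) \<in> borel_measurable ?M" by (rule meas[of ?g]) measurable
  have fm: "(\<lambda>z. ?f x (fst z) (snd z)) \<in> borel_measurable ?M" for x by (rule meas[of "?f x"]) measurable
  have fm0: "(\<lambda>z. ?flim (fst z) (snd z)) \<in> borel_measurable ?M" by (rule meas[of ?flim]) measurable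
  have gint: "integrable ?M (\<lambda>z. ?g (fst z) (snd z))"
  proof (rule integrableI_nonneg[OF gm])
    show "AE z in ?M. 0 \<le> ?g (fst z) (snd z)" by (intro always_eventually allI g_nonneg)
    have "(\<integral>\<^sup>+z. ennreal (?g (fst z) (snd z)) \<partial>?M) = (\<integral>\<^sup>+v. (\<Sum>k. ennreal (?g k v)) \<partial>D)"
      by (rule nn[of ?g]) measurable
    then show "(\<integral>\<^sup>+z. ennreal (?g (fst z) (snd z)) \<partial>?M) < \<infinity>" using gfin by (simp only:)
  qed
  have kern: "kernel (w x) (y * x) = (\<integral>\<^sup>+v. (\<Sum>k. ennreal (?n x k v)) \<partial>D)" for x
    unfolding kernel_def using w01 by (simp add: ennreal_mult tail_at_nonneg)
  have tof: "((\<lambda>x. ?f x k v) \<longlongrightarrow> ?flim k v) at_top" for k v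
  proof (cases "c k v = 0")
    case True
    then show ?thesis by (simp add: tail_at_def)
  next
    case False
    then have cp: "c k v > 0" using c_nonneg[of k v] by simp
    have "((\<lambda>x. w x v * (G (y / c k v * x) / G x)) \<longlongrightarrow> w0 * (y / c k v) powr (- \<alpha>)) at_top"
      using cp y by (intro tendsto_mult lim tail_rv) auto
    moreover have "(\<lambda>x. w x v * (G (y / c k v * x) / G x)) = (\<lambda>x. ?f x k v)"
      using False by (simp add: tail_at_def fun_eq_iff)
    moreover have "w0 * (y / c k v) powr (- \<alpha>) = ?flim k v"
      using cp y by (subst powr_divide) (simp_all add: powr_minus_divide)
    ultimately show ?thesis by (simp only:)
  qed
  have "((\<lambda>x. integral\<^sup>L ?M (\<lambda>z. ?f x (fst z) (snd z))) \<longlongrightarrow> integral\<^sup>L ?M (\<lambda>z. ?flim (fst z) (snd z))) at_top"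
  proof (rule integral_dominated_convergence_at_top[OF fm0 fm gint])
    show "\<forall>\<^sub>F x in at_top. AE z in ?M. norm (?f x (fst z) (snd z)) \<le> ?g (fst z) (snd z)"
      using eventually_ge_at_top[of x0]
    proof eventually_elim
      case (elim x)
      show ?case unfolding real_norm_def abs_of_nonneg[OF f_nonneg(2)]
        by (intro always_eventually allI bound elim)
    qed
  qed (intro always_eventually allI tof)
  moreover have "integral\<^sup>L ?M (\<lambda>z. ?f x (fst z) (snd z)) = enn2real (kernel (w x) (y * x)) / G x" for x
  proof -
    have m: "(\<lambda>z. ?n x (fst z) (snd z)) \<in> borel_measurable ?M" by (rule meas[of "?n x"]) measurable
    have "integral\<^sup>L ?M (\<lambda>z. ?n x (fst z) (snd z)) = enn2real (\<integral>\<^sup>+z. ennreal (?n x (fst z) (snd z)) \<partial>?M)"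
      using m f_nonneg by (intro integral_eq_nn_integral) auto
    also have "(\<integral>\<^sup>+z. ennreal (?n x (fst z) (snd z)) \<partial>?M) = kernel (w x) (y * x)"
      unfolding kern by (rule nn[of "?n x"]) measurable
    finally show ?thesis by simp
  qed
  moreover have "integral\<^sup>L ?M (\<lambda>z. ?flim (fst z) (snd z)) = w0 * \<rho> \<alpha> * y powr (- \<alpha>)"
  proof -
    have m: "(\<lambda>z. c (fst z) (snd z) powr \<alpha>) \<in> borel_measurable ?M" by (rule meas[of "\<lambda>k v. c k v powr \<alpha>"]) measurable
    have "integral\<^sup>L ?M (\<lambda>z. c (fst z) (snd z) powr \<alpha>) = enn2real (\<integral>\<^sup>+z. ennreal (c (fst z) (snd z) powr \<alpha>) \<partial>?M)"
      using m by (intro integral_eq_nn_integral) auto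
    also have "\<dots> = \<rho> \<alpha>" unfolding \<rho>_def weight_moment_def by (subst nn[of "\<lambda>k v. c k v powr \<alpha>"]) auto
    finally show ?thesis by simp
  qed
  ultimately show "((\<lambda>x. enn2real (kernel (w x) (y * x)) / G x) \<longlongrightarrow> w0 * \<rho> \<alpha> * y powr (- \<alpha>)) at_top" by (simp only:)
  show "\<forall>\<^sub>F x in at_top. kernel (w x) (y * x) < \<infinity>"
    using eventually_ge_at_top[of x0]
  proof eventually_elim
    case (elim x)
    have Gx: "G x > 0" using elim A by (intro tail_pos) auto
    have "kernel (w x) (y * x) \<le> (\<integral>\<^sup>+v. (\<Sum>k. ennreal (?g k v)) \<partial>D)"
      unfolding kern
    proof (intro nn_integral_mono suminf_le ennreal_leI)
      fix k v
      have "?n x k v = ?f x k v * G x" using Gx by simp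
      also have "\<dots> \<le> ?f x k v"
        by (rule mult_right_le_one_le[OF f_nonneg(2) G_nonneg tail_le_1])
      also have "\<dots> \<le> ?g k v" by (rule bound[OF elim])
      finally show "?n x k v \<le> ?g k v" .
    qed (rule summableI)+
    then show ?case using gfin by (rule le_less_trans)
  qed
qed

end

section \<open>Exceptional events of negligible probability\<close>

lemma (in prob_space) markov_prob:
  fixes f :: "'a \<Rightarrow> real"
  assumes f: "integrable M f" "\<And>x. 0 \<le> f x" and t: "0 < t"
  shows "prob {x\<in>space M. t < f x} \<le> expectation f / t"
proof -
  have [measurable]: "f \<in> borel_measurable M" using f by auto
  have "t * prob {x\<in>space M. t < f x} = (\<integral>x. t * indicator {x\<in>space M. t < f x} x \<partial>M)"
    by simp
  also have "\<dots> \<le> expectation f"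
  proof (rule integral_mono)
    show "integrable M (\<lambda>x. t * indicator {x\<in>space M. t < f x} x :: real)"
      by (intro integrable_mult_right integrable_real_indicator) (auto simp: less_top[symmetric])
    show "t * indicator {x\<in>space M. t < f x} x \<le> f x" for x
      using f(2)[of x] by (auto simp: indicator_def)
  qed (rule f)
  finally show ?thesis using t by (simp add: field_simps)
qed

lemma (in prob_space) integrable_of_powr_moment:
  fixes X :: "'a \<Rightarrow> real"
  assumes [measurable]: "X \<in> borel_measurable M" and Xp: "integrable M (\<lambda>x. \<bar>X x\<bar> powr p)" and p: "1 \<le> p"
  shows "integrable M X" "(\<integral>x. \<bar>X x\<bar> \<partial>M) \<le> 1 + (\<integral>x. \<bar>X x\<bar> powr p \<partial>M)"
proof -
  have le: "\<bar>a\<bar> \<le> 1 + \<bar>a\<bar> powr p" for a :: real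
  proof (cases "\<bar>a\<bar> \<le> 1")
    case False
    then have "\<bar>a\<bar> powr 1 \<le> \<bar>a\<bar> powr p" using p by (intro powr_mono) auto
    then show ?thesis by simp
  qed (simp add: add_increasing2)
  have i: "integrable M (\<lambda>x. 1 + \<bar>X x\<bar> powr p)" using Xp by simp
  then show 1: "integrable M X"
    by (rule Bochner_Integration.integrable_bound) (auto intro!: always_eventually order_trans[OF le])
  have "(\<integral>x. \<bar>X x\<bar> \<partial>M) \<le> (\<integral>x. 1 + \<bar>X x\<bar> powr p \<partial>M)"
    using 1 i le by (intro integral_mono) auto
  also have "\<dots> = 1 + (\<integral>x. \<bar>X x\<bar> powr p \<partial>M)" using Xp by (simp add: prob_space)
  finally show "(\<integral>x. \<bar>X x\<bar> \<partial>M) \<le> 1 + (\<integral>x. \<bar>X x\<bar> powr p \<partial>M)" .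
qed

lemma (in iid_sequence) emeasure_rest_ge:
  assumes X: "integrable L X" and c: "\<And>j. 0 \<le> c j" "summable c" and y: "0 < y"
    and r: "(\<integral>x. \<bar>X x\<bar> \<partial>L) * (\<Sum>j. c j) / y \<le> r"
  shows "ennreal (1 - r) \<le> emeasure PL {g\<in>space PL. rest X c k g \<le> ennreal y}"
proof -
  have [measurable]: "X \<in> borel_measurable L" using X by auto
  have "0 \<le> (\<integral>x. \<bar>X x\<bar> \<partial>L) * (\<Sum>j. c j) / y" using c y by (auto intro!: divide_nonneg_pos mult_nonneg_nonneg suminf_nonneg)
  then have "PL.prob {g\<in>space PL. rest X c k g > ennreal y} \<le> r"
    using emeasure_rest_le[OF X c y, of k] r by (simp add: PL.emeasure_eq_measure ennreal_le_iff)
  moreover have "PL.prob {g\<in>space PL. \<not> rest X c k g > ennreal y} = 1 - PL.prob {g\<in>space PL. rest X c k g > ennreal y}"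
    by (rule PL.prob_neg) measurable
  ultimately show ?thesis by (simp add: PL.emeasure_eq_measure not_less ennreal_leI)
qed

context branching_law
begin

lemma integrable_V: "integrable D (V (\<alpha> + \<epsilon>))"
proof (rule integrableI_nonneg)
  show "AE v in D. 0 \<le> V (\<alpha> + \<epsilon>) v"
    unfolding V_def using alpha eps by (intro always_eventually allI suminf_nonneg V_summable) auto
  show "(\<integral>\<^sup>+v. ennreal (V (\<alpha> + \<epsilon>) v) \<partial>D) < \<infinity>"
    using moment_eps alpha eps by (simp add: nn_integral_V)
qed measurable

text \<open>
  If all weights are at most \<open>x\<^bsup>1 - \<gamma>\<^esup>\<close>, then \<open>\<Sum> c\<^sub>j\<^sup>p \<le> x\<^bsup>(1 - \<gamma>) (p - 1)\<^esup> Z\<close>.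
\<close>

lemma bad_event_subset:
  assumes x: "1 \<le> x" and g: "0 < \<gamma>"
  shows "{v\<in>space D. x powr (p - \<gamma> * (p - 1) / 2) < V p v}
    \<subseteq> {v\<in>space D. x powr ((1 - \<gamma>) * (\<alpha> + \<epsilon>)) < V (\<alpha> + \<epsilon>) v} \<union> {v\<in>space D. x powr (1 + \<gamma> * (p - 1) / 2) < Z v}"
proof -
  have "V p v \<le> x powr (p - \<gamma> * (p - 1) / 2)"
    if v: "V (\<alpha> + \<epsilon>) v \<le> x powr ((1 - \<gamma>) * (\<alpha> + \<epsilon>))" "Z v \<le> x powr (1 + \<gamma> * (p - 1) / 2)" for v
  proof -
    have ck: "c k v \<le> x powr (1 - \<gamma>)" for k
    proof (rule ccontr)
      assume "\<not> c k v \<le> x powr (1 - \<gamma>)"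
      then have "(x powr (1 - \<gamma>)) powr (\<alpha> + \<epsilon>) < c k v powr (\<alpha> + \<epsilon>)"
        using alpha eps by (intro powr_less_mono2) auto
      also have "\<dots> = (\<Sum>j\<in>{k}. c j v powr (\<alpha> + \<epsilon>))" by simp
      also have "\<dots> \<le> V (\<alpha> + \<epsilon>) v"
        unfolding V_def using alpha eps by (intro sum_le_suminf V_summable) auto
      finally show False using v(1) by (simp add: powr_powr)
    qed
    have "V p v \<le> (\<Sum>k. (x powr (1 - \<gamma>)) powr (p - 1) * c k v)"
      unfolding V_def
    proof (intro suminf_le V_summable summable_mult c_summable)
      fix k
      have "c k v powr p = c k v powr (p - 1) * c k v"
        using powr_mult_base[OF c_nonneg[of k v], of "p - 1"] by (simp add: mult.commute)
      also have "\<dots> \<le> (x powr (1 - \<gamma>)) powr (p - 1) * c k v"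
        using ck[of k] c_nonneg p by (intro mult_right_mono powr_mono2) auto
      finally show "c k v powr p \<le> (x powr (1 - \<gamma>)) powr (p - 1) * c k v" .
    qed (use p in auto)
    also have "\<dots> = (x powr (1 - \<gamma>)) powr (p - 1) * Z v"
      unfolding Z_def by (rule suminf_mult[OF c_summable])
    also have "\<dots> \<le> (x powr (1 - \<gamma>)) powr (p - 1) * x powr (1 + \<gamma> * (p - 1) / 2)"
      using v(2) by (intro mult_left_mono) auto
    also have "\<dots> = x powr (p - \<gamma> * (p - 1) / 2)"
    proof -
      have "(1 - \<gamma>) * (p - 1) + (1 + \<gamma> * (p - 1) / 2) = p - \<gamma> * (p - 1) / 2" by (simp add: field_simps)
      then show ?thesis by (simp only: powr_powr powr_add[symmetric])
    qed
    finally show ?thesis .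
  qed
  then show ?thesis by (auto simp: not_less[symmetric])
qed

text \<open>
  A weight above \<open>x\<^bsup>1 - g\<^esup>\<close> has probability of order \<open>x\<^bsup>-(1 - g) (\<alpha> + \<epsilon>)\<^esup>\<close>, and \<open>Z > x\<^bsup>1 + \<gamma>\<^esup>\<close> has
  probability \<open>G (x\<^bsup>1 + \<gamma>\<^esup>)\<close>; for small \<open>g\<close> both exponents beat \<open>\<alpha>\<close>.
\<close>

lemma bad_negligible:
  obtains \<gamma> where "0 < \<gamma>" "\<gamma> < 1"
    "((\<lambda>x. \<P>(v in D. x powr (p - \<gamma>) < V p v) / G x) \<longlongrightarrow> 0) at_top"
proof -
  (* This choice leaves room: (1 - g) * (alpha + eps) = alpha + eps / 2. *)
  define g where "g = \<epsilon> / (2 * (\<alpha> + \<epsilon>))"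
  have g: "0 < g" "g < 1" using alpha eps by (auto simp: g_def)
  have ge: "(1 - g) * (\<alpha> + \<epsilon>) = \<alpha> + \<epsilon> / 2" using alpha eps by (simp add: g_def field_simps)
  define \<gamma> where "\<gamma> = g * (p - 1) / 2"
  have gam: "0 < \<gamma>" using g p by (simp add: \<gamma>_def)
  have "g * (p - 1) \<le> 1 * 1" using g p by (intro mult_mono) auto
  then have gam1: "\<gamma> < 1" by (simp add: \<gamma>_def)
  (* Any b < alpha with (1 + gamma) * b > alpha would do. *)
  define b where "b = \<alpha> / (1 + \<gamma> / 2)"
  have b: "0 < b" "b < \<alpha>" "\<alpha> < (1 + \<gamma>) * b" using gam alpha by (auto simp: b_def field_simps)
  obtain A where A: "A > 0" "\<And>x. x > 0 \<Longrightarrow> G x \<le> A * x powr (- b)" using tail_upper_power[OF b(1,2)] by auto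
  define E where "E = integral\<^sup>L D (V (\<alpha> + \<epsilon>))"
  have V0: "0 \<le> V (\<alpha> + \<epsilon>) v" for v
    unfolding V_def using alpha eps by (intro suminf_nonneg V_summable) auto
  have bound: "\<P>(v in D. x powr (p - \<gamma>) < V p v) \<le> E * x powr (- (\<alpha> + \<epsilon> / 2)) + A * x powr (- ((1 + \<gamma>) * b))" if x: "x \<ge> 1" for x
  proof -
    have "\<P>(v in D. x powr (p - \<gamma>) < V p v) \<le>
      measure D ({v\<in>space D. x powr (\<alpha> + \<epsilon> / 2) < V (\<alpha> + \<epsilon>) v} \<union> {v\<in>space D. x powr (1 + \<gamma>) < Z v})"
      using bad_event_subset[OF x g(1)] unfolding ge \<gamma>_def[symmetric] by (intro D.finite_measure_mono) auto
    also have "\<dots> \<le> \<P>(v in D. x powr (\<alpha> + \<epsilon> / 2) < V (\<alpha> + \<epsilon>) v) + \<P>(v in D. x powr (1 + \<gamma>) < Z v)"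
      by (rule measure_Un_le) measurable
    also have "\<dots> \<le> E / (x powr (\<alpha> + \<epsilon> / 2)) + A * (x powr (1 + \<gamma>)) powr (- b)"
      unfolding E_def G_def[symmetric] using x V0 by (intro add_mono D.markov_prob integrable_V A) auto
    also have "\<dots> = E * x powr (- (\<alpha> + \<epsilon> / 2)) + A * x powr (- ((1 + \<gamma>) * b))"
      by (simp only: powr_powr powr_minus_divide mult_minus_right times_divide_eq_right mult_1_right)
    finally show ?thesis .
  qed
  have "((\<lambda>x. E * (x powr (- (\<alpha> + \<epsilon> / 2)) / G x) + A * (x powr (- ((1 + \<gamma>) * b)) / G x)) \<longlongrightarrow> E * 0 + A * 0) at_top"
    using eps b by (intro tendsto_intros power_negligible) auto
  then have lim: "((\<lambda>x. E * (x powr (- (\<alpha> + \<epsilon> / 2)) / G x) + A * (x powr (- ((1 + \<gamma>) * b)) / G x)) \<longlongrightarrow> 0) at_top"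
    by simp
  have "((\<lambda>x. \<P>(v in D. x powr (p - \<gamma>) < V p v) / G x) \<longlongrightarrow> 0) at_top"
  proof (rule tendsto_sandwich[OF _ _ tendsto_const lim])
    show "\<forall>\<^sub>F x in at_top. 0 \<le> \<P>(v in D. x powr (p - \<gamma>) < V p v) / G x"
      by (intro always_eventually allI divide_nonneg_nonneg G_nonneg measure_nonneg)
    show "\<forall>\<^sub>F x in at_top. \<P>(v in D. x powr (p - \<gamma>) < V p v) / G x
      \<le> E * (x powr (- (\<alpha> + \<epsilon> / 2)) / G x) + A * (x powr (- ((1 + \<gamma>) * b)) / G x)"
      using eventually_ge_at_top[of 1]
    proof eventually_elim
      case (elim x)
      show ?case using divide_right_mono[OF bound[OF elim] G_nonneg[of x]] by (simp add: add_divide_distrib)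
    qed
  qed
  then show thesis using gam gam1 by (intro that)
qed

lemma q_negligible:
  assumes "0 < \<delta>"
  shows "((\<lambda>x. \<P>(v in D. \<delta> * x < \<bar>q v\<bar>) / G x) \<longlongrightarrow> 0) at_top"
proof -
  define E where "E = integral\<^sup>L D (\<lambda>v. \<bar>q v\<bar> powr (\<alpha> + \<epsilon>))"
  have lim: "((\<lambda>x. E * \<delta> powr (- (\<alpha> + \<epsilon>)) * (x powr (- (\<alpha> + \<epsilon>)) / G x)) \<longlongrightarrow> 0) at_top"
    using eps by (intro tendsto_mult_right_zero power_negligible) auto
  show ?thesis
  proof (rule tendsto_sandwich[OF _ _ tendsto_const lim])
    show "\<forall>\<^sub>F x in at_top. 0 \<le> \<P>(v in D. \<delta> * x < \<bar>q v\<bar>) / G x"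
      by (intro always_eventually allI divide_nonneg_nonneg G_nonneg measure_nonneg)
    show "\<forall>\<^sub>F x in at_top. \<P>(v in D. \<delta> * x < \<bar>q v\<bar>) / G x \<le> E * \<delta> powr (- (\<alpha> + \<epsilon>)) * (x powr (- (\<alpha> + \<epsilon>)) / G x)"
      using eventually_gt_at_top[of 0]
    proof eventually_elim
      case (elim x)
      have "\<P>(v in D. \<delta> * x < \<bar>q v\<bar>) \<le> \<P>(v in D. (\<delta> * x) powr (\<alpha> + \<epsilon>) < \<bar>q v\<bar> powr (\<alpha> + \<epsilon>))"
        using assms elim alpha eps by (intro D.finite_measure_mono) (auto intro!: powr_less_mono2)
      also have "\<dots> \<le> E / (\<delta> * x) powr (\<alpha> + \<epsilon>)"
        unfolding E_def using assms elim by (intro D.markov_prob q_moment) auto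
      also have "\<dots> = E * \<delta> powr (- (\<alpha> + \<epsilon>)) * x powr (- (\<alpha> + \<epsilon>))"
        using assms elim by (simp only: powr_mult powr_minus_divide times_divide_eq_right mult_1_right divide_divide_eq_left mult.commute less_imp_le)
      finally show ?case using divide_right_mono[OF _ G_nonneg[of x]] by fastforce
    qed
  qed
qed

text \<open>
  Outside this event the contribution of \<open>q\<close> is negligible, and so is the conditional mean of the sum.
  The threshold \<open>sqrt x\<close> could be any function that tends to infinity more slowly than \<open>x\<close>.
\<close>

definition large :: "real \<Rightarrow> real \<Rightarrow> 'v set" where
  "large \<delta> x = {v\<in>space D. sqrt x < Z v \<or> \<delta> * x < \<bar>q v\<bar>}"

lemma sets_large[measurable]: "large \<delta> x \<in> sets D" unfolding large_def by measurable

text \<open>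
  All error terms of one step of the recursion, collected in a form that depends on the summands only
  through the moment bound \<open>B\<close>: the level \<open>\<kappa> x\<close> of truncation, the parameter \<open>s x\<close> of the
  exponential Markov inequality, its bound \<open>F x\<close> off the event \<open>bad x\<close>, and a common majorant \<open>h x * G x\<close> with
  \<open>h\<close> tending to 0.  The kernel terms account for a jump above \<open>\<kappa> x\<close> that is accompanied by a large
  \<open>Z\<close>, or by a contribution above \<open>\<delta> x\<close> of the other summands.
\<close>

definition negligible_errors ::
    "real \<Rightarrow> real \<Rightarrow> real \<Rightarrow> (real \<Rightarrow> real) \<Rightarrow> (real \<Rightarrow> real) \<Rightarrow> (real \<Rightarrow> 'v set) \<Rightarrow> (real \<Rightarrow> real) \<Rightarrow> real \<Rightarrow> bool" where
  "negligible_errors \<delta> B \<kappa> s F bad h x0 \<longleftrightarrow>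
    0 < \<kappa> \<and> \<kappa> < 1 \<and> x0 \<ge> 1 \<and> (h \<longlongrightarrow> 0) at_top \<and> (\<forall>x. bad x \<in> sets D) \<and>
    (\<forall>x\<ge>x0. 0 < s x \<and> 1 \<le> s x * (\<kappa> * x) \<and> (1 + B) / (\<delta> * sqrt x) \<le> 1 \<and> 0 \<le> h x \<and>
      (\<forall>v\<in>space D - bad x. fn_bound p B (\<lambda>k. c k v) (s x) (\<kappa> * x) (\<delta> * x) \<le> F x) \<and>
      emeasure D {v\<in>space D. \<delta> * x < \<bar>q v\<bar>} + emeasure D (bad x) + ennreal (F x) \<le> ennreal (h x * G x) \<and>
      kernel (indicator (large \<delta> x)) (\<kappa> * x) + ennreal ((1 + B) / (\<delta> * sqrt x)) * kernel (\<lambda>_. 1) (\<kappa> * x) \<le> ennreal (h x * G x))"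

lemma negligible_errorsD:
  assumes "negligible_errors \<delta> B \<kappa> s F bad h x0"
  shows "0 < \<kappa>" "\<kappa> < 1" "x0 \<ge> 1" "(h \<longlongrightarrow> 0) at_top" "\<And>x. bad x \<in> sets D"
    and "\<And>x. x \<ge> x0 \<Longrightarrow> 0 < s x" "\<And>x. x \<ge> x0 \<Longrightarrow> 1 \<le> s x * (\<kappa> * x)"
    and "\<And>x. x \<ge> x0 \<Longrightarrow> (1 + B) / (\<delta> * sqrt x) \<le> 1" "\<And>x. x \<ge> x0 \<Longrightarrow> 0 \<le> h x"
    and "\<And>x v. x \<ge> x0 \<Longrightarrow> v \<in> space D \<Longrightarrow> v \<notin> bad x \<Longrightarrow> fn_bound p B (\<lambda>k. c k v) (s x) (\<kappa> * x) (\<delta> * x) \<le> F x"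
    and "\<And>x. x \<ge> x0 \<Longrightarrow> emeasure D {v\<in>space D. \<delta> * x < \<bar>q v\<bar>} + emeasure D (bad x) + ennreal (F x) \<le> ennreal (h x * G x)"
    and "\<And>x. x \<ge> x0 \<Longrightarrow> kernel (indicator (large \<delta> x)) (\<kappa> * x) + ennreal ((1 + B) / (\<delta> * sqrt x)) * kernel (\<lambda>_. 1) (\<kappa> * x) \<le> ennreal (h x * G x)"
  using assms unfolding negligible_errors_def by blast+

lemma negligible_errors_exist:
  assumes d: "0 < \<delta>" "\<delta> < 1 / 2" and B: "0 \<le> B"
  shows "\<exists>\<kappa> s F bad h x0. negligible_errors \<delta> B \<kappa> s F bad h x0"
proof -
  obtain \<gamma> where g: "0 < \<gamma>" "\<gamma> < 1"
    and bad_lim: "((\<lambda>x. \<P>(v in D. x powr (p - \<gamma>) < V p v) / G x) \<longlongrightarrow> 0) at_top"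
    using bad_negligible by blast
  define bad where "bad x = {v\<in>space D. x powr (p - \<gamma>) < V p v}" for x
  define \<kappa> where "\<kappa> = \<gamma> * \<delta> / (2 * (\<alpha> + 1))"
  have k0: "0 < \<kappa>" using g d alpha by (simp add: \<kappa>_def)
  have "\<gamma> * \<delta> < 1 * 1" using g d by (intro mult_strict_mono) auto
  then have k1: "\<kappa> < 1" using alpha by (simp add: \<kappa>_def)
  define s where "s x = \<gamma> / 2 * ln x / (\<kappa> * x)" for x
  define F where "F x = exp (- (s x * (\<delta> * x)) + exp (s x * (\<kappa> * x)) * s x powr p * B * x powr (p - \<gamma>))" for x
  have F_lim: "((\<lambda>x. F x / G x) \<longlongrightarrow> 0) at_top"
    unfolding F_def s_def \<kappa>_def by (rule fuk_nagaev_negligible[OF d(1) g(1) p(1)])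
  define r where "r x = (1 + B) / (\<delta> * sqrt x)" for x
  have r_lim: "(r \<longlongrightarrow> 0) at_top"
    unfolding r_def using d by real_asymp
  have w_lim: "((\<lambda>x. indicator (large \<delta> x) v :: real) \<longlongrightarrow> 0) at_top" for v
  proof (rule tendsto_eventually)
    show "\<forall>\<^sub>F x in at_top. indicator (large \<delta> x) v = (0::real)"
      using eventually_ge_at_top[of "(Z v)\<^sup>2"] eventually_ge_at_top[of "\<bar>q v\<bar> / \<delta>"]
    proof eventually_elim
      case (elim x)
      have "Z v \<le> sqrt x" using elim(1) Z_nonneg by (intro real_le_rsqrt) auto
      moreover have "\<bar>q v\<bar> \<le> \<delta> * x" using elim(2) d by (simp add: field_simps)
      ultimately show ?case by (simp add: large_def)
    qed
  qed
  define kw where "kw x = enn2real (kernel (indicator (large \<delta> x)) (\<kappa> * x))" for x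
  define k1' where "k1' x = enn2real (kernel (\<lambda>_. 1) (\<kappa> * x))" for x
  have kw_lim: "((\<lambda>x. kw x / G x) \<longlongrightarrow> 0) at_top" and kw_fin: "\<forall>\<^sub>F x in at_top. kernel (indicator (large \<delta> x)) (\<kappa> * x) < \<infinity>"
    using kernel_limit[OF k0, of "\<lambda>x. indicator (large \<delta> x)" 0] w_lim unfolding kw_def by auto
  have k1_lim: "((\<lambda>x. k1' x / G x) \<longlongrightarrow> \<rho> \<alpha> * \<kappa> powr (- \<alpha>)) at_top" and k1_fin: "\<forall>\<^sub>F x in at_top. kernel (\<lambda>_. 1) (\<kappa> * x) < \<infinity>"
    using kernel_limit[OF k0, of "\<lambda>x v. 1" 1] unfolding k1'_def by auto
  define h where "h x = \<P>(v in D. \<delta> * x < \<bar>q v\<bar>) / G x + measure D (bad x) / G x + F x / G x + kw x / G x + r x * (k1' x / G x)" for x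
  have "(h \<longlongrightarrow> 0 + 0 + 0 + 0 + 0 * (\<rho> \<alpha> * \<kappa> powr (- \<alpha>))) at_top"
    unfolding h_def[abs_def] using bad_lim unfolding bad_def[symmetric]
    by (intro tendsto_add tendsto_mult q_negligible[OF d(1)] F_lim kw_lim r_lim k1_lim)
  then have h_lim: "(h \<longlongrightarrow> 0) at_top" by simp
  have "\<forall>\<^sub>F x in at_top. x \<ge> 1 \<and> ln x \<ge> 2 / \<gamma> \<and> r x < 1 \<and> kernel (indicator (large \<delta> x)) (\<kappa> * x) < \<infinity> \<and> kernel (\<lambda>_. 1) (\<kappa> * x) < \<infinity>"
    using eventually_ge_at_top[of 1] filterlim_at_top[THEN iffD1, OF ln_at_top, rule_format, of "2 / \<gamma>"]
      order_tendstoD(2)[OF r_lim, of 1, simplified] kw_fin k1_fin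
    by eventually_elim auto
  then obtain x1 where x1: "\<And>x. x \<ge> x1 \<Longrightarrow> x \<ge> 1 \<and> ln x \<ge> 2 / \<gamma> \<and> r x < 1 \<and> kernel (indicator (large \<delta> x)) (\<kappa> * x) < \<infinity> \<and> kernel (\<lambda>_. 1) (\<kappa> * x) < \<infinity>"
    unfolding eventually_at_top_linorder by blast
  define x0 where "x0 = max 1 x1"
  have x0: "x \<ge> 1" "ln x \<ge> 2 / \<gamma>" "r x < 1" "kernel (indicator (large \<delta> x)) (\<kappa> * x) < \<infinity>" "kernel (\<lambda>_. 1) (\<kappa> * x) < \<infinity>" if "x \<ge> x0" for x
    using x1[of x] that by (auto simp: x0_def)
  have Gx: "0 < G x" if "x \<ge> x0" for x using x0(1)[OF that] by (intro tail_pos) auto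
  have r0: "0 \<le> r x" if "x \<ge> x0" for x using x0(1)[OF that] B d by (simp add: r_def)
  have F0: "0 \<le> F x" for x by (simp add: F_def)
  have kw0: "0 \<le> kw x" "0 \<le> k1' x" for x by (auto simp: kw_def k1'_def)
  have sk: "s x * (\<kappa> * x) = \<gamma> / 2 * ln x" if "x \<ge> x0" for x
    using x0(1)[OF that] k0 by (simp add: s_def)
  have s1: "1 \<le> s x * (\<kappa> * x)" if "x \<ge> x0" for x
    using x0(2)[OF that] g unfolding sk[OF that] by (simp add: field_simps)
  have s0: "0 < s x" if "x \<ge> x0" for x
  proof -
    have "0 < 2 / \<gamma>" using g by simp
    then have "0 < ln x" using x0(2)[OF that] by linarith
    then show ?thesis using x0(1)[OF that] k0 g by (simp add: s_def)
  qed
  have fn: "fn_bound p B (\<lambda>k. c k v) (s x) (\<kappa> * x) (\<delta> * x) \<le> F x" if "x \<ge> x0" "v \<in> space D" "v \<notin> bad x" for x v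
  proof -
    have "V p v \<le> x powr (p - \<gamma>)" using that by (simp add: bad_def)
    then show ?thesis unfolding fn_bound_def F_def V_def[symmetric] using B
      by (intro exp_le_cancel_iff[THEN iffD2] add_left_mono mult_left_mono) auto
  qed
  have hG: "h x * G x = \<P>(v in D. \<delta> * x < \<bar>q v\<bar>) + measure D (bad x) + F x + kw x + r x * k1' x" if "x \<ge> x0" for x
    unfolding h_def using Gx[OF that] by (simp add: distrib_right)
  have h0: "0 \<le> h x" if "x \<ge> x0" for x
    unfolding h_def using Gx[OF that] F0 kw0 r0[OF that] by (intro add_nonneg_nonneg mult_nonneg_nonneg divide_nonneg_pos) auto
  have e1: "emeasure D {v\<in>space D. \<delta> * x < \<bar>q v\<bar>} + emeasure D (bad x) + ennreal (F x) \<le> ennreal (h x * G x)" if "x \<ge> x0" for x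
    using F0 kw0 r0[OF that] unfolding D.emeasure_eq_measure hG[OF that]
    by (simp add: ennreal_plus[symmetric] del: ennreal_plus)
  have e2: "kernel (indicator (large \<delta> x)) (\<kappa> * x) + ennreal ((1 + B) / (\<delta> * sqrt x)) * kernel (\<lambda>_. 1) (\<kappa> * x) \<le> ennreal (h x * G x)" if "x \<ge> x0" for x
  proof -
    have "kernel (indicator (large \<delta> x)) (\<kappa> * x) = ennreal (kw x)" "kernel (\<lambda>_. 1) (\<kappa> * x) = ennreal (k1' x)"
      using x0(4,5)[OF that] by (auto simp: kw_def k1'_def)
    then have "kernel (indicator (large \<delta> x)) (\<kappa> * x) + ennreal ((1 + B) / (\<delta> * sqrt x)) * kernel (\<lambda>_. 1) (\<kappa> * x) = ennreal (kw x + r x * k1' x)"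
      using r0[OF that] kw0 by (simp add: r_def[symmetric] ennreal_mult)
    also have "\<dots> \<le> ennreal (h x * G x)" unfolding hG[OF that] using F0 by (intro ennreal_leI) simp
    finally show ?thesis .
  qed
  have r1: "(1 + B) / (\<delta> * sqrt x) \<le> 1" if "x \<ge> x0" for x using x0(3)[OF that] by (simp add: r_def)
  have badm: "bad x \<in> sets D" for x unfolding bad_def by measurable
  have "x0 \<ge> 1" by (simp add: x0_def)
  then have "negligible_errors \<delta> B \<kappa> s F bad h x0"
    unfolding negligible_errors_def using k0 k1 h_lim s0 s1 badm fn r1 h0 e1 e2 by blast
  then show ?thesis by blast
qed

text \<open>
  The information about the summands that the one-step estimates use besides their mean.
\<close>

definition tail_dominated :: "real \<Rightarrow> real \<Rightarrow> ('l \<Rightarrow> real) \<Rightarrow> bool" where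
  "tail_dominated B K X \<longleftrightarrow> X \<in> borel_measurable L \<and> integrable L (\<lambda>x. \<bar>X x\<bar> powr p) \<and>
    (\<integral>x. \<bar>X x\<bar> powr p \<partial>L) \<le> B \<and> 0 \<le> K \<and> (\<forall>z>0. \<P>(x in L. z < \<bar>X x\<bar>) \<le> K * G z)"

lemma jump_mass_le:
  assumes td: "tail_dominated B K X" and z: "0 < z"
  shows "jump_mass X (\<lambda>k. c k v) z \<le> ennreal K * (\<Sum>k. ennreal (tail_at (c k v) z))"
    and "jump_mass (\<lambda>x. - X x) (\<lambda>k. c k v) z \<le> ennreal K * (\<Sum>k. ennreal (tail_at (c k v) z))"
proof -
  have [measurable]: "X \<in> borel_measurable L" and K: "0 \<le> K" using td by (auto simp: tail_dominated_def)
  have main: "emeasure L {x\<in>space L. z < c k v * Y x} \<le> ennreal K * ennreal (tail_at (c k v) z)"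
    if Y: "\<And>x. Y x \<le> \<bar>X x\<bar>" for Y k
  proof (cases "c k v = 0")
    case True
    then have "{x\<in>space L. z < c k v * Y x} = {}" using z by auto
    then show ?thesis by (simp only: emeasure_empty zero_le)
  next
    case False
    then have cp: "0 < c k v" using c_nonneg[of k v] by simp
    have "emeasure L {x\<in>space L. z < c k v * Y x} \<le> emeasure L {x\<in>space L. z / c k v < \<bar>X x\<bar>}"
      using cp Y by (intro emeasure_mono) (auto simp: field_simps intro: less_le_trans mult_left_mono)
    also have "\<dots> \<le> ennreal (K * G (z / c k v))"
      unfolding emeasure_eq_measure using td z cp by (intro ennreal_leI) (simp add: tail_dominated_def)
    also have "\<dots> = ennreal K * ennreal (tail_at (c k v) z)"
      using K False G_nonneg by (simp add: tail_at_def ennreal_mult)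
    finally show ?thesis .
  qed
  show "jump_mass X (\<lambda>k. c k v) z \<le> ennreal K * (\<Sum>k. ennreal (tail_at (c k v) z))"
    "jump_mass (\<lambda>x. - X x) (\<lambda>k. c k v) z \<le> ennreal K * (\<Sum>k. ennreal (tail_at (c k v) z))"
    unfolding jump_mass_def ennreal_suminf_cmult[symmetric] by (intro suminf_le main; simp)+
qed

lemma measurable_jump_mass[measurable]:
  assumes [measurable]: "X \<in> borel_measurable L"
  shows "(\<lambda>v. jump_mass X (\<lambda>k. c k v) z) \<in> borel_measurable D"
  unfolding jump_mass_def
  by (intro borel_measurable_suminf_order measurable_emeasure) auto

lemma jump_mass_antimono:
  assumes [measurable]: "X \<in> borel_measurable L" and "z \<le> z'"
  shows "jump_mass X a z' \<le> jump_mass X a z"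
  unfolding jump_mass_def using assms(2) by (intro suminf_le emeasure_mono) auto

lemma jump_mass_kernel:
  assumes td: "tail_dominated B K X" and z: "0 < z" and [measurable]: "A \<in> sets D"
  shows "(\<integral>\<^sup>+v. indicator A v * jump_mass X (\<lambda>k. c k v) z \<partial>D) \<le> ennreal K * kernel (indicator A) z"
    and "(\<integral>\<^sup>+v. indicator A v * jump_mass (\<lambda>x. - X x) (\<lambda>k. c k v) z \<partial>D) \<le> ennreal K * kernel (indicator A) z"
proof -
  have e: "ennreal K * kernel (indicator A) z = (\<integral>\<^sup>+v. indicator A v * (ennreal K * (\<Sum>k. ennreal (tail_at (c k v) z))) \<partial>D)"
    unfolding kernel_def by (subst nn_integral_cmult[symmetric]) (auto intro!: nn_integral_cong simp: indicator_def)
  show "(\<integral>\<^sup>+v. indicator A v * jump_mass X (\<lambda>k. c k v) z \<partial>D) \<le> ennreal K * kernel (indicator A) z"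
    "(\<integral>\<^sup>+v. indicator A v * jump_mass (\<lambda>x. - X x) (\<lambda>k. c k v) z \<partial>D) \<le> ennreal K * kernel (indicator A) z"
    unfolding e by (intro nn_integral_mono mult_left_mono jump_mass_le[OF td z]; simp)+
qed

lemma kernel_const: "kernel (\<lambda>_. 1) z = kernel (indicator (space D)) z"
  unfolding kernel_def by (intro nn_integral_cong) auto

end

section \<open>One step of the recursion\<close>

context branching_law
begin

lemma emeasure_pair_sections:
  assumes [measurable]: "P \<in> measurable DL (count_space UNIV)"
  shows "emeasure DL {z\<in>space DL. P z} = (\<integral>\<^sup>+v. emeasure PL {g\<in>space PL. P (v, g)} \<partial>D)"
proof (subst PL.emeasure_pair_measure_alt)
  show "{z\<in>space DL. P z} \<in> sets DL" by measurable
  show "(\<integral>\<^sup>+v. emeasure PL (Pair v -` {z\<in>space DL. P z}) \<partial>D) = (\<integral>\<^sup>+v. emeasure PL {g\<in>space PL. P (v, g)} \<partial>D)"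
    by (intro nn_integral_cong arg_cong2[where f = emeasure]) (auto simp: space_pair_measure)
qed

lemma tail_dominatedD:
  assumes "tail_dominated B K X"
  shows "X \<in> borel_measurable L" "integrable L X" "(\<integral>x. \<bar>X x\<bar> \<partial>L) \<le> 1 + B"
    "integrable L (\<lambda>x. \<bar>X x\<bar> powr p)" "(\<integral>x. \<bar>X x\<bar> powr p \<partial>L) \<le> B" "0 \<le> K"
proof -
  show X: "X \<in> borel_measurable L" "integrable L (\<lambda>x. \<bar>X x\<bar> powr p)" "(\<integral>x. \<bar>X x\<bar> powr p \<partial>L) \<le> B" "0 \<le> K"
    using assms unfolding tail_dominated_def by blast+
  have p1: "1 \<le> p" using p by simp
  show "integrable L X" by (rule integrable_of_powr_moment(1)[OF X(1,2) p1])
  show "(\<integral>x. \<bar>X x\<bar> \<partial>L) \<le> 1 + B" using integrable_of_powr_moment(2)[OF X(1,2) p1] X(3) by linarith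
qed

lemma rest_ratio_le:
  assumes "tail_dominated B K X" "0 < \<delta>" "0 < x" "Z v \<le> sqrt x"
  shows "(\<integral>x. \<bar>X x\<bar> \<partial>L) * (\<Sum>j. c j v) / (\<delta> * x) \<le> (1 + B) / (\<delta> * sqrt x)"
proof -
  note X = tail_dominatedD[OF assms(1)]
  have "0 \<le> (\<integral>x. \<bar>X x\<bar> \<partial>L)" by simp
  moreover have "0 \<le> 1 + B" using X(3) calculation by linarith
  ultimately have "(\<integral>x. \<bar>X x\<bar> \<partial>L) * Z v \<le> (1 + B) * sqrt x"
    using X(3) assms(4) Z_nonneg by (intro mult_mono) auto
  then have "(\<integral>x. \<bar>X x\<bar> \<partial>L) * Z v / (\<delta> * x) \<le> (1 + B) * sqrt x / (\<delta> * x)"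
    using assms by (intro divide_right_mono) auto
  also have "\<dots> = (1 + B) / (\<delta> * sqrt x)"
    using assms real_sqrt_mult_self[of x] by (simp add: field_simps)
  finally show ?thesis by (simp add: Z_def)
qed

text \<open>
  Integration of \<open>upper_tail_fixed_weights\<close> over the root vector.  The function \<open>h\<close> and the threshold
  \<open>x0\<close> are chosen before the summand \<open>X\<close> and its constant \<open>K\<close>; this uniformity is what the induction over
  generations uses.
\<close>

lemma one_step_upper:
  assumes d: "0 < \<delta>" "\<delta> < 1 / 2" and m: "0 < m" and B: "0 \<le> B"
  obtains h x0 where "x0 \<ge> 1" "(h \<longlongrightarrow> 0) at_top" "\<And>x. x \<ge> x0 \<Longrightarrow> 0 \<le> h x"
    "\<And>X K x. tail_dominated B K X \<Longrightarrow> integral\<^sup>L L X \<le> m \<Longrightarrow> x \<ge> x0 \<Longrightarrow>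
      emeasure DL {z\<in>space DL. x < \<bar>q (fst z)\<bar> + offspring X z}
      \<le> mean_jumps X ((1 - 2 * \<delta>) * x) + ennreal (G ((1 - 2 * \<delta>) * x / m)) + ennreal ((1 + K) * (h x * G x))"
proof -
  obtain \<kappa> s F bad h x0 where "negligible_errors \<delta> B \<kappa> s F bad h x0"
    using negligible_errors_exist[OF d B] by blast
  note E = negligible_errorsD[OF this]
  note k = E(1-4) and badm[measurable] = E(5) and s = E(6,7) and r1 = E(8) and h0 = E(9) and fn = E(10) and e1 = E(11) and e2 = E(12)
  have main: "emeasure DL {z\<in>space DL. x < \<bar>q (fst z)\<bar> + offspring X z}
      \<le> mean_jumps X ((1 - 2 * \<delta>) * x) + ennreal (G ((1 - 2 * \<delta>) * x / m)) + ennreal ((1 + K) * (h x * G x))"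
    if td: "tail_dominated B K X" and Xm: "integral\<^sup>L L X \<le> m" and x: "x \<ge> x0" for X K x
  proof -
    note X = tail_dominatedD[OF td]
    note [measurable] = X(1)
    have xp: "0 < x" using x k by simp
    let ?Q = "{v\<in>space D. \<delta> * x < \<bar>q v\<bar>}"
    let ?M = "{v\<in>space D. (1 - 2 * \<delta>) * x / m < Z v}"
    let ?r = "ennreal ((1 + B) / (\<delta> * sqrt x))"
    let ?j = "\<lambda>v. jump_mass X (\<lambda>k. c k v) ((1 - 2 * \<delta>) * x)"
    let ?jk = "\<lambda>v. jump_mass X (\<lambda>k. c k v) (\<kappa> * x)"
    have pt: "emeasure PL {g\<in>space PL. x < \<bar>q v\<bar> + (\<Sum>j. c j v * X (g j))}
      \<le> (indicator ?Q v + indicator (bad x) v + ennreal (F x)) + indicator ?M v + ?j v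
        + (indicator (large \<delta> x) v * ?jk v + ?r * (indicator (space D) v * ?jk v))" if v: "v \<in> space D" for v
    proof (cases "v \<in> ?Q \<or> v \<in> bad x \<or> v \<in> ?M")
      case True
      have "emeasure PL {g\<in>space PL. x < \<bar>q v\<bar> + (\<Sum>j. c j v * X (g j))} \<le> 1" by (rule PL.emeasure_le_1)
      also have "(1::ennreal) \<le> indicator ?Q v + indicator (bad x) v + indicator ?M v"
        using True by (auto simp: indicator_def)
      also have "\<dots> \<le> (indicator ?Q v + indicator (bad x) v + ennreal (F x)) + indicator ?M v + ?j v
        + (indicator (large \<delta> x) v * ?jk v + ?r * (indicator (space D) v * ?jk v))"
        by (intro add_increasing2 add_mono order_refl zero_le)
      finally show ?thesis .
    next
      case False
      have q: "\<bar>q v\<bar> \<le> \<delta> * x" and nb: "v \<notin> bad x" and Zm: "m * (\<Sum>j. c j v) \<le> (1 - 2 * \<delta>) * x"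
        using False v m by (auto simp: Z_def[symmetric] field_simps not_less)
      define r where "r = (if v \<in> large \<delta> x then 1 else ?r)"
      have r: "emeasure PL {g\<in>space PL. rest X (\<lambda>k. c k v) k g > ennreal (\<delta> * x)} \<le> r" for k
      proof (cases "v \<in> large \<delta> x")
        case True
        then show ?thesis by (simp add: r_def PL.emeasure_le_1)
      next
        case False
        then have "Z v \<le> sqrt x" using v by (auto simp: large_def)
        have "emeasure PL {g\<in>space PL. rest X (\<lambda>k. c k v) k g > ennreal (\<delta> * x)} \<le> ennreal ((\<integral>x. \<bar>X x\<bar> \<partial>L) * (\<Sum>j. c j v) / (\<delta> * x))"
          using d xp by (intro emeasure_rest_le X c_nonneg c_summable) auto
        also have "\<dots> \<le> ?r" by (intro ennreal_leI rest_ratio_le[OF td d(1) xp]) fact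
        finally show ?thesis using False by (simp add: r_def)
      qed
      have "emeasure PL {g\<in>space PL. x < \<bar>q v\<bar> + (\<Sum>j. c j v * X (g j))}
        \<le> ennreal (fn_bound p B (\<lambda>k. c k v) (s x) (\<kappa> * x) (\<delta> * x)) + ?j v + ?jk v * r"
        by (rule upper_tail_fixed_weights[OF X(2) Xm X(4,5) p(1,2) c_nonneg c_summable s[OF x] d(1) xp q Zm r])
      also have "\<dots> \<le> ennreal (F x) + ?j v + (indicator (large \<delta> x) v * ?jk v + ?r * (indicator (space D) v * ?jk v))"
        using v by (intro add_mono order_refl ennreal_leI fn[OF x v nb]) (auto simp: r_def indicator_def mult.commute)
      also have "\<dots> \<le> (indicator ?Q v + indicator (bad x) v + ennreal (F x)) + indicator ?M v + ?j v
        + (indicator (large \<delta> x) v * ?jk v + ?r * (indicator (space D) v * ?jk v))"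
        by (intro add_mono order_refl add_increasing2 add_increasing zero_le)
      finally show ?thesis .
    qed
    have "emeasure DL {z\<in>space DL. x < \<bar>q (fst z)\<bar> + offspring X z}
      = (\<integral>\<^sup>+v. emeasure PL {g\<in>space PL. x < \<bar>q v\<bar> + (\<Sum>j. c j v * X (g j))} \<partial>D)"
      by (subst emeasure_pair_sections) auto
    also have "\<dots> \<le> (\<integral>\<^sup>+v. (indicator ?Q v + indicator (bad x) v + ennreal (F x)) + indicator ?M v + ?j v
        + (indicator (large \<delta> x) v * ?jk v + ?r * (indicator (space D) v * ?jk v)) \<partial>D)"
      by (rule nn_integral_mono) (rule pt)
    also have "\<dots> = (emeasure D ?Q + emeasure D (bad x) + ennreal (F x)) + emeasure D ?M + (\<integral>\<^sup>+v. ?j v \<partial>D)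
      + ((\<integral>\<^sup>+v. indicator (large \<delta> x) v * ?jk v \<partial>D) + ?r * (\<integral>\<^sup>+v. indicator (space D) v * ?jk v \<partial>D))"
      by (simp add: nn_integral_add nn_integral_cmult D.emeasure_space_1)
    also have "\<dots> \<le> ennreal (h x * G x) + emeasure D ?M + (\<integral>\<^sup>+v. ?j v \<partial>D)
      + (ennreal K * kernel (indicator (large \<delta> x)) (\<kappa> * x) + ?r * (ennreal K * kernel (\<lambda>_. 1) (\<kappa> * x)))"
      unfolding kernel_const using k xp
      by (intro add_mono order_refl e1[OF x] mult_left_mono jump_mass_kernel(1)[OF td]) auto
    also have "\<dots> = ennreal (h x * G x) + emeasure D ?M + (\<integral>\<^sup>+v. ?j v \<partial>D)
      + ennreal K * (kernel (indicator (large \<delta> x)) (\<kappa> * x) + ?r * kernel (\<lambda>_. 1) (\<kappa> * x))"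
      by (simp add: distrib_left mult_ac)
    also have "\<dots> \<le> ennreal (h x * G x) + emeasure D ?M + (\<integral>\<^sup>+v. ?j v \<partial>D) + ennreal K * ennreal (h x * G x)"
      by (intro add_mono order_refl mult_left_mono e2[OF x]) auto
    also have "\<dots> = (\<integral>\<^sup>+v. ?j v \<partial>D) + emeasure D ?M + (ennreal (h x * G x) + ennreal K * ennreal (h x * G x))"
      by (simp add: ac_simps)
    also have "ennreal (h x * G x) + ennreal K * ennreal (h x * G x) = ennreal ((1 + K) * (h x * G x))"
      using X(6) h0[OF x] G_nonneg[of x] by (simp add: ennreal_mult[symmetric] ennreal_plus[symmetric] distrib_right del: ennreal_plus)
    also have "emeasure D ?M = ennreal (G ((1 - 2 * \<delta>) * x / m))"
      by (simp add: D.emeasure_eq_measure G_def)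
    finally show ?thesis .
  qed
  show thesis by (rule that[OF k(3,4) h0 main])
qed

text \<open>
  The two ways to exceed \<open>x\<close> exclude each other: a single jump is counted where \<open>Z \<le> sqrt x\<close>, and
  for large \<open>x\<close> a large mean forces \<open>Z > sqrt x\<close>.  So the lower bounds \<open>lower_tail_one_jump\<close> and
  \<open>lower_tail_large_mean\<close> can be added.
\<close>

lemma one_step_lower:
  assumes d: "0 < \<delta>" "\<delta> < 1 / 2" and m: "0 < m" and B: "0 \<le> B"
    and td: "tail_dominated B K X" and Xm: "m \<le> integral\<^sup>L L X"
  obtains h where "(h \<longlongrightarrow> 0) at_top"
    "\<forall>\<^sub>F x in at_top. mean_jumps X ((1 + 2 * \<delta>) * x) + ennreal (G ((1 + 2 * \<delta>) * x / m))
      \<le> emeasure DL {z\<in>space DL. x < q (fst z) + offspring X z} + ennreal (h x * G x)"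
proof -
  obtain \<kappa> s F bad h x0 where "negligible_errors \<delta> B \<kappa> s F bad h x0"
    using negligible_errors_exist[OF d B] by blast
  note E = negligible_errorsD[OF this]
  note k = E(1-4) and badm[measurable] = E(5) and s = E(6,7) and r1 = E(8) and h0 = E(9) and fn = E(10) and e1 = E(11) and e2 = E(12)
  note X = tail_dominatedD[OF td]
  note [measurable] = X(1)
  have main: "mean_jumps X ((1 + 2 * \<delta>) * x) + ennreal (G ((1 + 2 * \<delta>) * x / m))
      \<le> emeasure DL {z\<in>space DL. x < q (fst z) + offspring X z} + ennreal ((1 + 2 * K) * h x * G x)"
    if x: "x \<ge> x0" and big: "sqrt x \<le> (1 + 2 * \<delta>) * x / m" for x
  proof -
    have xp: "0 < x" using x k by simp
    let ?Q = "{v\<in>space D. \<delta> * x < \<bar>q v\<bar>}"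
    let ?M = "{v\<in>space D. (1 + 2 * \<delta>) * x / m < Z v}"
    let ?r = "ennreal ((1 + B) / (\<delta> * sqrt x))"
    let ?E = "\<lambda>v. emeasure PL {g\<in>space PL. x < q v + (\<Sum>j. c j v * X (g j))}"
    let ?j = "\<lambda>v. jump_mass X (\<lambda>k. c k v) ((1 + 2 * \<delta>) * x)"
    let ?jk = "\<lambda>v. jump_mass X (\<lambda>k. c k v) (\<kappa> * x)"
    let ?jm = "\<lambda>v. jump_mass (\<lambda>y. - X y) (\<lambda>k. c k v) (\<kappa> * x)"
    have mono: "?j v \<le> ?jk v" for v
      using d k xp by (intro jump_mass_antimono mult_right_mono) auto
    have r0: "0 \<le> (1 + B) / (\<delta> * sqrt x)" using B d xp by simp
    have pt: "?j v + indicator ?M v \<le> ?E v + (indicator ?Q v + indicator (bad x) v + ennreal (F x))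
        + (indicator (large \<delta> x) v * ?jk v + ?r * (indicator (space D) v * ?jk v)) + indicator (large \<delta> x) v * ?jm v" (is "_ \<le> ?R") if v: "v \<in> space D" for v
    proof (cases "v \<in> large \<delta> x")
      case True
      have "indicator ?M v \<le> ?E v + (indicator ?Q v + indicator (bad x) v + ennreal (F x)) + ?jm v"
      proof (cases "v \<in> ?Q \<or> v \<in> bad x \<or> v \<notin> ?M")
        case True
        then have "indicator ?M v \<le> indicator ?Q v + (indicator (bad x) v :: ennreal)"
          by (auto simp: indicator_def)
        also have "\<dots> \<le> ?E v + (indicator ?Q v + indicator (bad x) v + ennreal (F x)) + ?jm v"
          by (intro add_increasing2 add_increasing order_refl zero_le)
        finally show ?thesis .
      next
        case False
        have q: "- (\<delta> * x) \<le> q v" and nb: "v \<notin> bad x" and Zm: "(1 + 2 * \<delta>) * x < m * (\<Sum>j. c j v)"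
          using False v m by (auto simp: Z_def[symmetric] field_simps not_less)
        have "1 = ?E v + emeasure PL {g\<in>space PL. \<not> x < q v + (\<Sum>j. c j v * X (g j))}"
        proof -
          have "PL.prob {g\<in>space PL. \<not> x < q v + (\<Sum>j. c j v * X (g j))} = 1 - PL.prob {g\<in>space PL. x < q v + (\<Sum>j. c j v * X (g j))}"
            by (rule PL.prob_neg) measurable
          then show ?thesis by (simp add: PL.emeasure_eq_measure ennreal_plus[symmetric] del: ennreal_plus)
        qed
        also have "\<dots> \<le> ?E v + (ennreal (fn_bound p B (\<lambda>k. c k v) (s x) (\<kappa> * x) (\<delta> * x)) + ?jm v)"
          by (intro add_left_mono lower_tail_large_mean[OF X(2) Xm X(4,5) p(1,2) c_nonneg c_summable s[OF x] q Zm])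
        also have "\<dots> \<le> ?E v + (ennreal (F x) + ?jm v)"
          by (intro add_mono order_refl ennreal_leI fn[OF x v nb])
        also have "\<dots> \<le> ?E v + (indicator ?Q v + indicator (bad x) v + ennreal (F x)) + ?jm v"
          by (subst add.assoc[symmetric]) (intro add_mono order_refl add_increasing zero_le)
        finally have "1 \<le> ?E v + (indicator ?Q v + indicator (bad x) v + ennreal (F x)) + ?jm v" .
        moreover have "indicator ?M v \<le> (1::ennreal)" by (simp add: indicator_def)
        ultimately show ?thesis by (rule order_trans[rotated])
      qed
      then have "?j v + indicator ?M v \<le> ?jk v + (?E v + (indicator ?Q v + indicator (bad x) v + ennreal (F x)) + ?jm v)"
        by (intro add_mono mono)
      also have "\<dots> = ?E v + (indicator ?Q v + indicator (bad x) v + ennreal (F x)) + ?jk v + ?jm v"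
        by (simp only: ac_simps)
      also have "\<dots> \<le> ?R"
        using True by (intro add_mono order_refl add_increasing2 zero_le) auto
      finally show ?thesis .
    next
      case False
      then have Zs: "Z v \<le> sqrt x" and q: "- (\<delta> * x) \<le> q v" using v by (auto simp: large_def)
      have M0: "indicator ?M v = (0::ennreal)" using Zs big by (auto simp: indicator_def)
      have le: "?j v * ennreal (1 - (1 + B) / (\<delta> * sqrt x)) \<le> ?E v"
      proof (rule lower_tail_one_jump[OF X(1) d(1) xp q])
        fix k
        show "ennreal (1 - (1 + B) / (\<delta> * sqrt x)) \<le> emeasure PL {g\<in>space PL. rest X (\<lambda>k. c k v) k g \<le> ennreal (\<delta> * x)}"
          using d xp by (intro emeasure_rest_ge[OF X(2) c_nonneg c_summable] rest_ratio_le[OF td d(1) xp Zs]) auto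
      qed
      have one: "ennreal (1 - (1 + B) / (\<delta> * sqrt x)) + ?r = 1"
        using r0 r1[OF x] by (simp add: ennreal_plus[symmetric] del: ennreal_plus)
      have "?j v = ?j v * (ennreal (1 - (1 + B) / (\<delta> * sqrt x)) + ?r)"
        by (simp only: one mult_1_right)
      also have "\<dots> = ?j v * ennreal (1 - (1 + B) / (\<delta> * sqrt x)) + ?r * ?j v"
        by (simp only: distrib_left mult.commute)
      also have "\<dots> \<le> ?E v + ?r * ?jk v"
        by (intro add_mono le mult_left_mono mono zero_le)
      also have "\<dots> \<le> ?R"
        using v by (intro add_increasing2[OF zero_le] add_mono add_increasing2[OF zero_le order_refl] add_increasing[OF zero_le]) auto
      finally show ?thesis by (simp add: M0)
    qed
    have "(\<integral>\<^sup>+v. ?j v \<partial>D) + ennreal (G ((1 + 2 * \<delta>) * x / m)) = (\<integral>\<^sup>+v. ?j v + indicator ?M v \<partial>D)"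
      by (simp add: nn_integral_add D.emeasure_eq_measure G_def)
    also have "\<dots> \<le> (\<integral>\<^sup>+v. ?E v + (indicator ?Q v + indicator (bad x) v + ennreal (F x))
        + (indicator (large \<delta> x) v * ?jk v + ?r * (indicator (space D) v * ?jk v)) + indicator (large \<delta> x) v * ?jm v \<partial>D)"
      by (rule nn_integral_mono) (rule pt)
    also have "\<dots> = (\<integral>\<^sup>+v. ?E v \<partial>D) + (emeasure D ?Q + emeasure D (bad x) + ennreal (F x))
      + ((\<integral>\<^sup>+v. indicator (large \<delta> x) v * ?jk v \<partial>D) + ?r * (\<integral>\<^sup>+v. indicator (space D) v * ?jk v \<partial>D)) + (\<integral>\<^sup>+v. indicator (large \<delta> x) v * ?jm v \<partial>D)"
      by (simp add: nn_integral_add nn_integral_cmult D.emeasure_space_1)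
    also have "\<dots> \<le> (\<integral>\<^sup>+v. ?E v \<partial>D) + ennreal (h x * G x)
      + (ennreal K * kernel (indicator (large \<delta> x)) (\<kappa> * x) + ?r * (ennreal K * kernel (\<lambda>_. 1) (\<kappa> * x))) + ennreal K * kernel (indicator (large \<delta> x)) (\<kappa> * x)"
      unfolding kernel_const using k xp
      by (intro add_mono order_refl e1[OF x] mult_left_mono jump_mass_kernel[OF td]) auto
    also have "\<dots> = (\<integral>\<^sup>+v. ?E v \<partial>D) + ennreal (h x * G x)
      + (ennreal K * (kernel (indicator (large \<delta> x)) (\<kappa> * x) + ?r * kernel (\<lambda>_. 1) (\<kappa> * x)) + ennreal K * kernel (indicator (large \<delta> x)) (\<kappa> * x))"
      by (simp add: distrib_left mult_ac add.assoc)
    also have "\<dots> \<le> (\<integral>\<^sup>+v. ?E v \<partial>D) + ennreal (h x * G x) + (ennreal K * ennreal (h x * G x) + ennreal K * ennreal (h x * G x))"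
    proof (intro add_mono order_refl mult_left_mono e2[OF x] zero_le)
      have "kernel (indicator (large \<delta> x)) (\<kappa> * x) \<le> kernel (indicator (large \<delta> x)) (\<kappa> * x) + ?r * kernel (\<lambda>_. 1) (\<kappa> * x)"
        by (simp add: add_increasing2)
      then show "kernel (indicator (large \<delta> x)) (\<kappa> * x) \<le> ennreal (h x * G x)" using e2[OF x] by (rule order_trans)
    qed
    also have "\<dots> = (\<integral>\<^sup>+v. ?E v \<partial>D) + ennreal ((1 + 2 * K) * h x * G x)"
      using X(6) h0[OF x] G_nonneg[of x]
      by (simp add: ennreal_mult[symmetric] ennreal_plus[symmetric] distrib_right add.assoc del: ennreal_plus)
    also have "(\<integral>\<^sup>+v. ?E v \<partial>D) = emeasure DL {z\<in>space DL. x < q (fst z) + offspring X z}"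
      by (subst emeasure_pair_sections) auto
    finally show ?thesis .
  qed
  have "((\<lambda>x. (1 + 2 * K) * h x) \<longlongrightarrow> 0) at_top" using k(4) by (intro tendsto_mult_right_zero)
  then show thesis
  proof (rule that)
    show "\<forall>\<^sub>F x in at_top. mean_jumps X ((1 + 2 * \<delta>) * x) + ennreal (G ((1 + 2 * \<delta>) * x / m))
      \<le> emeasure DL {z\<in>space DL. x < q (fst z) + offspring X z} + ennreal ((1 + 2 * K) * h x * G x)"
      using eventually_ge_at_top[of x0] eventually_ge_at_top[of "max 1 (m\<^sup>2)"]
    proof eventually_elim
      case (elim x)
      have x1: "x \<ge> 1" "m\<^sup>2 \<le> x" using elim by auto
      have "m \<le> sqrt x" using x1 m by (intro real_le_rsqrt) auto
      then have "sqrt x * m \<le> sqrt x * sqrt x" using x1 by (intro mult_left_mono) auto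
      also have "\<dots> \<le> (1 + 2 * \<delta>) * x" using x1 d by simp
      finally have "sqrt x \<le> (1 + 2 * \<delta>) * x / m" using m by (simp add: field_simps)
      then show ?case using elim by (intro main) auto
    qed
  qed
qed

end

section \<open>The tail of a solution of the fixed-point equation\<close>

context branching_law
begin

sublocale DP: prob_space "DL"
  by (intro prob_space_pair D.prob_space_axioms PL.prob_space_axioms)

text \<open>
  The hypothesis is used at the level \<open>y x / c\<^sub>k\<close>.  Where this level is too low for it to apply, \<open>c\<^sub>k\<close> is of
  order \<open>x\<close>, and the moment of order \<open>\<alpha> + \<epsilon>\<close> bounds the mass of such weights by \<open>o(G x)\<close>.
\<close>

lemma jump_mass_upper:
  assumes [measurable]: "X \<in> borel_measurable L" and a: "0 \<le> a" and y: "0 < y"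
    and le: "\<forall>\<^sub>F x in at_top. \<P>(t in L. x < X t) \<le> a * G x"
  obtains e where "(e \<longlongrightarrow> 0) at_top"
    "\<forall>\<^sub>F x in at_top. mean_jumps X (y * x) \<le> ennreal a * kernel (\<lambda>_. 1) (y * x) + ennreal (e x * G x)"
proof -
  let ?b = "\<alpha> + \<epsilon>"
  obtain x1 where x1: "x1 \<ge> 1" "\<And>x. x \<ge> x1 \<Longrightarrow> \<P>(t in L. x < X t) \<le> a * G x"
    using le unfolding eventually_at_top_linorder by (metis max.bounded_iff max.cobounded1)
  define e where "e x = \<rho> ?b * (x1 / y) powr ?b * (x powr (- ?b) / G x)" for x
  have "(e \<longlongrightarrow> 0) at_top"
    unfolding e_def[abs_def] using eps by (intro tendsto_mult_right_zero power_negligible) auto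
  moreover have "mean_jumps X (y * x) \<le> ennreal a * kernel (\<lambda>_. 1) (y * x) + ennreal (e x * G x)" if x: "0 < x" for x
  proof -
    define z where "z = y * x"
    have z: "0 < z" using x y by (simp add: z_def)
    have pt: "emeasure L {t\<in>space L. z < c k v * X t} \<le> ennreal (a * tail_at (c k v) z) + ennreal ((x1 / z) powr ?b * c k v powr ?b)" for k v
    proof (cases "c k v = 0")
      case True
      then have "{t\<in>space L. z < c k v * X t} = {}" using z by auto
      then show ?thesis by (simp only: emeasure_empty zero_le)
    next
      case False
      then have cp: "0 < c k v" using c_nonneg[of k v] by simp
      have eq: "{t\<in>space L. z < c k v * X t} = {t\<in>space L. z / c k v < X t}" using cp by (auto simp: field_simps)
      show ?thesis
      proof (cases "x1 \<le> z / c k v")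
        case True
        then have "emeasure L {t\<in>space L. z < c k v * X t} \<le> ennreal (a * tail_at (c k v) z)"
          unfolding eq emeasure_eq_measure using x1(2) False by (intro ennreal_leI) (simp add: tail_at_def)
        then show ?thesis by (rule order_trans) simp
      next
        case False
        then have "1 \<le> x1 / z * c k v" using cp z by (simp add: field_simps)
        then have "1 \<le> (x1 / z * c k v) powr ?b" using alpha eps by (intro ge_one_powr_ge_zero) auto
        also have "\<dots> = (x1 / z) powr ?b * c k v powr ?b" by (rule powr_mult)
        finally have "1 \<le> ennreal ((x1 / z) powr ?b * c k v powr ?b)" by (simp add: ennreal_1[symmetric] del: ennreal_1)
        then have "emeasure L {t\<in>space L. z < c k v * X t} \<le> ennreal ((x1 / z) powr ?b * c k v powr ?b)"
          using emeasure_le_1 by (rule order_trans[rotated])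
        then show ?thesis by (rule order_trans) simp
      qed
    qed
    have "(\<integral>\<^sup>+v. jump_mass X (\<lambda>k. c k v) z \<partial>D) \<le> (\<integral>\<^sup>+v. (\<Sum>k. ennreal a * ennreal (tail_at (c k v) z) + ennreal ((x1 / z) powr ?b) * ennreal (c k v powr ?b)) \<partial>D)"
      unfolding jump_mass_def using pt a
      by (intro nn_integral_mono suminf_le) (auto simp: ennreal_mult tail_at_nonneg)
    also have "\<dots> = (\<integral>\<^sup>+v. (\<Sum>k. ennreal a * ennreal (tail_at (c k v) z)) + (\<Sum>k. ennreal ((x1 / z) powr ?b) * ennreal (c k v powr ?b)) \<partial>D)"
      by (intro nn_integral_cong suminf_add[symmetric] summableI)
    also have "\<dots> = ennreal a * kernel (\<lambda>_. 1) z + ennreal ((x1 / z) powr ?b) * weight_moment D c ?b"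
      unfolding kernel_def weight_moment_def by (simp add: nn_integral_add nn_integral_cmult)
    also have "ennreal ((x1 / z) powr ?b) * weight_moment D c ?b = ennreal (e x * G x)"
    proof -
      have "(x1 / z) powr ?b = (x1 / y) powr ?b * x powr (- ?b)"
        using x1 y x unfolding z_def by (simp add: powr_divide powr_mult powr_minus_divide del: minus_add_distrib)
      moreover have "0 < G x" using x by (rule tail_pos)
      ultimately show ?thesis
        unfolding weight_moment_eq e_def by (simp add: ennreal_mult[symmetric] \<rho>_def mult_ac del: minus_add_distrib)
    qed
    finally show ?thesis unfolding z_def .
  qed
  then have "\<forall>\<^sub>F x in at_top. mean_jumps X (y * x) \<le> ennreal a * kernel (\<lambda>_. 1) (y * x) + ennreal (e x * G x)"
    using eventually_gt_at_top[of 0] by (rule eventually_mono[rotated])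
  ultimately show thesis by (rule that)
qed

lemma jump_mass_lower:
  assumes [measurable]: "X \<in> borel_measurable L" and a: "0 \<le> a" and y: "0 < y"
    and le: "\<forall>\<^sub>F x in at_top. a * G x \<le> \<P>(t in L. x < X t)"
  obtains e where "(e \<longlongrightarrow> 0) at_top"
    "\<forall>\<^sub>F x in at_top. ennreal a * kernel (\<lambda>_. 1) (y * x) \<le> mean_jumps X (y * x) + ennreal (e x * G x)"
proof -
  let ?b = "\<alpha> + \<epsilon>"
  obtain x1 where x1: "x1 \<ge> 1" "\<And>x. x \<ge> x1 \<Longrightarrow> a * G x \<le> \<P>(t in L. x < X t)"
    using le unfolding eventually_at_top_linorder by (metis max.bounded_iff max.cobounded1)
  define e where "e x = a * \<rho> ?b * (x1 / y) powr ?b * (x powr (- ?b) / G x)" for x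
  have "(e \<longlongrightarrow> 0) at_top"
    unfolding e_def[abs_def] using eps by (intro tendsto_mult_right_zero power_negligible) auto
  moreover have "ennreal a * kernel (\<lambda>_. 1) (y * x) \<le> mean_jumps X (y * x) + ennreal (e x * G x)" if x: "0 < x" for x
  proof -
    define z where "z = y * x"
    have z: "0 < z" using x y by (simp add: z_def)
    have pt: "ennreal (a * tail_at (c k v) z) \<le> emeasure L {t\<in>space L. z < c k v * X t} + ennreal (a * (x1 / z) powr ?b * c k v powr ?b)" for k v
    proof (cases "c k v = 0")
      case True
      then show ?thesis by (simp add: tail_at_def)
    next
      case False
      then have cp: "0 < c k v" using c_nonneg[of k v] by simp
      have eq: "{t\<in>space L. z < c k v * X t} = {t\<in>space L. z / c k v < X t}" using cp by (auto simp: field_simps)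
      show ?thesis
      proof (cases "x1 \<le> z / c k v")
        case True
        then have "ennreal (a * tail_at (c k v) z) \<le> emeasure L {t\<in>space L. z < c k v * X t}"
          unfolding eq emeasure_eq_measure using x1(2) False by (intro ennreal_leI) (simp add: tail_at_def)
        then show ?thesis by (rule order_trans) simp
      next
        case False
        then have "1 \<le> x1 / z * c k v" using cp z by (simp add: field_simps)
        then have "1 \<le> (x1 / z * c k v) powr ?b" using alpha eps by (intro ge_one_powr_ge_zero) auto
        also have "\<dots> = (x1 / z) powr ?b * c k v powr ?b" by (rule powr_mult)
        finally have "a * tail_at (c k v) z \<le> a * ((x1 / z) powr ?b * c k v powr ?b)"
          using a tail_le_1[of "z / c k v"] by (intro mult_left_mono) (auto simp: tail_at_def intro: order_trans)
        then have "ennreal (a * tail_at (c k v) z) \<le> ennreal (a * (x1 / z) powr ?b * c k v powr ?b)"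
          by (intro ennreal_leI) (simp add: mult.assoc)
        then show ?thesis by (rule order_trans) simp
      qed
    qed
    have "ennreal a * kernel (\<lambda>_. 1) z = (\<integral>\<^sup>+v. (\<Sum>k. ennreal (a * tail_at (c k v) z)) \<partial>D)"
      unfolding kernel_def using a by (simp add: ennreal_mult tail_at_nonneg nn_integral_cmult)
    also have "\<dots> \<le> (\<integral>\<^sup>+v. (\<Sum>k. emeasure L {t\<in>space L. z < c k v * X t} + ennreal (a * (x1 / z) powr ?b) * ennreal (c k v powr ?b)) \<partial>D)"
      using pt a by (intro nn_integral_mono suminf_le) (auto simp: ennreal_mult)
    also have "\<dots> = (\<integral>\<^sup>+v. jump_mass X (\<lambda>k. c k v) z + (\<Sum>k. ennreal (a * (x1 / z) powr ?b) * ennreal (c k v powr ?b)) \<partial>D)"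
      unfolding jump_mass_def by (intro nn_integral_cong suminf_add[symmetric] summableI)
    also have "\<dots> = (\<integral>\<^sup>+v. jump_mass X (\<lambda>k. c k v) z \<partial>D) + ennreal (a * (x1 / z) powr ?b) * weight_moment D c ?b"
      unfolding weight_moment_def by (simp add: nn_integral_add nn_integral_cmult)
    also have "ennreal (a * (x1 / z) powr ?b) * weight_moment D c ?b = ennreal (e x * G x)"
    proof -
      have "(x1 / z) powr ?b = (x1 / y) powr ?b * x powr (- ?b)"
        using x1 y x unfolding z_def by (simp add: powr_divide powr_mult powr_minus_divide del: minus_add_distrib)
      moreover have "0 < G x" using x by (rule tail_pos)
      ultimately show ?thesis
        unfolding weight_moment_eq e_def using a by (simp add: ennreal_mult[symmetric] \<rho>_def mult_ac del: minus_add_distrib)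
    qed
    finally show ?thesis unfolding z_def .
  qed
  then have "\<forall>\<^sub>F x in at_top. ennreal a * kernel (\<lambda>_. 1) (y * x) \<le> mean_jumps X (y * x) + ennreal (e x * G x)"
    using eventually_gt_at_top[of 0] by (rule eventually_mono[rotated])
  ultimately show thesis by (rule that)
qed

text \<open>
  The factors \<open>1 - 2 \<delta>\<close> and \<open>1 + 2 \<delta>\<close> of the one-step estimates disappear in the limit
  \<open>\<delta> \<rightarrow> 0\<close>.
\<close>

lemma small_shrink:
  fixes l a :: real
  assumes "l < a"
  obtains \<delta> where "0 < \<delta>" "\<delta> < 1 / 2" "l * (1 - 2 * \<delta>) powr (- \<alpha>) < a"
proof -
  have "((\<lambda>\<delta>. l * (1 - 2 * \<delta>) powr (- \<alpha>)) \<longlongrightarrow> l * (1 - 2 * 0) powr (- \<alpha>)) (at_right 0)"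
    by (intro tendsto_intros) auto
  then have "((\<lambda>\<delta>. l * (1 - 2 * \<delta>) powr (- \<alpha>)) \<longlongrightarrow> l) (at_right 0)" by simp
  from order_tendstoD(2)[OF this assms]
  have "\<forall>\<^sub>F \<delta> in at_right 0. l * (1 - 2 * \<delta>) powr (- \<alpha>) < a \<and> 0 < \<delta> \<and> \<delta> < 1 / 2"
    using eventually_at_right_less[of "0::real"] eventually_at_right_field[of "\<lambda>x. x < 1 / 2" "0::real"]
    by (auto simp: eventually_conj_iff intro!: exI[of _ "1/2"])
  then show thesis using that eventually_happens'[OF trivial_limit_at_right_real] by blast
qed

lemma small_stretch:
  fixes l a :: real
  assumes "a < l"
  obtains \<delta> where "0 < \<delta>" "\<delta> < 1 / 2" "a < l * (1 + 2 * \<delta>) powr (- \<alpha>)"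
proof -
  have "((\<lambda>\<delta>. l * (1 + 2 * \<delta>) powr (- \<alpha>)) \<longlongrightarrow> l * (1 + 2 * 0) powr (- \<alpha>)) (at_right 0)"
    by (intro tendsto_intros) auto
  then have "((\<lambda>\<delta>. l * (1 + 2 * \<delta>) powr (- \<alpha>)) \<longlongrightarrow> l) (at_right 0)" by simp
  from order_tendstoD(1)[OF this assms]
  have "\<forall>\<^sub>F \<delta> in at_right 0. a < l * (1 + 2 * \<delta>) powr (- \<alpha>) \<and> 0 < \<delta> \<and> \<delta> < 1 / 2"
    using eventually_at_right_less[of "0::real"] eventually_at_right_field[of "\<lambda>x. x < 1 / 2" "0::real"]
    by (auto simp: eventually_conj_iff intro!: exI[of _ "1/2"])
  then show thesis using that eventually_happens'[OF trivial_limit_at_right_real] by blast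
qed

lemma kernel_one_limit:
  assumes y: "0 < y"
  obtains k where "((\<lambda>x. k x / G x) \<longlongrightarrow> \<rho> \<alpha> * y powr (- \<alpha>)) at_top" "\<And>x. 0 \<le> k x"
    "\<forall>\<^sub>F x in at_top. kernel (\<lambda>_. 1) (y * x) = ennreal (k x)"
proof -
  have "((\<lambda>x. enn2real (kernel (\<lambda>_. 1) (y * x)) / G x) \<longlongrightarrow> \<rho> \<alpha> * y powr (- \<alpha>)) at_top"
    and fin: "\<forall>\<^sub>F x in at_top. kernel (\<lambda>_. 1) (y * x) < \<infinity>"
    using kernel_limit[OF y, of "\<lambda>x v. 1" 1] by auto
  moreover from fin have "\<forall>\<^sub>F x in at_top. kernel (\<lambda>_. 1) (y * x) = ennreal (enn2real (kernel (\<lambda>_. 1) (y * x)))"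
    by eventually_elim simp
  ultimately show thesis by (intro that[of "\<lambda>x. enn2real (kernel (\<lambda>_. 1) (y * x))"]) auto
qed

text \<open>
  The asymptotic probability that the conditional mean \<open>m Z\<close> exceeds \<open>y x\<close>.
\<close>

lemma tail_scaled_mean:
  assumes "0 < y" "0 < m"
  shows "((\<lambda>x. G (y * x / m) / G x) \<longlongrightarrow> m powr \<alpha> * y powr (- \<alpha>)) at_top"
proof -
  have "((\<lambda>x. G (y / m * x) / G x) \<longlongrightarrow> (y / m) powr (- \<alpha>)) at_top"
    using assms by (intro tail_rv) auto
  moreover have "(y / m) powr (- \<alpha>) = m powr \<alpha> * y powr (- \<alpha>)"
    using assms by (subst powr_divide) (simp_all add: powr_minus_divide)
  ultimately show ?thesis by simp
qed

text \<open>
  One application of the recursion turns the asymptotic constant \<open>a\<close> into any constant above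
  \<open>a \<rho>\<^sub>\<alpha> + m\<^sup>\<alpha>\<close>.
\<close>

lemma upper_step:
  assumes td: "tail_dominated B K X" and m: "0 < m" "integral\<^sup>L L X \<le> m" and a: "0 \<le> a"
    and le: "\<forall>\<^sub>F x in at_top. \<P>(t in L. x < X t) \<le> a * G x" and a': "a * \<rho> \<alpha> + m powr \<alpha> < a'"
  shows "\<forall>\<^sub>F x in at_top. \<P>(z in DL. x < \<bar>q (fst z)\<bar> + offspring X z) \<le> a' * G x"
proof -
  note X = tail_dominatedD[OF td]
  have B: "0 \<le> B" by (rule order_trans[OF _ X(5)]) simp
  obtain \<delta> where d: "0 < \<delta>" "\<delta> < 1 / 2" "(a * \<rho> \<alpha> + m powr \<alpha>) * (1 - 2 * \<delta>) powr (- \<alpha>) < a'"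
    using small_shrink[OF a'] by blast
  define y where "y = 1 - 2 * \<delta>"
  have y: "0 < y" using d by (simp add: y_def)
  obtain h x0 where "1 \<le> x0" and h: "(h \<longlongrightarrow> 0) at_top" and h0: "\<And>x. x \<ge> x0 \<Longrightarrow> 0 \<le> h x"
    and up: "\<And>X K x. tail_dominated B K X \<Longrightarrow> integral\<^sup>L L X \<le> m \<Longrightarrow> x \<ge> x0 \<Longrightarrow>
      emeasure DL {z\<in>space DL. x < \<bar>q (fst z)\<bar> + offspring X z}
      \<le> mean_jumps X (y * x) + ennreal (G (y * x / m)) + ennreal ((1 + K) * (h x * G x))"
    by (rule one_step_upper[OF d(1,2) m(1) B, folded y_def]) (rule that; assumption)
  obtain e where e: "(e \<longlongrightarrow> 0) at_top"
    "\<forall>\<^sub>F x in at_top. mean_jumps X (y * x) \<le> ennreal a * kernel (\<lambda>_. 1) (y * x) + ennreal (e x * G x)"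
    by (rule jump_mass_upper[OF X(1) a y le]) (rule that; assumption)
  obtain k where k: "((\<lambda>x. k x / G x) \<longlongrightarrow> \<rho> \<alpha> * y powr (- \<alpha>)) at_top" "\<And>x. 0 \<le> k x"
    "\<forall>\<^sub>F x in at_top. kernel (\<lambda>_. 1) (y * x) = ennreal (k x)"
    by (rule kernel_one_limit[OF y]) (rule that; assumption)
  have "((\<lambda>x. a * (k x / G x) + \<bar>e x\<bar> + G (y * x / m) / G x + (1 + K) * h x)
      \<longlongrightarrow> a * (\<rho> \<alpha> * y powr (- \<alpha>)) + \<bar>0\<bar> + m powr \<alpha> * y powr (- \<alpha>) + (1 + K) * 0) at_top"
    by (intro tendsto_intros k e h tail_scaled_mean y m)
  moreover have "a * (\<rho> \<alpha> * y powr (- \<alpha>)) + \<bar>0\<bar> + m powr \<alpha> * y powr (- \<alpha>) + (1 + K) * 0 < a'"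
    using d(3) by (simp add: y_def[symmetric] distrib_right mult.assoc)
  ultimately have "\<forall>\<^sub>F x in at_top. a * (k x / G x) + \<bar>e x\<bar> + G (y * x / m) / G x + (1 + K) * h x < a'"
    by (rule order_tendstoD(2))
  then show ?thesis using e(2) k(3) eventually_gt_at_top[of 0] eventually_ge_at_top[of x0]
  proof eventually_elim
    case (elim x)
    have Gx: "0 < G x" using elim by (intro tail_pos)
    have "emeasure DL {z\<in>space DL. x < \<bar>q (fst z)\<bar> + offspring X z}
      \<le> mean_jumps X (y * x) + ennreal (G (y * x / m)) + ennreal ((1 + K) * (h x * G x))"
      using elim by (intro up td m)
    also have "\<dots> \<le> (ennreal a * ennreal (k x) + ennreal (\<bar>e x\<bar> * G x)) + ennreal (G (y * x / m)) + ennreal ((1 + K) * (h x * G x))"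
    proof (intro add_mono order_refl)
      have "ennreal (e x * G x) \<le> ennreal (\<bar>e x\<bar> * G x)" using Gx by (intro ennreal_leI mult_right_mono) auto
      then show "mean_jumps X (y * x) \<le> ennreal a * ennreal (k x) + ennreal (\<bar>e x\<bar> * G x)"
        using elim(2,3) by (metis add_left_mono order_trans)
    qed
    also have "\<dots> = ennreal (a * k x + \<bar>e x\<bar> * G x + G (y * x / m) + (1 + K) * (h x * G x))"
      using a k(2) Gx G_nonneg X(6) h0 elim by (simp add: ennreal_mult[symmetric] ennreal_plus[symmetric] del: ennreal_plus)
    also have "a * k x + \<bar>e x\<bar> * G x + G (y * x / m) + (1 + K) * (h x * G x) = (a * (k x / G x) + \<bar>e x\<bar> + G (y * x / m) / G x + (1 + K) * h x) * G x"
      using Gx by (simp add: distrib_right)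
    finally have "\<P>(z in DL. x < \<bar>q (fst z)\<bar> + offspring X z) \<le> (a * (k x / G x) + \<bar>e x\<bar> + G (y * x / m) / G x + (1 + K) * h x) * G x"
      using Gx a k(2)[of x] G_nonneg X(6) h0 elim
      by (subst (asm) DP.emeasure_eq_measure, subst (asm) ennreal_le_iff) (auto intro!: mult_nonneg_nonneg add_nonneg_nonneg)
    also have "\<dots> \<le> a' * G x" using elim(1) Gx by (intro mult_right_mono) auto
    finally show ?case .
  qed
qed

lemma lower_step:
  assumes td: "tail_dominated B K X" and m: "0 < m" "m \<le> integral\<^sup>L L X" and a: "0 \<le> a"
    and le: "\<forall>\<^sub>F x in at_top. a * G x \<le> \<P>(t in L. x < X t)" and a': "a' < a * \<rho> \<alpha> + m powr \<alpha>"
  shows "\<forall>\<^sub>F x in at_top. a' * G x \<le> \<P>(z in DL. x < q (fst z) + offspring X z)"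
proof -
  note X = tail_dominatedD[OF td]
  have B: "0 \<le> B" by (rule order_trans[OF _ X(5)]) simp
  obtain \<delta> where d: "0 < \<delta>" "\<delta> < 1 / 2" "a' < (a * \<rho> \<alpha> + m powr \<alpha>) * (1 + 2 * \<delta>) powr (- \<alpha>)"
    using small_stretch[OF a'] by blast
  define y where "y = 1 + 2 * \<delta>"
  have y: "0 < y" using d by (simp add: y_def)
  obtain h where h: "(h \<longlongrightarrow> 0) at_top"
    "\<forall>\<^sub>F x in at_top. mean_jumps X (y * x) + ennreal (G (y * x / m))
      \<le> emeasure DL {z\<in>space DL. x < q (fst z) + offspring X z} + ennreal (h x * G x)"
    by (rule one_step_lower[OF d(1,2) m(1) B td m(2), folded y_def]) (rule that; assumption)
  obtain e where e: "(e \<longlongrightarrow> 0) at_top"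
    "\<forall>\<^sub>F x in at_top. ennreal a * kernel (\<lambda>_. 1) (y * x) \<le> mean_jumps X (y * x) + ennreal (e x * G x)"
    by (rule jump_mass_lower[OF X(1) a y le]) (rule that; assumption)
  obtain k where k: "((\<lambda>x. k x / G x) \<longlongrightarrow> \<rho> \<alpha> * y powr (- \<alpha>)) at_top" "\<And>x. 0 \<le> k x"
    "\<forall>\<^sub>F x in at_top. kernel (\<lambda>_. 1) (y * x) = ennreal (k x)"
    by (rule kernel_one_limit[OF y]) (rule that; assumption)
  have "((\<lambda>x. a * (k x / G x) + G (y * x / m) / G x - \<bar>e x\<bar> - \<bar>h x\<bar>)
      \<longlongrightarrow> a * (\<rho> \<alpha> * y powr (- \<alpha>)) + m powr \<alpha> * y powr (- \<alpha>) - \<bar>0\<bar> - \<bar>0\<bar>) at_top"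
    by (intro tendsto_intros k e h tail_scaled_mean y m)
  moreover have "a' < a * (\<rho> \<alpha> * y powr (- \<alpha>)) + m powr \<alpha> * y powr (- \<alpha>) - \<bar>0\<bar> - \<bar>0\<bar>"
    using d(3) by (simp add: y_def[symmetric] distrib_right mult.assoc)
  ultimately have "\<forall>\<^sub>F x in at_top. a' < a * (k x / G x) + G (y * x / m) / G x - \<bar>e x\<bar> - \<bar>h x\<bar>"
    by (rule order_tendstoD(1))
  then show ?thesis using e(2) k(3) h(2) eventually_gt_at_top[of 0]
  proof eventually_elim
    case (elim x)
    have Gx: "0 < G x" using elim by (intro tail_pos)
    let ?P = "\<P>(z in DL. x < q (fst z) + offspring X z)"
    have ee: "ennreal (e x * G x) \<le> ennreal (\<bar>e x\<bar> * G x)" "ennreal (h x * G x) \<le> ennreal (\<bar>h x\<bar> * G x)"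
      using Gx by (intro ennreal_leI mult_right_mono; simp)+
    have "ennreal (a * k x + G (y * x / m)) = ennreal a * kernel (\<lambda>_. 1) (y * x) + ennreal (G (y * x / m))"
      using a k(2) G_nonneg by (simp add: elim(3) ennreal_mult)
    also have "\<dots> \<le> (mean_jumps X (y * x) + ennreal (e x * G x)) + ennreal (G (y * x / m))"
      by (intro add_right_mono elim)
    also have "\<dots> = (mean_jumps X (y * x) + ennreal (G (y * x / m))) + ennreal (e x * G x)"
      by (simp add: ac_simps)
    also have "\<dots> \<le> (ennreal ?P + ennreal (\<bar>h x\<bar> * G x)) + ennreal (\<bar>e x\<bar> * G x)"
      using order_trans[OF elim(4)[unfolded DP.emeasure_eq_measure] add_left_mono[OF ee(2)]] ee(1) by (rule add_mono)
    also have "\<dots> = ennreal (?P + \<bar>h x\<bar> * G x + \<bar>e x\<bar> * G x)"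
      using Gx by (simp add: ennreal_plus[symmetric] del: ennreal_plus)
    finally have "a * k x + G (y * x / m) \<le> ?P + \<bar>h x\<bar> * G x + \<bar>e x\<bar> * G x"
      using Gx by (subst (asm) ennreal_le_iff) (auto intro!: add_nonneg_nonneg)
    moreover have "a' * G x \<le> (a * (k x / G x) + G (y * x / m) / G x - \<bar>e x\<bar> - \<bar>h x\<bar>) * G x"
      using elim(1) Gx by (intro mult_right_mono) auto
    moreover have "(a * (k x / G x) + G (y * x / m) / G x - \<bar>e x\<bar> - \<bar>h x\<bar>) * G x = a * k x + G (y * x / m) - \<bar>e x\<bar> * G x - \<bar>h x\<bar> * G x"
      using Gx by (simp add: distrib_right left_diff_distrib)
    ultimately show ?case by linarith
  qed
qed

text \<open>
  If the right-hand side of the recursion has the same tail as the summand \<open>X\<close>, the two steps can be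
  iterated.
\<close>

theorem fixed_point_tail:
  assumes td: "tail_dominated B K X" and m: "0 < m" "integral\<^sup>L L X = m"
    and fixed: "\<And>x. 0 < x \<Longrightarrow> \<P>(z in DL. x < q (fst z) + offspring X z) = \<P>(t in L. x < X t)"
  shows "((\<lambda>x. \<P>(t in L. x < X t) / G x) \<longlongrightarrow> m powr \<alpha> / (1 - \<rho> \<alpha>)) at_top"
proof -
  note X = tail_dominatedD[OF td]
  note [measurable] = X(1)
  let ?H = "\<lambda>x. \<P>(t in L. x < X t)"
  have KG: "\<forall>\<^sub>F x in at_top. ?H x \<le> K * G x"
    using eventually_gt_at_top[of 0]
  proof eventually_elim
    case (elim x)
    have "?H x \<le> \<P>(t in L. x < \<bar>X t\<bar>)" by (intro finite_measure_mono) auto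
    also have "\<dots> \<le> K * G x" using td elim by (simp add: tail_dominated_def)
    finally show ?case .
  qed
  have up: "\<forall>\<^sub>F x in at_top. ?H x \<le> a * G x" if "a > m powr \<alpha> / (1 - \<rho> \<alpha>)" for a
  proof (rule eventually_le_improve[where \<theta> = "\<rho> \<alpha>" and b = "m powr \<alpha>", OF _ _ _ _ _ KG _ that])
    fix a a' assume a: "0 \<le> a" "\<forall>\<^sub>F x in at_top. ?H x \<le> a * G x" "a * \<rho> \<alpha> + m powr \<alpha> < a'"
    have "\<forall>\<^sub>F x in at_top. \<P>(z in DL. x < \<bar>q (fst z)\<bar> + offspring X z) \<le> a' * G x"
      by (rule upper_step[OF td m(1) _ a]) (simp add: m)
    then show "\<forall>\<^sub>F x in at_top. ?H x \<le> a' * G x"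
      using eventually_gt_at_top[of 0]
    proof eventually_elim
      case (elim x)
      have "?H x \<le> \<P>(z in DL. x < \<bar>q (fst z)\<bar> + offspring X z)"
        unfolding fixed[OF elim(2), symmetric] by (intro DP.finite_measure_mono) (auto intro: less_le_trans)
      with elim show ?case by linarith
    qed
  qed (use rho_bounds tail_pos in auto)
  have low: "\<forall>\<^sub>F x in at_top. a * G x \<le> ?H x" if "a < m powr \<alpha> / (1 - \<rho> \<alpha>)" for a
  proof (rule eventually_ge_improve[where \<theta> = "\<rho> \<alpha>" and b = "m powr \<alpha>", OF _ _ _ _ _ KG _ that])
    fix a a' assume a: "0 \<le> a" "\<forall>\<^sub>F x in at_top. a * G x \<le> ?H x" "a' < a * \<rho> \<alpha> + m powr \<alpha>"
    have "\<forall>\<^sub>F x in at_top. a' * G x \<le> \<P>(z in DL. x < q (fst z) + offspring X z)"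
      by (rule lower_step[OF td m(1) _ a]) (simp add: m)
    then show "\<forall>\<^sub>F x in at_top. a' * G x \<le> ?H x"
      using eventually_gt_at_top[of 0] by eventually_elim (simp add: fixed)
  qed (use rho_bounds tail_pos in auto)
  show ?thesis
  proof (rule order_tendstoI)
    fix a assume "a < m powr \<alpha> / (1 - \<rho> \<alpha>)"
    then obtain b where b: "a < b" "b < m powr \<alpha> / (1 - \<rho> \<alpha>)" using dense by blast
    show "\<forall>\<^sub>F x in at_top. a < ?H x / G x"
      using low[OF b(2)] eventually_gt_at_top[of 0]
    proof eventually_elim
      case (elim x)
      then have "b \<le> ?H x / G x" using tail_pos[of x] by (simp add: field_simps)
      then show ?case using b by linarith
    qed
  next
    fix a assume "m powr \<alpha> / (1 - \<rho> \<alpha>) < a"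
    then obtain b where b: "b < a" "m powr \<alpha> / (1 - \<rho> \<alpha>) < b" using dense by blast
    show "\<forall>\<^sub>F x in at_top. ?H x / G x < a"
      using up[OF b(2)] eventually_gt_at_top[of 0]
    proof eventually_elim
      case (elim x)
      then have "?H x / G x \<le> b" using tail_pos[of x] by (simp add: field_simps)
      then show ?case using b by linarith
    qed
  qed
qed

end

section \<open>Bounds preserved by the recursion\<close>

text \<open>
  Convexity of \<open>x \<mapsto> x\<^sup>p\<close> at \<open>(1 - t) (a / (1 - t)) + t (b / t)\<close>.
\<close>

lemma powr_add_weighted:
  fixes a b t p :: real
  assumes "0 \<le> a" "0 \<le> b" "0 < t" "t < 1" "1 \<le> p"
  shows "(a + b) powr p \<le> (1 - t) powr (1 - p) * a powr p + t powr (1 - p) * b powr p"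
proof -
  have split: "s powr (1 - p) * x powr p = s * (x / s) powr p" if "0 < s" for s x :: real
    using that by (simp add: powr_divide powr_diff)
  consider "a = 0" | "b = 0" | "0 < a" "0 < b" using assms by linarith
  then show ?thesis
  proof cases
    case 1
    have "t powr 0 \<le> t powr (1 - p)" using assms by (intro powr_mono') auto
    then have "1 * b powr p \<le> t powr (1 - p) * b powr p" using assms by (intro mult_right_mono) auto
    then show ?thesis using 1 by simp
  next
    case 2
    have "(1 - t) powr 0 \<le> (1 - t) powr (1 - p)" using assms by (intro powr_mono') auto
    then have "1 * a powr p \<le> (1 - t) powr (1 - p) * a powr p" using assms by (intro mult_right_mono) auto
    then show ?thesis using 2 by simp
  next
    case 3
    have "((1 - t) *\<^sub>R (a / (1 - t)) + t *\<^sub>R (b / t)) powr p \<le> (1 - t) * (a / (1 - t)) powr p + t * (b / t) powr p"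
      using convex_onD[OF powr_convex[OF assms(5)], of t "a / (1 - t)" "b / t"] 3 assms by auto
    then show ?thesis using assms by (simp add: split)
  qed
qed

context branching_law
begin

text \<open>
  For \<open>x\<close> beyond a threshold that does not depend on \<open>X\<close>, the one-step bound is at most
  \<open>(K \<theta> + g + (1 + K) e) G x\<close> with \<open>\<theta> + e < 1\<close>, which is at most \<open>K G x\<close> once \<open>K\<close> is large.  Below
  the threshold the probability is at most 1, and a large \<open>K\<close> suffices again.
\<close>

lemma tail_constant:
  assumes m: "0 < m" and B: "0 \<le> B"
  obtains K where "0 \<le> K" "\<And>X x. tail_dominated B K X \<Longrightarrow> integral\<^sup>L L X \<le> m \<Longrightarrow> 0 < x \<Longrightarrow>
    \<P>(z in DL. x < \<bar>q (fst z)\<bar> + offspring X z) \<le> K * G x"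
proof -
  obtain \<delta> where d: "0 < \<delta>" "\<delta> < 1 / 2" "\<rho> \<alpha> * (1 - 2 * \<delta>) powr (- \<alpha>) < 1"
    using small_shrink[OF rho_bounds(4)] by blast
  define y where "y = 1 - 2 * \<delta>"
  have y: "0 < y" using d by (simp add: y_def)
  obtain \<theta> where th: "\<rho> \<alpha> * y powr (- \<alpha>) < \<theta>" "\<theta> < 1"
    using dense[OF d(3)] unfolding y_def by blast
  define g where "g = m powr \<alpha> * y powr (- \<alpha>) + 1"
  have g: "m powr \<alpha> * y powr (- \<alpha>) < g" "0 < g" by (auto simp: g_def add_nonneg_pos)
  define e where "e = (1 - \<theta>) / 2"
  have e: "0 < e" using th by (simp add: e_def)
  obtain h x0 where "1 \<le> x0" and h: "(h \<longlongrightarrow> 0) at_top" and h0: "\<And>x. x \<ge> x0 \<Longrightarrow> 0 \<le> h x"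
    and up: "\<And>X K x. tail_dominated B K X \<Longrightarrow> integral\<^sup>L L X \<le> m \<Longrightarrow> x \<ge> x0 \<Longrightarrow>
      emeasure DL {z\<in>space DL. x < \<bar>q (fst z)\<bar> + offspring X z}
      \<le> mean_jumps X (y * x) + ennreal (G (y * x / m)) + ennreal ((1 + K) * (h x * G x))"
    by (rule one_step_upper[OF d(1,2) m B, folded y_def]) (rule that; assumption)
  obtain k where k: "((\<lambda>x. k x / G x) \<longlongrightarrow> \<rho> \<alpha> * y powr (- \<alpha>)) at_top" "\<And>x. 0 \<le> k x"
    "\<forall>\<^sub>F x in at_top. kernel (\<lambda>_. 1) (y * x) = ennreal (k x)"
    by (rule kernel_one_limit[OF y]) (rule that; assumption)
  have "\<forall>\<^sub>F x in at_top. k x / G x < \<theta> \<and> G (y * x / m) / G x < g \<and> h x < e \<and> kernel (\<lambda>_. 1) (y * x) = ennreal (k x)"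
    using order_tendstoD(2)[OF k(1) th(1)] order_tendstoD(2)[OF tail_scaled_mean[OF y m] g(1)] order_tendstoD(2)[OF h e] k(3)
    by eventually_elim simp
  then obtain x1 where x1: "\<And>x. x \<ge> x1 \<Longrightarrow> k x / G x < \<theta> \<and> G (y * x / m) / G x < g \<and> h x < e \<and> kernel (\<lambda>_. 1) (y * x) = ennreal (k x)"
    unfolding eventually_at_top_linorder by blast
  define x2 where "x2 = max x0 x1"
  have x2: "1 \<le> x2" using \<open>1 \<le> x0\<close> by (simp add: x2_def)
  have G2: "0 < G x2" using x2 by (intro tail_pos) auto
  (* The first summand serves x below the threshold x2, the second one the induction step. *)
  define K where "K = 1 / G x2 + (g + e) / e"
  have K: "0 \<le> K" unfolding K_def using G2 g e by (intro add_nonneg_nonneg divide_nonneg_pos) auto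
  have "g + e \<le> K * e"
  proof -
    have "K * e = e / G x2 + (g + e)" using e by (simp only: K_def distrib_right) simp
    then show ?thesis using e G2 by simp
  qed
  then have Ke: "K * \<theta> + g + (1 + K) * e \<le> K"
  proof -
    have "\<theta> = 1 - 2 * e" unfolding e_def by (simp add: field_simps)
    then have "K * \<theta> = K - 2 * (K * e)" by (simp only: right_diff_distrib mult_1_right mult.left_commute)
    then show ?thesis using \<open>g + e \<le> K * e\<close> by (simp add: distrib_right)
  qed
  have "\<P>(z in DL. x < \<bar>q (fst z)\<bar> + offspring X z) \<le> K * G x"
    if td: "tail_dominated B K X" and Xm: "integral\<^sup>L L X \<le> m" and x: "0 < x" for X x
  proof (cases "x2 \<le> x")
    case True
    note X = tail_dominatedD[OF td]
    have xx: "x0 \<le> x" "x1 \<le> x" using True by (auto simp: x2_def)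
    have Gx: "0 < G x" by (rule tail_pos[OF x])
    have b: "k x \<le> \<theta> * G x" "G (y * x / m) \<le> g * G x" "h x \<le> e" and kk: "kernel (\<lambda>_. 1) (y * x) = ennreal (k x)"
      using x1[OF xx(2)] Gx by (auto simp: field_simps)
    have "mean_jumps X (y * x) = (\<integral>\<^sup>+v. indicator (space D) v * jump_mass X (\<lambda>k. c k v) (y * x) \<partial>D)"
      by (intro nn_integral_cong) auto
    also have "\<dots> \<le> ennreal K * kernel (indicator (space D)) (y * x)"
      using y x by (intro jump_mass_kernel[OF td]) auto
    also have "\<dots> = ennreal (K * k x)" using K k(2) by (simp add: kernel_const[symmetric] kk ennreal_mult)
    finally have jump: "mean_jumps X (y * x) \<le> ennreal (K * k x)" .
    have "ennreal (\<P>(z in DL. x < \<bar>q (fst z)\<bar> + offspring X z))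
      \<le> mean_jumps X (y * x) + ennreal (G (y * x / m)) + ennreal ((1 + K) * (h x * G x))"
      unfolding DP.emeasure_eq_measure[symmetric] by (rule up[OF td Xm xx(1)])
    also have "\<dots> \<le> ennreal (K * k x) + ennreal (G (y * x / m)) + ennreal ((1 + K) * (h x * G x))"
      by (intro add_mono order_refl jump)
    also have "\<dots> = ennreal (K * k x + G (y * x / m) + (1 + K) * (h x * G x))"
      using K k(2) G_nonneg h0[OF xx(1)] by (simp add: ennreal_plus[symmetric] del: ennreal_plus)
    finally have "\<P>(z in DL. x < \<bar>q (fst z)\<bar> + offspring X z) \<le> K * k x + G (y * x / m) + (1 + K) * (h x * G x)"
      using K k(2)[of x] G_nonneg h0[OF xx(1)] by (subst (asm) ennreal_le_iff) (auto intro!: add_nonneg_nonneg mult_nonneg_nonneg)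
    also have "\<dots> \<le> K * (\<theta> * G x) + g * G x + (1 + K) * (e * G x)"
      using b K Gx by (intro add_mono mult_left_mono mult_right_mono) auto
    also have "\<dots> = (K * \<theta> + g + (1 + K) * e) * G x" by (simp add: distrib_right mult.assoc)
    also have "\<dots> \<le> K * G x" using Ke Gx by (intro mult_right_mono) auto
    finally show ?thesis .
  next
    case False
    have "\<P>(z in DL. x < \<bar>q (fst z)\<bar> + offspring X z) \<le> 1" by simp
    also have "1 = 1 / G x2 * G x2" using G2 by simp
    also have "\<dots> \<le> K * G x"
      using K G2 g e False x by (intro mult_mono tail_antimono) (auto simp: K_def)
    finally show ?thesis .
  qed
  then show thesis using K by (rule that[rotated])
qed

text \<open>
  The recursion for the absolute values maps a mean \<open>m\<close> to \<open>E|q| + \<rho>\<^sub>1 m\<close>, which preserves the bound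
  \<open>E|q| / (1 - \<rho>\<^sub>1)\<close>.  The summand 1 makes the bound positive.
\<close>

definition mean_bound :: real where
  "mean_bound = (integral\<^sup>L D (\<lambda>v. \<bar>q v\<bar>) + 1) / (1 - \<rho> 1)"

lemma q_integrable: "integrable D q"
  using D.integrable_of_powr_moment(1)[OF measurable_q q_moment] alpha eps by simp

lemma mean_bound_pos: "0 < mean_bound"
  unfolding mean_bound_def using rho_bounds by (intro divide_pos_pos add_nonneg_pos) auto

lemma nn_integral_branching_sum:
  assumes [measurable]: "X \<in> borel_measurable L"
  shows "(\<integral>\<^sup>+z. (\<Sum>j. ennreal (c j (fst z)) * X (snd z j)) \<partial>DL) = ennreal (\<rho> 1) * (\<integral>\<^sup>+t. X t \<partial>L)"
proof -
  have "(\<integral>\<^sup>+z. (\<Sum>j. ennreal (c j (fst z)) * X (snd z j)) \<partial>DL)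
    = (\<integral>\<^sup>+v. \<integral>\<^sup>+g. (\<Sum>j. ennreal (c j v) * X (g j)) \<partial>PL \<partial>D)"
    by (subst PL.nn_integral_fst[symmetric]) auto
  also have "\<dots> = (\<integral>\<^sup>+v. ennreal (Z v) * (\<integral>\<^sup>+t. X t \<partial>L) \<partial>D)"
    by (simp add: nn_integral_weighted_sum[OF assms] ennreal_Z)
  also have "\<dots> = ennreal (\<rho> 1) * (\<integral>\<^sup>+t. X t \<partial>L)"
    by (simp add: nn_integral_multc nn_integral_Z weight_moment_eq)
  finally show ?thesis .
qed

lemma AE_branching_summable:
  assumes X: "integrable L X"
  shows "AE z in DL. summable (\<lambda>j. c j (fst z) * \<bar>X (snd z j)\<bar>)"
proof -
  have [measurable]: "X \<in> borel_measurable L" using X by auto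
  have "(\<integral>\<^sup>+z. (\<Sum>j. ennreal (c j (fst z)) * ennreal \<bar>X (snd z j)\<bar>) \<partial>DL) = ennreal (\<rho> 1) * (\<integral>\<^sup>+t. ennreal \<bar>X t\<bar> \<partial>L)"
    by (rule nn_integral_branching_sum) simp
  also have "\<dots> < \<infinity>" using X by (auto simp: integrable_iff_bounded ennreal_mult_less_top)
  finally have "AE z in DL. (\<Sum>j. ennreal (c j (fst z)) * ennreal \<bar>X (snd z j)\<bar>) \<noteq> \<infinity>"
    by (intro nn_integral_noteq_infinite) auto
  then show ?thesis
  proof eventually_elim
    case (elim z)
    then show ?case using c_nonneg by (intro summable_suminf_not_top) (auto simp: ennreal_mult)
  qed
qed

text \<open>
  The recursion maps a \<open>p\<close>-th moment \<open>e\<close> to at most \<open>C + \<theta> e\<close>, where \<open>\<theta> = t\<^bsup>1 - p\<^esup> \<rho>\<^sub>p < 1\<close> if \<open>t\<close>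
  is close to 1; so the bound \<open>C / (1 - \<theta>)\<close> is preserved.
\<close>

lemma moment_constant:
  assumes m: "0 < m"
  obtains B where "0 \<le> B" "\<And>X. X \<in> borel_measurable L \<Longrightarrow> \<forall>t. 0 \<le> X t \<Longrightarrow> (\<integral>\<^sup>+t. ennreal (X t) \<partial>L) \<le> ennreal m \<Longrightarrow>
    (\<integral>\<^sup>+t. ennreal (X t powr p) \<partial>L) \<le> ennreal B \<Longrightarrow>
    (\<integral>\<^sup>+z. ennreal ((\<bar>q (fst z)\<bar> + offspring X z) powr p) \<partial>DL) \<le> ennreal B"
proof -
  define r where "r = enn2real (weight_moment D c p)"
  have r: "0 \<le> r" "r < 1" "weight_moment D c p = ennreal r"
  proof -
    show "0 \<le> r" by (simp add: r_def)
    show *: "weight_moment D c p = ennreal r" unfolding r_def using weight_moment_p by (cases "weight_moment D c p") auto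
    show "r < 1" using weight_moment_p unfolding * by (simp add: ennreal_1[symmetric] ennreal_less_iff r_def del: ennreal_1)
  qed
  (* Chosen so that t powr (1 - p) = 2 / (1 + r), hence t powr (1 - p) * r < 1. *)
  define t where "t = ((1 + r) / 2) powr (1 / (p - 1))"
  have t: "0 < t" "t < 1"
  proof -
    show "0 < t" unfolding t_def using r by simp
    have "((1 + r) / 2) powr (1 / (p - 1)) < 1 powr (1 / (p - 1))" using r p by (intro powr_less_mono2) auto
    then show "t < 1" by (simp add: t_def)
  qed
  have tp: "t powr (1 - p) = 2 / (1 + r)"
  proof -
    have "1 / (p - 1) * (1 - p) = - 1" using p by (simp add: field_simps)
    then have "t powr (1 - p) = ((1 + r) / 2) powr (- 1)" unfolding t_def powr_powr by (simp only:)
    also have "\<dots> = 2 / (1 + r)" using r by (simp add: powr_minus_divide)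
    finally show ?thesis .
  qed
  define \<theta> where "\<theta> = t powr (1 - p) * r"
  have th: "0 \<le> \<theta>" "\<theta> < 1" using r by (auto simp: \<theta>_def tp field_simps)
  define S where "S = enn2real (\<integral>\<^sup>+v. ennreal (Z v powr p) \<partial>D)"
  have S: "0 \<le> S" "(\<integral>\<^sup>+v. ennreal (Z v powr p) \<partial>D) = ennreal S"
    using Z_moment_p by (auto simp: S_def less_top[symmetric])
  have qp: "(\<integral>\<^sup>+v. ennreal (\<bar>q v\<bar> powr p) \<partial>D) < \<infinity>"
  proof -
    have "\<bar>q v\<bar> powr p \<le> 1 + \<bar>q v\<bar> powr (\<alpha> + \<epsilon>)" for v
    proof (cases "\<bar>q v\<bar> \<le> 1")
      case True
      then have "\<bar>q v\<bar> powr p \<le> 1 powr p" using p by (intro powr_mono2) auto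
      then show ?thesis by (simp add: add_increasing2)
    next
      case False
      then have "\<bar>q v\<bar> powr p \<le> \<bar>q v\<bar> powr (\<alpha> + \<epsilon>)" using p eps by (intro powr_mono) auto
      then show ?thesis by simp
    qed
    then have "(\<integral>\<^sup>+v. ennreal (\<bar>q v\<bar> powr p) \<partial>D) \<le> (\<integral>\<^sup>+v. ennreal (1 + \<bar>q v\<bar> powr (\<alpha> + \<epsilon>)) \<partial>D)"
      by (intro nn_integral_mono ennreal_leI)
    also have "\<dots> = ennreal (integral\<^sup>L D (\<lambda>v. 1 + \<bar>q v\<bar> powr (\<alpha> + \<epsilon>)))"
      using q_moment by (intro nn_integral_eq_integral) auto
    finally show ?thesis by (rule le_less_trans) simp
  qed
  define A where "A = enn2real (\<integral>\<^sup>+v. ennreal (\<bar>q v\<bar> powr p) \<partial>D)"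
  have A: "0 \<le> A" "(\<integral>\<^sup>+v. ennreal (\<bar>q v\<bar> powr p) \<partial>D) = ennreal A"
    using qp by (auto simp: A_def less_top[symmetric])
  define C where "C = (1 - t) powr (1 - p) * A + t powr (1 - p) * (2 * m powr p * S)"
  have C: "0 \<le> C" using A S by (simp add: C_def)
  define B where "B = C / (1 - \<theta>)"
  have B: "0 \<le> B" "C + \<theta> * B \<le> B"
  proof -
    show "0 \<le> B" unfolding B_def using C th by simp
    have "B * (1 - \<theta>) = C" using th by (simp add: B_def)
    then show "C + \<theta> * B \<le> B" by (simp add: algebra_simps)
  qed
  have "(\<integral>\<^sup>+z. ennreal ((\<bar>q (fst z)\<bar> + offspring X z) powr p) \<partial>DL) \<le> ennreal B"
    if [measurable]: "X \<in> borel_measurable L" and X0: "\<forall>t. 0 \<le> X t" and X1: "(\<integral>\<^sup>+t. ennreal (X t) \<partial>L) \<le> ennreal m"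
      "(\<integral>\<^sup>+t. ennreal (X t powr p) \<partial>L) \<le> ennreal B" for X
  proof -
    note X = X0[rule_format] X1
    have iX: "integrable L X" using X by (intro integrableI_nonneg) (auto simp: top_unique intro: le_less_trans)
    let ?a = "ennreal ((1 - t) powr (1 - p))" and ?b = "ennreal (t powr (1 - p))"
    have "AE z in DL. ennreal ((\<bar>q (fst z)\<bar> + offspring X z) powr p)
      \<le> ?a * ennreal (\<bar>q (fst z)\<bar> powr p) + ?b * ennreal (offspring X z powr p)"
      using AE_branching_summable[OF iX]
    proof eventually_elim
      case (elim z)
      have "0 \<le> offspring X z" using elim X c_nonneg by (intro suminf_nonneg) auto
      then have "(\<bar>q (fst z)\<bar> + offspring X z) powr p
        \<le> (1 - t) powr (1 - p) * \<bar>q (fst z)\<bar> powr p + t powr (1 - p) * (offspring X z) powr p"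
        using t p by (intro powr_add_weighted) auto
      then show ?case
        by (simp add: ennreal_mult[symmetric] ennreal_plus[symmetric] ennreal_leI del: ennreal_plus)
    qed
    then have "(\<integral>\<^sup>+z. ennreal ((\<bar>q (fst z)\<bar> + offspring X z) powr p) \<partial>DL)
      \<le> (\<integral>\<^sup>+z. ?a * ennreal (\<bar>q (fst z)\<bar> powr p) + ?b * ennreal (offspring X z powr p) \<partial>DL)"
      by (rule nn_integral_mono_AE)
    also have "\<dots> = (\<integral>\<^sup>+v. (\<integral>\<^sup>+g. ?a * ennreal (\<bar>q v\<bar> powr p) + ?b * ennreal ((\<Sum>j. c j v * X (g j)) powr p) \<partial>PL) \<partial>D)"
      by (subst PL.nn_integral_fst[symmetric]) auto
    also have "\<dots> = (\<integral>\<^sup>+v. ?a * ennreal (\<bar>q v\<bar> powr p) + ?b * (\<integral>\<^sup>+g. ennreal ((\<Sum>j. c j v * X (g j)) powr p) \<partial>PL) \<partial>D)"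
      by (simp add: nn_integral_add nn_integral_cmult PL.emeasure_space_1)
    also have "\<dots> \<le> (\<integral>\<^sup>+v. ?a * ennreal (\<bar>q v\<bar> powr p) + ?b * ((\<Sum>j. ennreal (c j v powr p)) * ennreal B + ennreal (2 * m powr p) * ennreal (Z v powr p)) \<partial>D)"
    proof (intro nn_integral_mono add_left_mono mult_left_mono)
      fix v
      have "(\<integral>\<^sup>+g. ennreal ((\<Sum>j. c j v * X (g j)) powr p) \<partial>PL)
        \<le> (\<Sum>j. ennreal (c j v powr p)) * (\<integral>\<^sup>+x. ennreal (X x powr p) \<partial>L) + ennreal (2 * m powr p * Z v powr p)"
        unfolding Z_def by (rule powr_moment_fixed_weights) (use X m p c_nonneg c_summable in auto)
      also have "\<dots> \<le> (\<Sum>j. ennreal (c j v powr p)) * ennreal B + ennreal (2 * m powr p * Z v powr p)"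
        by (intro add_right_mono mult_left_mono X) auto
      finally show "(\<integral>\<^sup>+g. ennreal ((\<Sum>j. c j v * X (g j)) powr p) \<partial>PL)
        \<le> (\<Sum>j. ennreal (c j v powr p)) * ennreal B + ennreal (2 * m powr p) * ennreal (Z v powr p)"
        by (simp add: ennreal_mult)
    qed auto
    also have "\<dots> = ?a * ennreal A + ?b * (ennreal r * ennreal B + ennreal (2 * m powr p) * ennreal S)"
      unfolding A(2)[symmetric] S(2)[symmetric] r(3)[symmetric] weight_moment_def
      by (simp add: nn_integral_add nn_integral_cmult nn_integral_multc)
    also have "\<dots> = ennreal (C + \<theta> * B)"
      using A S r B m unfolding C_def \<theta>_def
      by (simp add: ennreal_mult[symmetric] ennreal_plus[symmetric] del: ennreal_plus) (simp add: algebra_simps)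
    also have "\<dots> \<le> ennreal B" by (intro ennreal_leI B)
    finally show ?thesis .
  qed
  then show thesis using B(1) by (rule that[rotated])
qed

lemma integral_branching_sum:
  assumes X: "integrable L X"
  shows "integral\<^sup>L DL (\<lambda>z. q (fst z) + offspring X z) = integral\<^sup>L D q + \<rho> 1 * integral\<^sup>L L X"
proof -
  have [measurable]: "X \<in> borel_measurable L" using X by auto
  interpret P2: pair_sigma_finite D PL ..
  have ic: "integrable D (c j)" for j
  proof (rule integrableI_nonneg)
    have "(\<integral>\<^sup>+v. ennreal (c j v) \<partial>D) \<le> (\<integral>\<^sup>+v. ennreal (Z v) \<partial>D)"
    proof (intro nn_integral_mono)
      fix v
      have "ennreal (c j v) = (\<Sum>j\<in>{j}. ennreal (c j v))" by simp
      also have "\<dots> \<le> ennreal (Z v)" unfolding ennreal_Z by (rule sum_le_suminf) auto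
      finally show "ennreal (c j v) \<le> ennreal (Z v)" .
    qed
    then show "(\<integral>\<^sup>+v. ennreal (c j v) \<partial>D) < \<infinity>" by (rule le_less_trans) (simp add: nn_integral_Z weight_moment_eq)
  qed (auto simp: c_nonneg)
  have coord: "integrable PL (\<lambda>g. Y (g j))" "integral\<^sup>L PL (\<lambda>g. Y (g j)) = integral\<^sup>L L Y" if Y: "integrable L Y" for Y :: "'l \<Rightarrow> real" and j
  proof -
    have e: "distr PL L (\<lambda>g. g j) = L" by (rule distr_PiM_component) (auto intro: prob_space_axioms)
    have [measurable]: "Y \<in> borel_measurable L" using Y by auto
    show "integrable PL (\<lambda>g. Y (g j))" using integrable_distr[of "\<lambda>g. g j" PL L Y] Y e by simp
    show "integral\<^sup>L PL (\<lambda>g. Y (g j)) = integral\<^sup>L L Y" using integral_distr[of "\<lambda>g. g j" PL L Y] e by simp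
  qed
  have summand: "integrable DL (\<lambda>z. c j (fst z) * Y (snd z j))"
    "integral\<^sup>L DL (\<lambda>z. c j (fst z) * Y (snd z j)) = integral\<^sup>L D (c j) * integral\<^sup>L L Y" if Y: "integrable L Y" for Y :: "'l \<Rightarrow> real" and j
  proof -
    have [measurable]: "Y \<in> borel_measurable L" using Y by auto
    have [measurable]: "(\<lambda>z. c j (fst z) * Y (snd z j)) \<in> borel_measurable DL" by measurable
    show i: "integrable DL (\<lambda>z. c j (fst z) * Y (snd z j))"
      by (rule P2.Fubini_integrable) (use ic coord[OF Y] coord[OF integrable_norm[OF Y]] in \<open>auto simp: abs_mult\<close>)
    show "integral\<^sup>L DL (\<lambda>z. c j (fst z) * Y (snd z j)) = integral\<^sup>L D (c j) * integral\<^sup>L L Y"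
      using P2.integral_fst'[OF i] by (simp add: coord[OF Y])
  qed
  have sc: "(\<lambda>j. integral\<^sup>L D (c j)) sums \<rho> 1"
  proof -
    have nn: "(\<integral>\<^sup>+v. ennreal (c j v) \<partial>D) = ennreal (integral\<^sup>L D (c j))" for j
      using ic c_nonneg by (intro nn_integral_eq_integral) auto
    have "ennreal (\<rho> 1) = (\<Sum>j. ennreal (integral\<^sup>L D (c j)))"
      unfolding weight_moment_eq(1)[symmetric] nn_integral_Z[symmetric] ennreal_Z nn[symmetric]
      by (rule nn_integral_suminf) simp
    moreover have c0: "0 \<le> integral\<^sup>L D (c j)" for j using c_nonneg by simp
    ultimately have "summable (\<lambda>j. integral\<^sup>L D (c j))"
      by (intro summable_suminf_not_top) auto
    moreover have "ennreal (\<rho> 1) = ennreal (\<Sum>j. integral\<^sup>L D (c j))"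
      using \<open>ennreal (\<rho> 1) = _\<close> calculation c0 by (simp add: suminf_ennreal2)
    then have "\<rho> 1 = (\<Sum>j. integral\<^sup>L D (c j))"
      using rho_bounds suminf_nonneg[OF calculation c0] by simp
    ultimately show ?thesis by (simp add: sums_iff)
  qed
  have AEs: "AE z in DL. summable (\<lambda>j. norm (c j (fst z) * X (snd z j)))"
    using AE_branching_summable[OF X] c_nonneg by (simp add: abs_mult)
  have S: "summable (\<lambda>j. \<integral>z. norm (c j (fst z) * X (snd z j)) \<partial>DL)"
    using sums_summable[OF sc] c_nonneg summand(2)[OF integrable_norm[OF X]]
    by (simp add: abs_mult summable_mult2)
  have i: "integrable DL (\<lambda>z. \<Sum>j. c j (fst z) * X (snd z j))"
    by (rule integrable_suminf[OF summand(1)[OF X] AEs S])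
  have "integral\<^sup>L DL (\<lambda>z. \<Sum>j. c j (fst z) * X (snd z j)) = (\<Sum>j. integral\<^sup>L D (c j) * integral\<^sup>L L X)"
    unfolding summand(2)[OF X, symmetric] by (rule integral_suminf[OF summand(1)[OF X] AEs S])
  also have "\<dots> = \<rho> 1 * integral\<^sup>L L X"
    using sc by (simp add: sums_iff suminf_mult2[symmetric])
  finally have e: "integral\<^sup>L DL (\<lambda>z. \<Sum>j. c j (fst z) * X (snd z j)) = \<rho> 1 * integral\<^sup>L L X" .
  have q: "integrable DL (\<lambda>z. q (fst z))" "integral\<^sup>L DL (\<lambda>z. q (fst z)) = integral\<^sup>L D q"
  proof -
    show iq: "integrable DL (\<lambda>z. q (fst z))"
      by (rule P2.Fubini_integrable) (use q_integrable in \<open>auto simp: PL.prob_space\<close>)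
    show "integral\<^sup>L DL (\<lambda>z. q (fst z)) = integral\<^sup>L D q"
      using P2.integral_fst'[OF iq] by (simp add: PL.prob_space)
  qed
  show ?thesis using q i e by simp
qed

end

section \<open>Trees and their branches\<close>

lemma countable_tree_nodes[simp]: "countable tree_nodes"
  by (rule countableI_type)

lemma Nil_in_tree_nodes[simp]: "[] \<in> tree_nodes" by (simp add: tree_nodes_def)

lemma Cons_in_tree_nodes[simp]: "k # i \<in> tree_nodes \<longleftrightarrow> 1 \<le> k \<and> i \<in> tree_nodes"
  by (auto simp: tree_nodes_def)

lemma tree_nodes_decomp:
  "tree_nodes = {[]} \<union> (\<lambda>(j, i). Suc j # i) ` (UNIV \<times> tree_nodes)"
proof (intro set_eqI iffI)
  fix i assume i: "i \<in> tree_nodes"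
  show "i \<in> {[]} \<union> (\<lambda>(j, i). Suc j # i) ` (UNIV \<times> tree_nodes)"
  proof (cases i)
    case (Cons k i')
    then show ?thesis using i by (auto intro!: image_eqI[of _ _ "(k - 1, i')"])
  qed simp
qed auto

lemma inj_child: "inj_on (\<lambda>(j, i). Suc j # i) A"
  by (auto simp: inj_on_def)

text \<open>
  Summation over the root and then over the branches.
\<close>

lemma nn_integral_tree_nodes:
  fixes u :: "nat list \<Rightarrow> ennreal"
  shows "(\<integral>\<^sup>+i. u i \<partial>count_space tree_nodes) = u [] + (\<Sum>j. \<integral>\<^sup>+i. u (Suc j # i) \<partial>count_space tree_nodes)"
proof -
  let ?C = "(\<lambda>(j::nat, i). Suc j # i) ` (UNIV \<times> tree_nodes)"
  interpret sf: sigma_finite_measure "count_space tree_nodes"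
    by (rule sigma_finite_measure_count_space_countable) simp
  have "(\<integral>\<^sup>+i. u i \<partial>count_space tree_nodes) = (\<integral>\<^sup>+i. u i * indicator {[]} i + u i * indicator ?C i \<partial>count_space tree_nodes)"
    by (intro nn_integral_cong) (subst (asm) tree_nodes_decomp, auto simp: indicator_def)
  also have "\<dots> = (\<integral>\<^sup>+i. u i * indicator {[]} i \<partial>count_space tree_nodes) + (\<integral>\<^sup>+i. u i * indicator ?C i \<partial>count_space tree_nodes)"
    by (intro nn_integral_add) auto
  also have "(\<integral>\<^sup>+i. u i * indicator {[]} i \<partial>count_space tree_nodes) = u []"
    by (subst nn_integral_indicator_singleton) auto
  also have "(\<integral>\<^sup>+i. u i * indicator ?C i \<partial>count_space tree_nodes) = (\<integral>\<^sup>+i. u i \<partial>count_space ?C)"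
  proof -
    have "tree_nodes \<inter> ?C = ?C" by auto
    then show ?thesis
      by (subst nn_integral_count_space_indicator, simp, subst nn_integral_count_space_indicator, simp)
        (auto intro!: nn_integral_cong simp: indicator_def)
  qed
  also have "\<dots> = (\<integral>\<^sup>+z. u (case z of (j, i) \<Rightarrow> Suc j # i) \<partial>count_space (UNIV \<times> tree_nodes))"
    by (rule nn_integral_bij_count_space[symmetric]) (rule inj_on_imp_bij_betw[OF inj_child])
  also have "\<dots> = (\<integral>\<^sup>+z. u (case z of (j, i) \<Rightarrow> Suc j # i) \<partial>(count_space UNIV \<Otimes>\<^sub>M count_space tree_nodes))"
    by (simp add: pair_measure_countable)
  also have "\<dots> = (\<integral>\<^sup>+j. \<integral>\<^sup>+i. u (Suc j # i) \<partial>count_space tree_nodes \<partial>count_space UNIV)"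
    by (subst sf.nn_integral_fst[symmetric]) (auto simp: pair_measure_countable)
  also have "\<dots> = (\<Sum>j. \<integral>\<^sup>+i. u (Suc j # i) \<partial>count_space tree_nodes)"
    by (rule nn_integral_count_space_nat)
  finally show ?thesis .
qed

lemma infsetsum_tree_nodes:
  fixes u :: "nat list \<Rightarrow> real"
  assumes u: "Infinite_Set_Sum.abs_summable_on u tree_nodes"
  shows "infsetsum u tree_nodes = u [] + (\<Sum>j. infsetsum (\<lambda>i. u (Suc j # i)) tree_nodes)"
    and "summable (\<lambda>j. infsetsum (\<lambda>i. u (Suc j # i)) tree_nodes)"
proof -
  let ?C = "(\<lambda>(j::nat, i). Suc j # i) ` (UNIV \<times> tree_nodes)"
  have uC: "Infinite_Set_Sum.abs_summable_on u ?C"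
    by (rule abs_summable_on_subset[OF u]) auto
  have uS: "Infinite_Set_Sum.abs_summable_on (\<lambda>(j, i). u (Suc j # i)) (UNIV \<times> tree_nodes)"
    using abs_summable_on_reindex_iff[OF inj_child, of u "UNIV \<times> tree_nodes"] uC by (simp add: case_prod_beta')
  have uJ: "Infinite_Set_Sum.abs_summable_on (\<lambda>j. infsetsum (\<lambda>i. u (Suc j # i)) tree_nodes) UNIV"
    using abs_summable_on_Sigma_project1'[OF uS] by simp
  have "infsetsum u tree_nodes = infsetsum u ({[]} \<union> ?C)" by (subst tree_nodes_decomp) simp
  also have "\<dots> = u [] + infsetsum u ?C"
    using uC by (subst infsetsum_Un_disjoint) auto
  also have "infsetsum u ?C = infsetsum (\<lambda>(j, i). u (Suc j # i)) (UNIV \<times> tree_nodes)"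
    by (subst infsetsum_reindex[OF inj_child]) (simp add: case_prod_beta')
  also have "\<dots> = infsetsum (\<lambda>j. infsetsum (\<lambda>i. u (Suc j # i)) tree_nodes) UNIV"
    by (rule infsetsum_Sigma'[symmetric, OF _ _ uS]) auto
  also have "\<dots> = (\<Sum>j. infsetsum (\<lambda>i. u (Suc j # i)) tree_nodes)"
    by (rule infsetsum_nat'[OF uJ])
  finally show "infsetsum u tree_nodes = u [] + (\<Sum>j. infsetsum (\<lambda>i. u (Suc j # i)) tree_nodes)" .
  show "summable (\<lambda>j. infsetsum (\<lambda>i. u (Suc j # i)) tree_nodes)"
    using uJ unfolding abs_summable_on_nat_iff' by (rule summable_norm_cancel)
qed

text \<open>
  The branch at the child \<open>Suc j\<close>, as a family indexed by all nodes; children are numbered from 1.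
\<close>

definition subtree :: "nat \<Rightarrow> (nat list \<Rightarrow> 'v) \<Rightarrow> nat list \<Rightarrow> 'v" where
  "subtree j f = (\<lambda>i\<in>tree_nodes. f (Suc j # i))"

lemma measurable_subtree[measurable]:
  "subtree j \<in> measurable (PiM tree_nodes (\<lambda>_. D)) (PiM tree_nodes (\<lambda>_. D))"
  unfolding subtree_def by (intro measurable_restrict measurable_component_singleton) simp

text \<open>
  A product measure over the nodes splits into the root and the branches, each of which is again a
  copy of the whole tree.  All of this is grouping of independent coordinates.
\<close>

lemma tree_law_decomposition:
  fixes D :: "'v measure"
  assumes D: "prob_space D"
  defines "T \<equiv> PiM tree_nodes (\<lambda>_. D)"
  shows "distr T (D \<Otimes>\<^sub>M PiM UNIV (\<lambda>_. T)) (\<lambda>f. (f [], \<lambda>j. subtree j f)) = D \<Otimes>\<^sub>M PiM UNIV (\<lambda>_. T)"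
proof -
  interpret D: prob_space D by fact
  interpret T: prob_space T unfolding T_def by (intro prob_space_PiM D)
  have comp: "(\<lambda>f. f i) \<in> measurable T D" if "i \<in> tree_nodes" for i
    unfolding T_def using that by (rule measurable_component_singleton)
  have dcomp: "distr T D (\<lambda>f. f i) = D" if "i \<in> tree_nodes" for i
    unfolding T_def using that by (intro distr_PiM_component D)
  have ind: "T.indep_vars (\<lambda>_. D) (\<lambda>i f. f i) tree_nodes"
  proof (subst T.indep_vars_iff_distr_eq_PiM')
    have "distr T (PiM tree_nodes (\<lambda>_. D)) (\<lambda>x. \<lambda>i\<in>tree_nodes. x i) = distr T T (\<lambda>x. x)"
      unfolding T_def by (intro distr_cong) (auto simp: space_PiM PiE_restrict)
    also have "\<dots> = T" by (rule distr_id2) simp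
    also have "T = PiM tree_nodes (\<lambda>i. distr T D (\<lambda>f. f i))"
      unfolding T_def by (intro PiM_cong refl) (simp add: dcomp[unfolded T_def])
    finally show "distr T (PiM tree_nodes (\<lambda>_. D)) (\<lambda>x. \<lambda>i\<in>tree_nodes. x i) = PiM tree_nodes (\<lambda>i. distr T D (\<lambda>f. f i))" .
  qed (use comp Nil_in_tree_nodes in blast)+
  have sub: "subtree j \<in> measurable T T" for j unfolding T_def by measurable
  have dsub: "distr T T (subtree j) = T" for j
  proof -
    have "distr (PiM tree_nodes (\<lambda>_. D)) (PiM tree_nodes (\<lambda>_. D)) (\<lambda>f. \<lambda>i\<in>tree_nodes. f (Suc j # i)) = PiM tree_nodes (\<lambda>_. D)"
      using distr_PiM_reindex[of tree_nodes "\<lambda>_. D" "\<lambda>i. Suc j # i" tree_nodes] D by (auto simp: inj_on_def)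
    then show ?thesis unfolding T_def subtree_def .
  qed
  define Y where "Y j h = (\<lambda>i\<in>tree_nodes. h (Suc j # i))" for j and h :: "nat list \<Rightarrow> 'v"
  have Ym: "Y j \<in> measurable (PiM A (\<lambda>_. D)) T" if "(\<lambda>i. Suc j # i) ` tree_nodes \<subseteq> A" for j A
    unfolding T_def Y_def using that by (intro measurable_restrict measurable_component_singleton) auto
  have indsub: "T.indep_vars (\<lambda>_. T) subtree UNIV"
  proof -
    have "T.indep_vars (\<lambda>j. PiM ((\<lambda>i. Suc j # i) ` tree_nodes) (\<lambda>_. D)) (\<lambda>j f. restrict (\<lambda>i. f i) ((\<lambda>i. Suc j # i) ` tree_nodes)) UNIV"
      by (rule T.indep_vars_restrict[OF ind]) (auto simp: disjoint_family_on_def)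
    then have "T.indep_vars (\<lambda>_. T) (\<lambda>j f. Y j (restrict (\<lambda>i. f i) ((\<lambda>i. Suc j # i) ` tree_nodes))) UNIV"
      by (rule T.indep_vars_compose2) (auto intro!: Ym)
    moreover have "(\<lambda>j f. Y j (restrict (\<lambda>i. f i) ((\<lambda>i. Suc j # i) ` tree_nodes))) = subtree"
      by (auto simp: fun_eq_iff Y_def subtree_def restrict_def)
    ultimately show ?thesis by simp
  qed
  have dsubs: "distr T (PiM UNIV (\<lambda>_. T)) (\<lambda>f j. subtree j f) = PiM UNIV (\<lambda>_. T)"
    using T.indep_vars_iff_distr_eq_PiM[where I = UNIV and M' = "\<lambda>_. T" and X = subtree] indsub sub by (simp add: dsub restrict_UNIV)
  define B where "B = tree_nodes - {[]}"
  define P1 P2 where "P1 = PiM {[]} (\<lambda>_::nat list. D)" and "P2 = PiM B (\<lambda>_. D)"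
  define r1 r2 where "r1 f = restrict (\<lambda>i. f i) {[]}" and "r2 f = restrict (\<lambda>i. f i) B" for f :: "nat list \<Rightarrow> 'v"
  define g1 g2 where "g1 h = h []" and "g2 h = (\<lambda>j. Y j h)" for h :: "nat list \<Rightarrow> 'v"
  have "T.indep_var P1 r1 P2 r2"
    unfolding P1_def P2_def r1_def r2_def B_def by (rule T.indep_var_restrict[OF ind]) auto
  then have r: "r1 \<in> measurable T P1" "r2 \<in> measurable T P2"
    and joint: "distr T P1 r1 \<Otimes>\<^sub>M distr T P2 r2 = distr T (P1 \<Otimes>\<^sub>M P2) (\<lambda>f. (r1 f, r2 f))"
    unfolding T.indep_var_distribution_eq by auto
  have g1: "g1 \<in> measurable P1 D"
    unfolding g1_def P1_def by (rule measurable_component_singleton) simp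
  have YB: "Y j \<in> measurable P2 T" for j
    unfolding P2_def B_def by (rule Ym) auto
  have g2: "g2 \<in> measurable P2 (PiM UNIV (\<lambda>_. T))"
    unfolding g2_def by (rule measurable_PiM_single') (auto intro!: YB simp: PiE_UNIV_domain measurable_space[OF YB])
  have gr1: "g1 (r1 f) = f []" for f by (simp add: g1_def r1_def)
  have gr2: "g2 (r2 f) = (\<lambda>j. subtree j f)" for f
    by (auto simp: fun_eq_iff g2_def r2_def Y_def B_def subtree_def restrict_def)
  have d1: "distr (distr T P1 r1) D g1 = D"
    by (subst distr_distr[OF g1 r(1)]) (simp add: comp_def gr1 dcomp)
  have d2: "distr (distr T P2 r2) (PiM UNIV (\<lambda>_. T)) g2 = PiM UNIV (\<lambda>_. T)"
    by (subst distr_distr[OF g2 r(2)]) (simp add: comp_def gr2 dsubs)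
  interpret PT: prob_space "PiM UNIV (\<lambda>_::nat. T)" by (intro prob_space_PiM T.prob_space_axioms)
  have rr: "(\<lambda>f. (r1 f, r2 f)) \<in> measurable T (P1 \<Otimes>\<^sub>M P2)" using r by simp
  have gg: "(\<lambda>(x, y). (g1 x, g2 y)) \<in> measurable (P1 \<Otimes>\<^sub>M P2) (D \<Otimes>\<^sub>M PiM UNIV (\<lambda>_. T))"
    using g1 g2 by measurable
  have "D \<Otimes>\<^sub>M PiM UNIV (\<lambda>_. T) = distr (distr T P1 r1) D g1 \<Otimes>\<^sub>M distr (distr T P2 r2) (PiM UNIV (\<lambda>_. T)) g2"
    by (simp only: d1 d2)
  also have "\<dots> = distr (distr T P1 r1 \<Otimes>\<^sub>M distr T P2 r2) (D \<Otimes>\<^sub>M PiM UNIV (\<lambda>_. T)) (\<lambda>(x, y). (g1 x, g2 y))"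
    using g1 g2 by (intro pair_measure_distr) (auto simp: d2 PT.sigma_finite_measure_axioms)
  also have "\<dots> = distr T (D \<Otimes>\<^sub>M PiM UNIV (\<lambda>_. T)) ((\<lambda>(x, y). (g1 x, g2 y)) \<circ> (\<lambda>f. (r1 f, r2 f)))"
    unfolding joint by (rule distr_distr[OF gg rr])
  also have "(\<lambda>(x, y). (g1 x, g2 y)) \<circ> (\<lambda>f. (r1 f, r2 f)) = (\<lambda>f. (f [], \<lambda>j. subtree j f))"
    by (simp add: comp_def gr1 gr2)
  finally show ?thesis by simp
qed

text \<open>
  Here the summands of the recursion are functions of a whole tree, so \<open>L\<close> is the law of an i.i.d.
  family of vectors indexed by the nodes.
\<close>

locale branching_tree = branching_law "PiM tree_nodes (\<lambda>_. D)" D q c \<alpha> \<epsilon> p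
  for D :: "'v measure" and q c \<alpha> \<epsilon> p
begin

abbreviation "T \<equiv> PiM tree_nodes (\<lambda>_. D)"

definition split_root :: "(nat list \<Rightarrow> 'v) \<Rightarrow> 'v \<times> (nat \<Rightarrow> nat list \<Rightarrow> 'v)" where
  "split_root f = (f [], \<lambda>j. subtree j f)"

lemma measurable_split_root[measurable]: "split_root \<in> measurable T DL"
proof -
  have 1: "(\<lambda>f. f []) \<in> measurable T D" by (rule measurable_component_singleton) simp
  have 2: "(\<lambda>f j. subtree j f) \<in> measurable T PL"
    by (rule measurable_PiM_single') (auto simp: space_PiM[of UNIV] measurable_space[OF measurable_subtree])
  show ?thesis unfolding split_root_def by (rule measurable_Pair[OF 1 2])
qed

lemma distr_split_root: "distr T DL split_root = DL"
  unfolding split_root_def by (rule tree_law_decomposition[OF D.prob_space_axioms])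

lemma nn_integral_split_root:
  assumes "F \<in> borel_measurable DL"
  shows "(\<integral>\<^sup>+f. F (split_root f) \<partial>T) = (\<integral>\<^sup>+z. F z \<partial>DL)"
  using nn_integral_distr[OF measurable_split_root, of F] assms unfolding distr_split_root by simp

lemma prob_split_root:
  assumes "Measurable.pred DL P"
  shows "\<P>(f in T. P (split_root f)) = \<P>(z in DL. P z)"
proof -
  have "\<P>(z in DL. P z) = measure (distr T DL split_root) {z\<in>space DL. P z}"
    by (simp only: distr_split_root)
  also have "\<dots> = prob (split_root -` {z\<in>space DL. P z} \<inter> space T)"
    using assms by (intro measure_distr) auto
  also have "split_root -` {z\<in>space DL. P z} \<inter> space T = {f\<in>space T. P (split_root f)}"
    using measurable_space[OF measurable_split_root] by auto
  finally show ?thesis by simp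
qed

text \<open>
  The sum of \<open>|q \<Pi>|\<close> over the nodes of depth less than \<open>n\<close>, defined by the recursion at the root;
  \<open>abs_sum_eq\<close> identifies it with that sum.
\<close>

primrec abs_sum :: "nat \<Rightarrow> (nat list \<Rightarrow> 'v) \<Rightarrow> ennreal" where
  "abs_sum 0 = (\<lambda>f. 0)"
| "abs_sum (Suc n) = (\<lambda>f. ennreal \<bar>q (f [])\<bar> + (\<Sum>j. ennreal (c j (f [])) * abs_sum n (subtree j f)))"

lemma abs_sum_Suc: "abs_sum (Suc n) f = ennreal \<bar>q (fst (split_root f))\<bar> + (\<Sum>j. ennreal (c j (fst (split_root f))) * abs_sum n (snd (split_root f) j))"
  by (simp add: split_root_def)

lemma measurable_abs_sum[measurable]: "abs_sum n \<in> borel_measurable T"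
proof (induction n)
  case (Suc n)
  note [measurable] = Suc
  have "(\<lambda>f. ennreal \<bar>q (fst (split_root f))\<bar> + (\<Sum>j. ennreal (c j (fst (split_root f))) * abs_sum n (snd (split_root f) j))) \<in> borel_measurable T"
    by measurable
  then show ?case by (simp only: abs_sum_Suc[symmetric, abs_def])
qed simp

lemma abs_sum_mono: "abs_sum n f \<le> abs_sum (Suc n) f"
proof (induction n arbitrary: f)
  case (Suc n)
  have 1: "abs_sum (Suc n) f = ennreal \<bar>q (f [])\<bar> + (\<Sum>j. ennreal (c j (f [])) * abs_sum n (subtree j f))" by simp
  have 2: "abs_sum (Suc (Suc n)) f = ennreal \<bar>q (f [])\<bar> + (\<Sum>j. ennreal (c j (f [])) * abs_sum (Suc n) (subtree j f))"
    by (simp only: abs_sum.simps(2)[of "Suc n"])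
  show ?case unfolding 1 2
    by (intro add_left_mono suminf_le mult_left_mono Suc) auto
qed simp

definition abs_total :: "(nat list \<Rightarrow> 'v) \<Rightarrow> ennreal" where "abs_total f = (SUP n. abs_sum n f)"

lemma measurable_abs_total[measurable]: "abs_total \<in> borel_measurable T" unfolding abs_total_def by measurable

text \<open>
  The real-valued version, to which the one-step estimates apply.
\<close>

definition dom_sum :: "nat \<Rightarrow> (nat list \<Rightarrow> 'v) \<Rightarrow> real" where "dom_sum n f = enn2real (abs_sum n f)"

lemma measurable_dom_sum[measurable]: "dom_sum n \<in> borel_measurable T" unfolding dom_sum_def by measurable

lemma nn_integral_abs_sum: "(\<integral>\<^sup>+f. abs_sum n f \<partial>T) \<le> ennreal mean_bound"
proof (induction n)
  case (Suc n)
  have "(\<integral>\<^sup>+f. abs_sum (Suc n) f \<partial>T) = (\<integral>\<^sup>+z. ennreal \<bar>q (fst z)\<bar> + (\<Sum>j. ennreal (c j (fst z)) * abs_sum n (snd z j)) \<partial>DL)"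
    unfolding abs_sum_Suc by (rule nn_integral_split_root) measurable
  also have "\<dots> = (\<integral>\<^sup>+v. ennreal \<bar>q v\<bar> \<partial>D) + ennreal (\<rho> 1) * (\<integral>\<^sup>+f. abs_sum n f \<partial>T)"
  proof -
    have "(\<integral>\<^sup>+z. ennreal \<bar>q (fst z)\<bar> \<partial>DL) = (\<integral>\<^sup>+v. ennreal \<bar>q v\<bar> \<partial>D)"
      by (subst PL.nn_integral_fst[symmetric]) (auto simp: PL.emeasure_space_1)
    then show ?thesis by (subst nn_integral_add) (auto simp: nn_integral_branching_sum[OF measurable_abs_sum])
  qed
  also have "\<dots> \<le> ennreal (integral\<^sup>L D (\<lambda>v. \<bar>q v\<bar>)) + ennreal (\<rho> 1) * ennreal mean_bound"
    using q_integrable by (intro add_mono mult_left_mono Suc) (auto simp: nn_integral_eq_integral)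
  also have "\<dots> = ennreal (integral\<^sup>L D (\<lambda>v. \<bar>q v\<bar>) + \<rho> 1 * mean_bound)"
    using rho_bounds mean_bound_pos by (simp add: ennreal_mult)
  also have "\<dots> \<le> ennreal mean_bound"
  proof (rule ennreal_leI)
    have "mean_bound * (1 - \<rho> 1) = integral\<^sup>L D (\<lambda>v. \<bar>q v\<bar>) + 1"
      unfolding mean_bound_def using rho_bounds by simp
    then show "integral\<^sup>L D (\<lambda>v. \<bar>q v\<bar>) + \<rho> 1 * mean_bound \<le> mean_bound" by (simp add: algebra_simps)
  qed
  finally show ?case .
qed simp

lemma nn_integral_abs_total: "(\<integral>\<^sup>+f. abs_total f \<partial>T) \<le> ennreal mean_bound"
proof -
  have "incseq abs_sum" using abs_sum_mono by (intro incseq_SucI) (auto simp: le_fun_def)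
  then have "(\<integral>\<^sup>+f. abs_total f \<partial>T) = (SUP n. \<integral>\<^sup>+f. abs_sum n f \<partial>T)"
    unfolding abs_total_def by (rule nn_integral_monotone_convergence_SUP) measurable
  also have "\<dots> \<le> ennreal mean_bound" by (intro SUP_least nn_integral_abs_sum)
  finally show ?thesis .
qed

lemma AE_abs_total_finite: "AE f in T. abs_total f < \<infinity>"
  using nn_integral_abs_total by (subst less_top[symmetric] infinity_ennreal_def)+
    (intro nn_integral_noteq_infinite[unfolded infinity_ennreal_def], auto simp: top_unique)

lemma nn_integral_dom_sum: "(\<integral>\<^sup>+f. ennreal (dom_sum n f) \<partial>T) \<le> ennreal mean_bound"
proof -
  have "(\<integral>\<^sup>+f. ennreal (dom_sum n f) \<partial>T) \<le> (\<integral>\<^sup>+f. abs_sum n f \<partial>T)"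
    unfolding dom_sum_def by (intro nn_integral_mono) (metis enn2real_nonneg ennreal_enn2real_if order_refl top_greatest)
  also have "\<dots> \<le> ennreal mean_bound" by (rule nn_integral_abs_sum)
  finally show ?thesis .
qed

lemma dom_sum_mean: "integral\<^sup>L T (dom_sum n) \<le> mean_bound"
proof -
  have "integrable T (dom_sum n)"
    using nn_integral_dom_sum[of n] by (intro integrableI_nonneg) (auto simp: dom_sum_def intro: le_less_trans)
  then have "ennreal (integral\<^sup>L T (dom_sum n)) \<le> ennreal mean_bound"
    using nn_integral_dom_sum[of n] by (subst nn_integral_eq_integral[symmetric]) (auto simp: dom_sum_def)
  then show ?thesis using mean_bound_pos by (subst (asm) ennreal_le_iff) auto
qed

text \<open>
  In law, \<open>dom_sum (Suc n)\<close> is the right-hand side of the recursion for absolute values, applied to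
  \<open>dom_sum n\<close>.  The two sides agree almost surely only, because of infinite values.
\<close>

lemma dom_sum_Suc:
  obtains \<Psi> where "\<Psi> \<in> borel_measurable DL" "\<And>f. dom_sum (Suc n) f = \<Psi> (split_root f)"
    "AE z in DL. \<Psi> z = \<bar>q (fst z)\<bar> + offspring (dom_sum n) z"
proof -
  define \<Psi> where "\<Psi> z = enn2real (ennreal \<bar>q (fst z)\<bar> + (\<Sum>j. ennreal (c j (fst z)) * abs_sum n (snd z j)))" for z
  have 1: "\<Psi> \<in> borel_measurable DL" unfolding \<Psi>_def by measurable
  have 2: "dom_sum (Suc n) f = \<Psi> (split_root f)" for f unfolding dom_sum_def \<Psi>_def abs_sum_Suc ..
  have fin: "AE z in DL. (\<Sum>j. ennreal (c j (fst z)) * abs_sum n (snd z j)) \<noteq> \<infinity>"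
  proof (rule nn_integral_noteq_infinite)
    have "ennreal (\<rho> 1) * (\<integral>\<^sup>+t. abs_sum n t \<partial>T) \<le> ennreal (\<rho> 1) * ennreal mean_bound"
      by (intro mult_left_mono nn_integral_abs_sum) auto
    also have "\<dots> < \<infinity>" by (simp add: ennreal_mult_less_top)
    finally show "(\<integral>\<^sup>+z. (\<Sum>j. ennreal (c j (fst z)) * abs_sum n (snd z j)) \<partial>DL) \<noteq> \<infinity>"
      unfolding nn_integral_branching_sum[OF measurable_abs_sum] by simp
  qed measurable
  then have 3: "AE z in DL. \<Psi> z = \<bar>q (fst z)\<bar> + offspring (dom_sum n) z"
  proof eventually_elim
    case (elim z)
    have e: "ennreal (c j (fst z)) * abs_sum n (snd z j) = ennreal (c j (fst z) * dom_sum n (snd z j))" for j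
    proof (cases "c j (fst z) = 0")
      case False
      have "(\<Sum>i\<in>{j}. ennreal (c i (fst z)) * abs_sum n (snd z i)) \<le> (\<Sum>j. ennreal (c j (fst z)) * abs_sum n (snd z j))"
        by (rule sum_le_suminf) auto
      then have "ennreal (c j (fst z)) * abs_sum n (snd z j) \<noteq> \<infinity>" using elim by (auto simp: top_unique)
      moreover have "0 < c j (fst z)" using False c_nonneg[of j "fst z"] by simp
      ultimately have "abs_sum n (snd z j) \<noteq> \<infinity>" by (auto simp: ennreal_mult_eq_top_iff)
      then have "abs_sum n (snd z j) = ennreal (dom_sum n (snd z j))" unfolding dom_sum_def by (simp add: less_top[symmetric])
      then show ?thesis using c_nonneg by (simp add: ennreal_mult dom_sum_def)
    qed simp
    have nn: "0 \<le> c j (fst z) * dom_sum n (snd z j)" for j using c_nonneg by (simp add: dom_sum_def)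
    have s: "summable (\<lambda>j. c j (fst z) * dom_sum n (snd z j))"
      using elim nn unfolding e by (intro summable_suminf_not_top) auto
    show ?case
      unfolding \<Psi>_def e suminf_ennreal2[OF nn s] using suminf_nonneg[OF s nn]
      by (simp add: ennreal_plus[symmetric] del: ennreal_plus)
  qed
  show thesis by (rule that[OF 1 2 3])
qed

text \<open>
  The moment bound and the tail bound are preserved from one depth to the next with the same
  constants.
\<close>

lemma uniform_domination:
  obtains B K where "\<And>n. tail_dominated B K (dom_sum n)"
proof -
  obtain B where B: "0 \<le> B" and moment: "\<And>Y. Y \<in> borel_measurable T \<Longrightarrow> \<forall>t. 0 \<le> Y t \<Longrightarrow> (\<integral>\<^sup>+t. ennreal (Y t) \<partial>T) \<le> ennreal mean_bound \<Longrightarrow>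
    (\<integral>\<^sup>+t. ennreal (Y t powr p) \<partial>T) \<le> ennreal B \<Longrightarrow>
    (\<integral>\<^sup>+z. ennreal ((\<bar>q (fst z)\<bar> + offspring Y z) powr p) \<partial>DL) \<le> ennreal B"
    by (rule moment_constant[OF mean_bound_pos]) (rule that; assumption)
  obtain K where K: "0 \<le> K" and tail: "\<And>Y x. tail_dominated B K Y \<Longrightarrow> integral\<^sup>L T Y \<le> mean_bound \<Longrightarrow> 0 < x \<Longrightarrow>
    \<P>(z in DL. x < \<bar>q (fst z)\<bar> + offspring Y z) \<le> K * G x"
    by (rule tail_constant[OF mean_bound_pos B]) (rule that; assumption)
  have X0: "0 \<le> dom_sum n f" for n f by (simp add: dom_sum_def)
  have "tail_dominated B K (dom_sum n) \<and> (\<integral>\<^sup>+f. ennreal (dom_sum n f powr p) \<partial>T) \<le> ennreal B" for n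
  proof (induction n)
    case 0
    show ?case using B K G_nonneg unfolding tail_dominated_def by (simp add: dom_sum_def)
  next
    case (Suc n)
    note td = Suc[THEN conjunct1] and mom = Suc[THEN conjunct2]
    obtain \<Psi> where Psi: "\<Psi> \<in> borel_measurable DL" "\<And>f. dom_sum (Suc n) f = \<Psi> (split_root f)"
      "AE z in DL. \<Psi> z = \<bar>q (fst z)\<bar> + offspring (dom_sum n) z"
      by (rule dom_sum_Suc[of n]) (rule that; assumption)
    note [measurable] = Psi(1)
    have "(\<integral>\<^sup>+f. ennreal (dom_sum (Suc n) f powr p) \<partial>T) = (\<integral>\<^sup>+z. ennreal (\<Psi> z powr p) \<partial>DL)"
      unfolding Psi(2) by (rule nn_integral_split_root[of "\<lambda>z. ennreal (\<Psi> z powr p)"]) measurable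
    also have "\<dots> = (\<integral>\<^sup>+z. ennreal ((\<bar>q (fst z)\<bar> + offspring (dom_sum n) z) powr p) \<partial>DL)"
      using Psi(3) by (intro nn_integral_cong_AE) auto
    also have "\<dots> \<le> ennreal B" using X0 by (intro moment measurable_dom_sum nn_integral_dom_sum mom) auto
    finally have m1: "(\<integral>\<^sup>+f. ennreal (dom_sum (Suc n) f powr p) \<partial>T) \<le> ennreal B" .
    have i1: "integrable T (\<lambda>f. dom_sum (Suc n) f powr p)"
      using m1 by (intro integrableI_nonneg) (auto intro: le_less_trans)
    have "ennreal (\<integral>f. dom_sum (Suc n) f powr p \<partial>T) \<le> ennreal B"
      using m1 i1 by (subst nn_integral_eq_integral[symmetric]) auto
    then have m2: "(\<integral>f. dom_sum (Suc n) f powr p \<partial>T) \<le> B" using B by simp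
    have t1: "\<P>(f in T. z < dom_sum (Suc n) f) \<le> K * G z" if z: "0 < z" for z
    proof -
      have "\<P>(f in T. z < dom_sum (Suc n) f) = \<P>(y in DL. z < \<Psi> y)"
        unfolding Psi(2) by (rule prob_split_root) measurable
      also have "\<dots> = \<P>(y in DL. z < \<bar>q (fst y)\<bar> + offspring (dom_sum n) y)"
        using Psi(3) by (intro DP.finite_measure_eq_AE) auto
      also have "\<dots> \<le> K * G z" by (rule tail[OF td dom_sum_mean z])
      finally show ?thesis .
    qed
    show ?case using m1 i1 m2 t1 K X0 unfolding tail_dominated_def by simp
  qed
  then show thesis by (intro that) auto
qed

end

section \<open>The sum over the tree\<close>

context branching_tree
begin

definition dom_total :: "(nat list \<Rightarrow> 'v) \<Rightarrow> real" where "dom_total f = enn2real (abs_total f)"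

lemma measurable_dom_total[measurable]: "dom_total \<in> borel_measurable T" unfolding dom_total_def by measurable

lemma dom_sum_tendsto: "AE f in T. (\<lambda>n. dom_sum n f) \<longlonglongrightarrow> dom_total f"
  using AE_abs_total_finite
proof eventually_elim
  case (elim f)
  have "(\<lambda>n. abs_sum n f) \<longlonglongrightarrow> abs_total f"
    unfolding abs_total_def by (intro LIMSEQ_SUP incseq_SucI abs_sum_mono)
  then show ?case unfolding dom_sum_def dom_total_def
    using elim by (intro tendsto_enn2real) (auto simp: less_top[symmetric])
qed

text \<open>
  Fatou's lemma carries the uniform bounds to the limit.
\<close>

lemma limit_domination:
  obtains B K where "tail_dominated B K dom_total"
proof -
  obtain B K where td: "\<And>n. tail_dominated B K (dom_sum n)"
    by (rule uniform_domination) (rule that; assumption)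
  have B: "0 \<le> B" by (rule order_trans[OF _ tail_dominatedD(5)[OF td[of 0]]]) simp
  have K: "0 \<le> K" by (rule tail_dominatedD(6)[OF td])
  have X0: "0 \<le> dom_sum n f" "0 \<le> dom_total f" for n f by (auto simp: dom_sum_def dom_total_def)
  have "(\<integral>\<^sup>+f. ennreal (dom_total f powr p) \<partial>T) \<le> (\<integral>\<^sup>+f. liminf (\<lambda>n. ennreal (dom_sum n f powr p)) \<partial>T)"
  proof (rule nn_integral_mono_AE)
    show "AE f in T. ennreal (dom_total f powr p) \<le> liminf (\<lambda>n. ennreal (dom_sum n f powr p))"
      using dom_sum_tendsto
    proof eventually_elim
      case (elim f)
      have "(\<lambda>n. ennreal (dom_sum n f powr p)) \<longlonglongrightarrow> ennreal (dom_total f powr p)"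
        using p X0 by (intro tendsto_ennrealI tendsto_powr' elim tendsto_const) auto
      from lim_imp_Liminf[OF _ this] show ?case by simp
    qed
  qed
  also have "\<dots> \<le> liminf (\<lambda>n. \<integral>\<^sup>+f. ennreal (dom_sum n f powr p) \<partial>T)"
    by (rule nn_integral_liminf) measurable
  also have "\<dots> \<le> ennreal B"
  proof (rule Liminf_le)
    have "(\<integral>\<^sup>+f. ennreal (dom_sum n f powr p) \<partial>T) \<le> ennreal B" for n
      using tail_dominatedD(4,5)[OF td[of n]] X0 by (subst nn_integral_eq_integral) (auto intro: ennreal_leI)
    then show "\<forall>\<^sub>F n in sequentially. (\<integral>\<^sup>+f. ennreal (dom_sum n f powr p) \<partial>T) \<le> ennreal B" by simp
  qed simp
  finally have m1: "(\<integral>\<^sup>+f. ennreal (dom_total f powr p) \<partial>T) \<le> ennreal B" .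
  have i1: "integrable T (\<lambda>f. dom_total f powr p)"
    using m1 by (intro integrableI_nonneg) (auto intro: le_less_trans)
  have "ennreal (\<integral>f. dom_total f powr p \<partial>T) \<le> ennreal B"
    using m1 i1 by (subst nn_integral_eq_integral[symmetric]) auto
  then have m2: "(\<integral>f. dom_total f powr p \<partial>T) \<le> B" using B by simp
  have t: "\<P>(f in T. z < dom_total f) \<le> K * G z" if z: "0 < z" for z
  proof -
    have "emeasure T {f\<in>space T. z < dom_total f} = (\<integral>\<^sup>+f. indicator {f\<in>space T. z < dom_total f} f \<partial>T)" by simp
    also have "\<dots> \<le> (\<integral>\<^sup>+f. liminf (\<lambda>n. indicator {f\<in>space T. z < dom_sum n f} f) \<partial>T)"
    proof (rule nn_integral_mono_AE)
      show "AE f in T. indicator {f\<in>space T. z < dom_total f} f \<le> liminf (\<lambda>n. indicator {f\<in>space T. z < dom_sum n f} f :: ennreal)"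
        using dom_sum_tendsto
      proof eventually_elim
        case (elim f)
        show ?case
        proof (cases "f \<in> space T \<and> z < dom_total f")
          case True
          have "\<forall>\<^sub>F n in sequentially. z < dom_sum n f" using order_tendstoD(1)[OF elim] True by auto
          then have "\<forall>\<^sub>F n in sequentially. (1::ennreal) \<le> indicator {f\<in>space T. z < dom_sum n f} f"
            by eventually_elim (use True in auto)
          then have "(1::ennreal) \<le> liminf (\<lambda>n. indicator {f\<in>space T. z < dom_sum n f} f)"
            by (rule Liminf_bounded)
          then show ?thesis using True by simp
        qed auto
      qed
    qed
    also have "\<dots> \<le> liminf (\<lambda>n. \<integral>\<^sup>+f. indicator {f\<in>space T. z < dom_sum n f} f \<partial>T)"
      by (rule nn_integral_liminf) measurable
    also have "\<dots> \<le> ennreal (K * G z)"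
    proof (rule Liminf_le)
      have "(\<integral>\<^sup>+f. indicator {f\<in>space T. z < dom_sum n f} f \<partial>T) \<le> ennreal (K * G z)" for n
      proof -
        have "\<P>(f in T. z < dom_sum n f) \<le> K * G z"
          using td[of n] z X0 unfolding tail_dominated_def by simp
        then show ?thesis by (simp add: emeasure_eq_measure ennreal_leI)
      qed
      then show "\<forall>\<^sub>F n in sequentially. (\<integral>\<^sup>+f. indicator {f\<in>space T. z < dom_sum n f} f \<partial>T) \<le> ennreal (K * G z)" by simp
    qed simp
    finally show ?thesis using K G_nonneg by (simp add: emeasure_eq_measure)
  qed
  have "tail_dominated B K dom_total"
    using i1 m2 t K X0 unfolding tail_dominated_def by simp
  then show thesis by (rule that)
qed

text \<open>
  The product \<open>\<Pi>\<^sub>i\<close> of the weights along the path to \<open>i\<close>, by recursion from the root, which matches the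
  decomposition into branches.  The weight of the child \<open>k\<close> has the index \<open>k - 1\<close>.
\<close>

primrec node_weight :: "nat list \<Rightarrow> (nat list \<Rightarrow> 'v) \<Rightarrow> real" where
  "node_weight [] f = 1"
| "node_weight (k # i) f = c (k - 1) (f []) * node_weight i (subtree (k - 1) f)"

definition node_term :: "nat list \<Rightarrow> (nat list \<Rightarrow> 'v) \<Rightarrow> real" where
  "node_term i f = q (f i) * node_weight i f"

lemma measurable_node_weight: "i \<in> tree_nodes \<Longrightarrow> node_weight i \<in> borel_measurable T"
proof (induction i)
  case (Cons k i)
  then have [measurable]: "node_weight i \<in> borel_measurable T" by simp
  have "(\<lambda>f. c (k - 1) (fst (split_root f)) * node_weight i (subtree (k - 1) f)) \<in> borel_measurable T" by measurable
  then show ?case by (simp add: split_root_def)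
next
  case Nil
  have "node_weight [] = (\<lambda>_. 1)" by (simp add: fun_eq_iff)
  then show ?case by simp
qed

lemma measurable_node_term: "i \<in> tree_nodes \<Longrightarrow> node_term i \<in> borel_measurable T"
  unfolding node_term_def
  by (intro borel_measurable_times measurable_node_weight measurable_compose[OF _ measurable_q] measurable_component_singleton)

lemma node_term_child: "i \<in> tree_nodes \<Longrightarrow> node_term (Suc j # i) f = c j (f []) * node_term i (subtree j f)"
  by (simp add: node_term_def subtree_def)

lemma abs_sum_eq: "abs_sum n f = (\<integral>\<^sup>+i. (if length i < n then ennreal \<bar>node_term i f\<bar> else 0) \<partial>count_space tree_nodes)"
proof (induction n arbitrary: f)
  case (Suc n)
  have "(\<integral>\<^sup>+i. (if length i < Suc n then ennreal \<bar>node_term i f\<bar> else 0) \<partial>count_space tree_nodes)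
    = ennreal \<bar>q (f [])\<bar> + (\<Sum>j. \<integral>\<^sup>+i. (if length i < n then ennreal \<bar>node_term (Suc j # i) f\<bar> else 0) \<partial>count_space tree_nodes)"
    by (subst nn_integral_tree_nodes) (simp add: node_term_def)
  also have "(\<lambda>j. \<integral>\<^sup>+i. (if length i < n then ennreal \<bar>node_term (Suc j # i) f\<bar> else 0) \<partial>count_space tree_nodes)
    = (\<lambda>j. ennreal (c j (f [])) * abs_sum n (subtree j f))"
  proof
    fix j
    have "(\<integral>\<^sup>+i. (if length i < n then ennreal \<bar>node_term (Suc j # i) f\<bar> else 0) \<partial>count_space tree_nodes)
      = (\<integral>\<^sup>+i. ennreal (c j (f [])) * (if length i < n then ennreal \<bar>node_term i (subtree j f)\<bar> else 0) \<partial>count_space tree_nodes)"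
      using c_nonneg by (intro nn_integral_cong) (auto simp: node_term_child abs_mult ennreal_mult)
    also have "\<dots> = ennreal (c j (f [])) * abs_sum n (subtree j f)"
      by (subst nn_integral_cmult) (auto simp: Suc)
    finally show "(\<integral>\<^sup>+i. (if length i < n then ennreal \<bar>node_term (Suc j # i) f\<bar> else 0) \<partial>count_space tree_nodes)
      = ennreal (c j (f [])) * abs_sum n (subtree j f)" .
  qed
  finally show ?case by simp
qed simp

lemma abs_total_eq: "abs_total f = (\<integral>\<^sup>+i. ennreal \<bar>node_term i f\<bar> \<partial>count_space tree_nodes)"
proof -
  have "ennreal \<bar>node_term i f\<bar> = (SUP n. if length i < n then ennreal \<bar>node_term i f\<bar> else 0)" for i
  proof (rule antisym)
    show "ennreal \<bar>node_term i f\<bar> \<le> (SUP n. if length i < n then ennreal \<bar>node_term i f\<bar> else 0)"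
      by (rule SUP_upper2[of "Suc (length i)"]) auto
    show "(SUP n. if length i < n then ennreal \<bar>node_term i f\<bar> else 0) \<le> ennreal \<bar>node_term i f\<bar>"
      by (rule SUP_least) simp
  qed
  then have "(\<integral>\<^sup>+i. ennreal \<bar>node_term i f\<bar> \<partial>count_space tree_nodes)
    = (\<integral>\<^sup>+i. (SUP n. if length i < n then ennreal \<bar>node_term i f\<bar> else 0) \<partial>count_space tree_nodes)" by simp
  also have "\<dots> = (SUP n. \<integral>\<^sup>+i. (if length i < n then ennreal \<bar>node_term i f\<bar> else 0) \<partial>count_space tree_nodes)"
    by (rule nn_integral_monotone_convergence_SUP) (auto simp: incseq_def le_fun_def)
  finally show ?thesis unfolding abs_total_def abs_sum_eq by simp
qed

definition tree_sum :: "(nat list \<Rightarrow> 'v) \<Rightarrow> real" where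
  "tree_sum f = infsetsum (\<lambda>i. node_term i f) tree_nodes"

lemma node_term_summable:
  assumes "abs_total f < \<infinity>"
  shows "Infinite_Set_Sum.abs_summable_on (\<lambda>i. node_term i f) tree_nodes"
  unfolding Infinite_Set_Sum.abs_summable_on_def
  using assms by (intro integrableI_bounded) (auto simp: abs_total_eq)

text \<open>
  A sum over a countable set is a Lebesgue integral, and such integrals depend measurably on parameters.
\<close>

lemma measurable_tree_sum[measurable]: "tree_sum \<in> borel_measurable T"
proof -
  interpret sf: sigma_finite_measure "count_space tree_nodes"
    by (rule sigma_finite_measure_count_space_countable) (rule countable_tree_nodes)
  have "(\<lambda>z. node_term (fst z) (snd z)) \<in> borel_measurable (count_space tree_nodes \<Otimes>\<^sub>M T)"
    by (rule measurable_pair_measure_countable1) (auto intro: measurable_node_term)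
  from measurable_pair_swap[OF this]
  have "(\<lambda>(f, i). node_term i f) \<in> borel_measurable (T \<Otimes>\<^sub>M count_space tree_nodes)" by simp
  from sf.borel_measurable_lebesgue_integral[OF this]
  show ?thesis unfolding tree_sum_def infsetsum_def[abs_def] .
qed

lemma tree_sum_le_dom_total:
  assumes "abs_total f < \<infinity>"
  shows "\<bar>tree_sum f\<bar> \<le> dom_total f"
proof -
  have "norm (tree_sum f) \<le> infsetsum (\<lambda>i. norm (node_term i f)) tree_nodes"
    unfolding tree_sum_def by (rule norm_infsetsum_bound)
  also have "\<dots> = dom_total f"
    unfolding dom_total_def abs_total_eq infsetsum_def by (subst integral_eq_nn_integral) auto
  finally show ?thesis by simp
qed

lemma tree_sum_recursion:
  assumes "abs_total f < \<infinity>"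
  shows "tree_sum f = q (f []) + (\<Sum>j. c j (f []) * tree_sum (subtree j f))"
proof -
  have "infsetsum (\<lambda>i. node_term (Suc j # i) f) tree_nodes = c j (f []) * tree_sum (subtree j f)" for j
  proof -
    have "infsetsum (\<lambda>i. node_term (Suc j # i) f) tree_nodes = infsetsum (\<lambda>i. c j (f []) * node_term i (subtree j f)) tree_nodes"
      by (intro infsetsum_cong node_term_child refl)
    also have "\<dots> = c j (f []) * tree_sum (subtree j f)" unfolding tree_sum_def infsetsum_def by simp
    finally show ?thesis .
  qed
  then show ?thesis
    unfolding tree_sum_def[of f] infsetsum_tree_nodes(1)[OF node_term_summable[OF assms]] by (simp add: node_term_def)
qed

lemma tree_sum_fixed_AE: "AE f in T. tree_sum f = q (fst (split_root f)) + (\<Sum>j. c j (fst (split_root f)) * tree_sum (snd (split_root f) j))"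
  using AE_abs_total_finite by eventually_elim (simp add: tree_sum_recursion split_root_def)

text \<open>
  The sum over the tree inherits the bounds of the sum of absolute values, and it solves the fixed-point
  equation.  Taking expectations there gives its mean \<open>E q / (1 - \<rho>\<^sub>1)\<close>.
\<close>

theorem tree_tail:
  assumes q: "0 < integral\<^sup>L D q"
  shows "((\<lambda>x. \<P>(f in T. x < tree_sum f) / G x) \<longlongrightarrow> (integral\<^sup>L D q / (1 - \<rho> 1)) powr \<alpha> / (1 - \<rho> \<alpha>)) at_top"
proof -
  obtain B K where td: "tail_dominated B K dom_total" by (rule limit_domination) (rule that; assumption)
  have le: "AE f in T. \<bar>tree_sum f\<bar> \<le> dom_total f"
    using AE_abs_total_finite by eventually_elim (rule tree_sum_le_dom_total)
  have X0: "0 \<le> dom_total f" for f by (simp add: dom_total_def)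
  have pw: "AE f in T. \<bar>tree_sum f\<bar> powr p \<le> \<bar>dom_total f\<bar> powr p"
    using le by eventually_elim (use p X0 in \<open>auto intro!: powr_mono2\<close>)
  have iR: "integrable T (\<lambda>f. \<bar>tree_sum f\<bar> powr p)"
    by (rule Bochner_Integration.integrable_bound[OF tail_dominatedD(4)[OF td]]) (use pw in auto)
  have tdR: "tail_dominated B K tree_sum"
    unfolding tail_dominated_def
  proof (intro conjI allI impI)
    show "(\<integral>f. \<bar>tree_sum f\<bar> powr p \<partial>T) \<le> B"
      using integral_mono_AE[OF iR tail_dominatedD(4)[OF td] pw] tail_dominatedD(5)[OF td] by linarith
    show "0 \<le> K" by (rule tail_dominatedD(6)[OF td])
    fix z :: real assume "0 < z"
    have "\<P>(f in T. z < \<bar>tree_sum f\<bar>) \<le> \<P>(f in T. z < \<bar>dom_total f\<bar>)"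
      using le by (intro finite_measure_mono_AE) auto
    also have "\<dots> \<le> K * G z" using td \<open>0 < z\<close> by (simp add: tail_dominated_def)
    finally show "\<P>(f in T. z < \<bar>tree_sum f\<bar>) \<le> K * G z" .
  qed (use iR in auto)
  note RI = tail_dominatedD(2)[OF tdR]
  let ?\<Psi> = "\<lambda>z. q (fst z) + offspring tree_sum z"
  have fixed: "\<P>(z in DL. x < ?\<Psi> z) = \<P>(f in T. x < tree_sum f)" for x
  proof -
    have "\<P>(f in T. x < tree_sum f) = \<P>(f in T. x < ?\<Psi> (split_root f))"
      using tree_sum_fixed_AE by (intro finite_measure_eq_AE) auto
    also have "\<dots> = \<P>(z in DL. x < ?\<Psi> z)"
      by (rule prob_split_root) measurable
    finally show ?thesis by simp
  qed
  have "integral\<^sup>L T tree_sum = integral\<^sup>L T (\<lambda>f. ?\<Psi> (split_root f))"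
    using tree_sum_fixed_AE by (intro integral_cong_AE) auto
  also have "\<dots> = integral\<^sup>L (distr T DL split_root) ?\<Psi>"
    by (rule integral_distr[symmetric]) measurable
  also have "\<dots> = integral\<^sup>L D q + \<rho> 1 * integral\<^sup>L T tree_sum"
    unfolding distr_split_root by (rule integral_branching_sum[OF RI])
  finally have "integral\<^sup>L T tree_sum * (1 - \<rho> 1) = integral\<^sup>L D q" by (simp add: algebra_simps)
  then have mean: "integral\<^sup>L T tree_sum = integral\<^sup>L D q / (1 - \<rho> 1)" using rho_bounds by (simp add: field_simps)
  show ?thesis
    by (rule fixed_point_tail[OF tdR _ mean fixed]) (use q rho_bounds in auto)
qed

lemma tree_sum_levels:
  assumes "abs_total f < \<infinity>"
  shows "tree_sum f = (\<Sum>n. infsetsum (\<lambda>i. node_term i f) {i\<in>tree_nodes. length i = n})"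
proof -
  let ?S = "Sigma UNIV (\<lambda>n. {i\<in>tree_nodes. length i = n})"
  have bij: "bij_betw snd ?S tree_nodes"
    by (rule bij_betwI[where g = "\<lambda>i. (length i, i)"]) auto
  have s: "Infinite_Set_Sum.abs_summable_on (\<lambda>(n, i). node_term i f) ?S"
    using abs_summable_on_reindex_bij_betw[OF bij, of "\<lambda>i. node_term i f"] node_term_summable[OF assms]
    by (simp add: case_prod_beta')
  have cnt: "countable {i \<in> tree_nodes. length i = n}" for n
    by (rule countable_subset[OF _ countable_tree_nodes]) auto
  have "tree_sum f = infsetsum (\<lambda>(n, i). node_term i f) ?S"
    unfolding tree_sum_def using infsetsum_reindex_bij_betw[OF bij, of "\<lambda>i. node_term i f"] by (simp add: case_prod_beta')
  also have "\<dots> = infsetsum (\<lambda>n. infsetsum (\<lambda>i. node_term i f) {i\<in>tree_nodes. length i = n}) UNIV"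
    by (rule infsetsum_Sigma'[symmetric, OF _ _ s]) (auto intro: cnt)
  also have "\<dots> = (\<Sum>n. infsetsum (\<lambda>i. node_term i f) {i\<in>tree_nodes. length i = n})"
    by (rule infsetsum_nat'[OF abs_summable_on_Sigma_project1'[OF s]]) (auto intro: cnt)
  finally show ?thesis .
qed

lemma node_weight_snoc:
  "i \<in> tree_nodes \<Longrightarrow> node_weight (i @ [k]) f = node_weight i f * c (k - 1) (f i)"
proof (induction i arbitrary: f)
  case (Cons a i)
  then have "subtree (a - 1) f i = f (a # i)" by (simp add: subtree_def)
  then show ?case using Cons by simp
qed simp

end

section \<open>The weighted branching tree\<close>

lemma regular_tail_of_regularly_varying:
  assumes rv: "regularly_varying (- \<alpha>) G" and a: "0 < \<alpha>"
    and anti: "\<And>x y. x \<le> y \<Longrightarrow> G y \<le> G x" and le1: "\<And>x. G x \<le> 1"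
  shows "regular_tail G \<alpha>"
proof -
  obtain l where l: "\<And>x. 0 \<le> x \<Longrightarrow> 0 < l x" "\<And>c. c > 0 \<Longrightarrow> ((\<lambda>x. l (c * x) / l x) \<longlongrightarrow> 1) at_top"
    and G: "\<And>x. 0 < x \<Longrightarrow> G x = x powr (- \<alpha>) * l x"
    using rv unfolding regularly_varying_def slowly_varying_def by blast
  show ?thesis
  proof
    show "0 < G x" if "0 < x" for x using G[OF that] l(1)[of x] that by simp
    show "((\<lambda>x. G (c * x) / G x) \<longlongrightarrow> c powr (- \<alpha>)) at_top" if c: "0 < c" for c
    proof (rule Lim_transform_eventually)
      show "((\<lambda>x. c powr (- \<alpha>) * (l (c * x) / l x)) \<longlongrightarrow> c powr (- \<alpha>)) at_top"
        using tendsto_mult[OF tendsto_const l(2)[OF c], of "c powr (- \<alpha>)"] by simp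
      show "\<forall>\<^sub>F x in at_top. c powr (- \<alpha>) * (l (c * x) / l x) = G (c * x) / G x"
        using eventually_gt_at_top[of 0]
      proof eventually_elim
        case (elim x)
        then have "0 < x powr (- \<alpha>)" "0 < l x" using l(1)[of x] by auto
        then show ?case using elim c by (simp add: G powr_mult)
      qed
    qed
  qed (use a anti le1 in auto)
qed

text \<open>
  For real terms unconditional summability is absolute summability, and both notions of sum have the
  value 0 where it fails.
\<close>

lemma infsum_eq_infsetsum:
  fixes u :: "'b \<Rightarrow> real"
  shows "infsum u S = infsetsum u S"
proof (cases "Infinite_Set_Sum.abs_summable_on u S")
  case True
  then show ?thesis by (rule infsetsum_infsum[symmetric])
next
  case False
  then have "\<not> u summable_on S"
    using abs_summable_equivalent[of u S] summable_on_iff_abs_summable_on_real[of u S] by auto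
  then show ?thesis using False by (simp add: infsum_not_exists not_summable_infsetsum_eq)
qed

definition vec_Q :: "real \<times> enat \<times> (nat \<Rightarrow> real) \<Rightarrow> real" where "vec_Q v = fst v"

definition vec_entry :: "nat \<Rightarrow> real \<times> enat \<times> (nat \<Rightarrow> real) \<Rightarrow> real" where
  "vec_entry j v = snd (snd v) j"

definition vec_total :: "real \<times> enat \<times> (nat \<Rightarrow> real) \<Rightarrow> ennreal" where
  "vec_total v = (\<Sum>j. ennreal \<bar>vec_entry (Suc j) v\<bar>)"

text \<open>
  The entry \<open>j + 1\<close> of a vector, made nonnegative and summable at every point.  By \<open>AE_good_vec\<close> this
  changes a vector of the model with probability 0 only.
\<close>

definition vec_weight :: "nat \<Rightarrow> real \<times> enat \<times> (nat \<Rightarrow> real) \<Rightarrow> real" where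
  "vec_weight j v = (if vec_total v < \<infinity> then \<bar>vec_entry (Suc j) v\<bar> else 0)"

definition good_vec :: "real \<times> enat \<times> (nat \<Rightarrow> real) \<Rightarrow> bool" where
  "good_vec v \<longleftrightarrow> vec_total v < \<infinity> \<and> (\<forall>j. 0 \<le> vec_entry (Suc j) v)"

lemma measurable_vec[measurable]:
  "vec_Q \<in> borel_measurable branch_space"
  "vec_entry j \<in> borel_measurable branch_space"
  unfolding vec_Q_def[abs_def] vec_entry_def[abs_def] branch_space_def by measurable

lemma measurable_vec_derived[measurable]:
  "vec_total \<in> borel_measurable branch_space"
  "vec_weight j \<in> borel_measurable branch_space"
  "Measurable.pred branch_space good_vec"
proof -
  show 1[measurable]: "vec_total \<in> borel_measurable branch_space" unfolding vec_total_def[abs_def] by measurable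
  show "vec_weight j \<in> borel_measurable branch_space" unfolding vec_weight_def[abs_def] by measurable
  show "Measurable.pred branch_space good_vec" unfolding good_vec_def[abs_def] by measurable
qed

lemma vec_weight_nonneg: "0 \<le> vec_weight j v" by (simp add: vec_weight_def)

lemma vec_weight_summable: "summable (\<lambda>j. vec_weight j v)"
  unfolding vec_weight_def
  by (cases "vec_total v < \<infinity>") (auto simp: vec_total_def intro!: summable_suminf_not_top)

lemma vec_weight_good: "good_vec v \<Longrightarrow> vec_weight j v = vec_entry (Suc j) v"
  by (simp add: good_vec_def vec_weight_def)

lemma vec_entry_branch_vector:
  "vec_entry j (branch_vector Q N C \<omega>) = (if 1 \<le> j \<and> enat j \<le> N \<omega> then C j \<omega> else 0)"
  by (simp add: vec_entry_def branch_vector_def)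

lemma branch_sum_Suc: "branch_sum n f = (\<Sum>j. if enat (Suc j) \<le> n then f (Suc j) else 0)"
proof -
  let ?f = "\<lambda>j. if 1 \<le> j \<and> enat j \<le> n then f j else 0"
  have "(\<lambda>j. ?f (Suc j)) sums (\<Sum>j. ?f (Suc j))" by (rule summable_sums) (rule summableI)
  then have "?f sums ((\<Sum>j. ?f (Suc j)) + ?f 0)" by (rule sums_Suc)
  then show ?thesis unfolding branch_sum_def by (simp add: sums_iff)
qed

text \<open>
  The hypotheses of the theorem, with the maximum of \<open>\<rho>\<close> and \<open>\<rho>\<^sub>\<alpha>\<close> split into two inequalities.
\<close>

locale branching_model = base: prob_space M for M :: "'a measure" +
  fixes Q :: "'a \<Rightarrow> real" and N :: "'a \<Rightarrow> enat" and C :: "nat \<Rightarrow> 'a \<Rightarrow> real"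
    and Qt :: "nat list \<Rightarrow> 'a \<Rightarrow> real" and Nt :: "nat list \<Rightarrow> 'a \<Rightarrow> enat" and Ct :: "nat list \<Rightarrow> 'a \<Rightarrow> real"
    and \<alpha> \<epsilon> :: real
  assumes vector_measurable: "branch_vector Q N C \<in> measurable M branch_space"
    and weights_nonneg: "AE \<omega> in M. \<forall>j. 1 \<le> j \<and> enat j \<le> N \<omega> \<longrightarrow> 0 \<le> C j \<omega>"
    and wbt: "weighted_branching_tree M Q N C Qt Nt Ct"
    and index: "\<alpha> > 1"
    and rv: "regularly_varying (- \<alpha>) (\<lambda>x. \<P>(\<omega> in M. enn2ereal (Z_sum N C \<omega>) > ereal x))"
    and extra: "\<epsilon> > 0"
    and Q_moment: "integrable M (\<lambda>\<omega>. \<bar>Q \<omega>\<bar> powr (\<alpha> + \<epsilon>))"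
    and rho_extra: "rho M N C (\<alpha> + \<epsilon>) < \<infinity>"
    and rho_less: "rho M N C 1 < 1" "rho M N C \<alpha> < 1"
begin

abbreviation "root_vec \<equiv> branch_vector Q N C"

definition D :: "(real \<times> enat \<times> (nat \<Rightarrow> real)) measure" where "D = distr M branch_space root_vec"

lemma sets_D[measurable_cong]: "sets D = sets branch_space" by (simp add: D_def)

lemma space_D: "space D = space branch_space" by (simp add: D_def)

sublocale D: prob_space D unfolding D_def by (rule base.prob_space_distr) (rule vector_measurable)

lemma AE_good_vec: "AE \<omega> in M. good_vec (root_vec \<omega>)"
proof -
  note [measurable] = vector_measurable
  have "AE \<omega> in M. vec_total (root_vec \<omega>) \<noteq> \<infinity>"
  proof (rule nn_integral_noteq_infinite)
    have "(\<integral>\<^sup>+\<omega>. vec_total (root_vec \<omega>) \<partial>M) = rho M N C 1"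
      unfolding rho_def
    proof (rule nn_integral_cong_AE)
      show "AE \<omega> in M. vec_total (root_vec \<omega>) = branch_sum (N \<omega>) (\<lambda>j. ennreal (C j \<omega> powr 1))"
        using weights_nonneg
        by eventually_elim (auto simp: vec_total_def branch_sum_Suc vec_entry_branch_vector intro!: suminf_cong)
    qed
    then show "(\<integral>\<^sup>+\<omega>. vec_total (root_vec \<omega>) \<partial>M) \<noteq> \<infinity>" using rho_less(1) by auto
  qed measurable
  then show ?thesis
    using weights_nonneg
    by eventually_elim (auto simp: good_vec_def vec_entry_branch_vector less_top[symmetric])
qed

lemma weight_moment_eq_rho: "weight_moment D vec_weight \<beta> = rho M N C \<beta>"
proof -
  have "weight_moment D vec_weight \<beta> = (\<integral>\<^sup>+\<omega>. (\<Sum>j. ennreal (vec_weight j (root_vec \<omega>) powr \<beta>)) \<partial>M)"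
    unfolding weight_moment_def D_def by (rule nn_integral_distr[OF vector_measurable]) measurable
  also have "\<dots> = rho M N C \<beta>"
    unfolding rho_def
  proof (rule nn_integral_cong_AE)
    show "AE \<omega> in M. (\<Sum>j. ennreal (vec_weight j (root_vec \<omega>) powr \<beta>)) = branch_sum (N \<omega>) (\<lambda>j. ennreal (C j \<omega> powr \<beta>))"
      using AE_good_vec
      by eventually_elim (auto simp: vec_weight_good branch_sum_Suc vec_entry_branch_vector intro!: suminf_cong)
  qed
  finally show ?thesis .
qed

text \<open>
  Almost surely \<open>Z\<close> is finite, and there the real series and the extended real one agree.
\<close>

lemma tail_eq: "\<P>(v in D. x < (\<Sum>j. vec_weight j v)) = \<P>(\<omega> in M. enn2ereal (Z_sum N C \<omega>) > ereal x)"
proof -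
  note [measurable] = vector_measurable
  have Z: "Z_sum N C \<omega> = (\<Sum>j. ennreal (vec_entry (Suc j) (root_vec \<omega>)))" for \<omega>
    unfolding Z_sum_def branch_sum_Suc by (intro suminf_cong) (simp add: vec_entry_branch_vector)
  have "\<P>(v in D. x < (\<Sum>j. vec_weight j v)) = \<P>(\<omega> in M. x < (\<Sum>j. vec_weight j (root_vec \<omega>)))"
    unfolding space_D unfolding D_def
    by (subst measure_distr[OF vector_measurable]) (auto intro!: arg_cong[where f = base.prob] simp: measurable_space[OF vector_measurable])
  also have "\<dots> = \<P>(\<omega> in M. ereal x < enn2ereal (Z_sum N C \<omega>))"
  proof (rule base.finite_measure_eq_AE)
    show "AE \<omega> in M. \<omega> \<in> {\<omega>\<in>space M. x < (\<Sum>j. vec_weight j (root_vec \<omega>))} \<longleftrightarrow> \<omega> \<in> {\<omega>\<in>space M. ereal x < enn2ereal (Z_sum N C \<omega>)}"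
      using AE_good_vec
    proof eventually_elim
      case (elim \<omega>)
      have "Z_sum N C \<omega> = ennreal (\<Sum>j. vec_weight j (root_vec \<omega>))"
        unfolding Z vec_weight_good[OF elim, symmetric] using vec_weight_nonneg vec_weight_summable by (rule suminf_ennreal2)
      then show ?case using suminf_nonneg[OF vec_weight_summable vec_weight_nonneg] by simp
    qed
  qed (unfold Z, measurable)
  finally show ?thesis .
qed

text \<open>
  The moment order \<open>min 2 ((1 + \<alpha>) / 2)\<close> lies strictly between 1 and \<open>\<alpha>\<close> and does not exceed 2.
\<close>

sublocale branching_tree D vec_Q vec_weight \<alpha> \<epsilon> "min 2 ((1 + \<alpha>) / 2)"
proof (intro branching_tree.intro branching_law.intro iid_sequence.intro)
  show "prob_space (PiM tree_nodes (\<lambda>_. D))" by (intro prob_space_PiM) (rule D.prob_space_axioms)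
  show "prob_space D" by (rule D.prob_space_axioms)
  show "branching_law_axioms D vec_Q vec_weight \<alpha> \<epsilon> (min 2 ((1 + \<alpha>) / 2))"
  proof (rule branching_law_axioms.intro)
    show "integrable D (\<lambda>v. \<bar>vec_Q v\<bar> powr (\<alpha> + \<epsilon>))"
    proof -
      have "vec_Q (root_vec \<omega>) = Q \<omega>" for \<omega> by (simp add: vec_Q_def branch_vector_def)
      then show ?thesis
        unfolding D_def using Q_moment by (subst integrable_distr_eq[OF vector_measurable]) auto
    qed
    show "regular_tail (\<lambda>x. \<P>(v in D. x < (\<Sum>j. vec_weight j v))) \<alpha>"
    proof (rule regular_tail_of_regularly_varying)
      show "regularly_varying (- \<alpha>) (\<lambda>x. \<P>(v in D. x < (\<Sum>j. vec_weight j v)))"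
        unfolding tail_eq by (rule rv)
      show "\<P>(v in D. y < (\<Sum>j. vec_weight j v)) \<le> \<P>(v in D. x < (\<Sum>j. vec_weight j v))" if "x \<le> y" for x y
        using that by (intro D.finite_measure_mono) auto
    qed (use index in auto)
  qed (use index extra rho_less rho_extra in \<open>auto simp: vec_weight_nonneg vec_weight_summable weight_moment_eq_rho min_less_iff_disj\<close>)
qed

abbreviation "node_vec i \<equiv> node_vector Qt Nt Ct i"

definition family :: "'a \<Rightarrow> nat list \<Rightarrow> real \<times> enat \<times> (nat \<Rightarrow> real)" where
  "family \<omega> = (\<lambda>i\<in>tree_nodes. node_vec i \<omega>)"

lemma measurable_node: "i \<in> tree_nodes \<Longrightarrow> node_vec i \<in> measurable M branch_space"
  using wbt by (auto simp: weighted_branching_tree_def base.indep_vars_def)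

lemma measurable_family[measurable]: "family \<in> measurable M T"
  unfolding family_def by (rule measurable_restrict) (simp add: measurable_node cong: measurable_cong_sets[OF refl sets_D])

text \<open>
  Independence and identical distribution of the node vectors say exactly that the family of all of them
  has a product law.
\<close>

lemma distr_family: "distr M T family = T"
proof -
  have ind: "base.indep_vars (\<lambda>_. branch_space) (\<lambda>i. node_vec i) tree_nodes"
    and d: "\<And>i. i \<in> tree_nodes \<Longrightarrow> distr M branch_space (node_vec i) = D"
    using wbt by (auto simp: weighted_branching_tree_def D_def)
  have ne: "tree_nodes \<noteq> {}" using Nil_in_tree_nodes by blast
  have sT: "sets T = sets (PiM tree_nodes (\<lambda>_. branch_space))" by (intro sets_PiM_cong refl sets_D)
  have "distr M T family = distr M (PiM tree_nodes (\<lambda>_. branch_space)) family"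
    by (intro distr_cong refl sT)
  also have "\<dots> = PiM tree_nodes (\<lambda>i. distr M branch_space (node_vec i))"
    unfolding family_def using base.indep_vars_iff_distr_eq_PiM'[OF ne measurable_node] ind by simp
  also have "\<dots> = T" by (intro PiM_cong refl d)
  finally show ?thesis .
qed

lemma AE_family_good: "AE \<omega> in M. abs_total (family \<omega>) < \<infinity> \<and> (\<forall>i\<in>tree_nodes. good_vec (node_vec i \<omega>))"
proof -
  have "AE v in D. good_vec v"
    unfolding D_def using AE_good_vec by (subst AE_distr_iff[OF vector_measurable]) auto
  then have "AE f in T. good_vec (f i)" if "i \<in> tree_nodes" for i
    using that by (intro AE_PiM_component D.prob_space_axioms) auto
  then have "AE f in T. \<forall>i\<in>tree_nodes. good_vec (f i)"
    by (intro AE_ball_countable[THEN iffD2] ballI) auto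
  then have "AE f in T. abs_total f < \<infinity> \<and> (\<forall>i\<in>tree_nodes. good_vec (f i))"
    using AE_abs_total_finite by eventually_elim simp
  then have "AE f in distr M T family. abs_total f < \<infinity> \<and> (\<forall>i\<in>tree_nodes. good_vec (f i))"
    by (simp only: distr_family)
  from AE_distrD[OF measurable_family this]
  show ?thesis by eventually_elim (auto simp: family_def)
qed

text \<open>
  The weight \<open>\<Pi>\<^sub>i\<close>, set to 0 off the tree.  It is measurable because it involves the padded entries only,
  while \<open>path_weight\<close> also sees unconstrained values.
\<close>

definition gen_weight :: "nat list \<Rightarrow> 'a \<Rightarrow> real" where
  "gen_weight i \<omega> = (if i \<in> generation Nt (length i) \<omega> then path_weight Ct i \<omega> else 0)"

lemma generation_subset: "generation Nt n \<omega> \<subseteq> {i\<in>tree_nodes. length i = n}"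
  by (induction n) (auto simp: tree_nodes_def in_lists_conv_set subset_iff)

lemma enat_less_plus_one: "enat k < n + 1 \<longleftrightarrow> enat k \<le> n"
  by (cases n) (auto simp: one_enat_def)

lemma gen_weight_snoc:
  assumes "1 \<le> k"
  shows "gen_weight (i @ [k]) \<omega> = gen_weight i \<omega> * vec_entry k (node_vec i \<omega>)"
proof -
  have "i @ [k] \<in> generation Nt (Suc (length i)) \<omega> \<longleftrightarrow> i \<in> generation Nt (length i) \<omega> \<and> enat k \<le> Nt i \<omega>"
    using assms by (auto simp: enat_less_plus_one)
  then show ?thesis
    using assms by (auto simp: gen_weight_def vec_entry_branch_vector path_weight_snoc)
qed

lemma measurable_gen_weight: "i \<in> tree_nodes \<Longrightarrow> gen_weight i \<in> borel_measurable M"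
proof (induction i rule: rev_induct)
  case Nil
  have "gen_weight [] = (\<lambda>_. 1)" by (simp add: fun_eq_iff gen_weight_def path_weight_Nil)
  then show ?case by simp
next
  case (snoc k i)
  then have i: "i \<in> tree_nodes" "1 \<le> k" by (auto simp: tree_nodes_def)
  note [measurable] = snoc.IH[OF i(1)] measurable_node[OF i(1)]
  have "(\<lambda>\<omega>. gen_weight i \<omega> * vec_entry k (node_vec i \<omega>)) \<in> borel_measurable M" by measurable
  then show ?case by (simp add: gen_weight_snoc[OF i(2), abs_def])
qed

lemma W_tree_eq: "W_tree Qt Nt Ct n \<omega> = infsetsum (\<lambda>i. Qt i \<omega> * gen_weight i \<omega>) {i\<in>tree_nodes. length i = n}"
proof -
  have "W_tree Qt Nt Ct n \<omega> = infsum (\<lambda>i. Qt i \<omega> * gen_weight i \<omega>) {i\<in>tree_nodes. length i = n}"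
    unfolding W_tree_def using generation_subset[of n \<omega>]
    by (intro infsum_cong_neutral) (auto simp: gen_weight_def)
  then show ?thesis by (simp only: infsum_eq_infsetsum)
qed

text \<open>
  The sum \<open>R\<close> is measurable on the whole space, including the exceptional set where the series
  diverge.  So its tail probabilities are those of any almost surely equal variable.
\<close>

lemma measurable_R_tree: "R_tree Qt Nt Ct \<in> borel_measurable M"
proof -
  have "(\<lambda>\<omega>. infsetsum (\<lambda>i. Qt i \<omega> * gen_weight i \<omega>) {i\<in>tree_nodes. length i = n}) \<in> borel_measurable M" for n
  proof -
    let ?S = "{i\<in>tree_nodes. length i = n}"
    have cnt: "countable ?S" by (rule countable_subset[OF _ countable_tree_nodes]) auto
    interpret sf: sigma_finite_measure "count_space ?S" by (rule sigma_finite_measure_count_space_countable[OF cnt])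
    have Qm: "(\<lambda>\<omega>. Qt i \<omega>) \<in> borel_measurable M" if "i \<in> tree_nodes" for i
      using measurable_compose[OF measurable_node[OF that] measurable_vec(1)] by (simp add: vec_Q_def branch_vector_def)
    have "(\<lambda>z. Qt (fst z) (snd z) * gen_weight (fst z) (snd z)) \<in> borel_measurable (count_space ?S \<Otimes>\<^sub>M M)"
      by (rule measurable_pair_measure_countable1[OF cnt]) (auto intro!: borel_measurable_times Qm measurable_gen_weight)
    from measurable_pair_swap[OF this]
    have "(\<lambda>(\<omega>, i). Qt i \<omega> * gen_weight i \<omega>) \<in> borel_measurable (M \<Otimes>\<^sub>M count_space ?S)" by simp
    from sf.borel_measurable_lebesgue_integral[OF this] show ?thesis unfolding infsetsum_def .
  qed
  then show ?thesis unfolding R_tree_def[abs_def] W_tree_eq by measurable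
qed

lemma AE_R_tree: "AE \<omega> in M. R_tree Qt Nt Ct \<omega> = tree_sum (family \<omega>)"
  using AE_family_good
proof eventually_elim
  case (elim \<omega>)
  have gw: "node_weight i (family \<omega>) = gen_weight i \<omega>" if "i \<in> tree_nodes" for i
    using that
  proof (induction i rule: rev_induct)
    case Nil
    then show ?case by (simp add: gen_weight_def path_weight_Nil)
  next
    case (snoc k i)
    then have i: "i \<in> tree_nodes" "1 \<le> k" by (auto simp: tree_nodes_def)
    have "family \<omega> i = node_vec i \<omega>" using i by (simp add: family_def)
    moreover have "vec_weight (k - 1) (node_vec i \<omega>) = vec_entry k (node_vec i \<omega>)"
      using vec_weight_good[of "node_vec i \<omega>" "k - 1"] elim i by simp
    ultimately show ?case
      by (simp add: node_weight_snoc[OF i(1)] gen_weight_snoc[OF i(2)] snoc.IH[OF i(1)])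
  qed
  have nt: "node_term i (family \<omega>) = Qt i \<omega> * gen_weight i \<omega>" if "i \<in> tree_nodes" for i
    using that by (simp add: node_term_def gw) (simp add: family_def vec_Q_def branch_vector_def)
  have "tree_sum (family \<omega>) = (\<Sum>n. infsetsum (\<lambda>i. Qt i \<omega> * gen_weight i \<omega>) {i\<in>tree_nodes. length i = n})"
    using elim by (subst tree_sum_levels) (auto intro!: suminf_cong infsetsum_cong nt)
  then show ?case by (simp add: R_tree_def W_tree_eq)
qed

lemma R_tree_tail: "\<P>(\<omega> in M. R_tree Qt Nt Ct \<omega> > x) = \<P>(f in T. x < tree_sum f)"
proof -
  note [measurable] = measurable_R_tree
  have "\<P>(f in T. x < tree_sum f) = measure (distr M T family) {f\<in>space T. x < tree_sum f}"
    by (simp only: distr_family)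
  also have "\<dots> = base.prob (family -` {f\<in>space T. x < tree_sum f} \<inter> space M)"
    by (rule measure_distr) measurable
  also have "family -` {f\<in>space T. x < tree_sum f} \<inter> space M = {\<omega>\<in>space M. x < tree_sum (family \<omega>)}"
    using measurable_space[OF measurable_family] by auto
  also have "base.prob \<dots> = \<P>(\<omega> in M. x < R_tree Qt Nt Ct \<omega>)"
    using AE_R_tree by (intro base.finite_measure_eq_AE) auto
  finally show ?thesis by simp
qed

lemma expectation_Q: "integral\<^sup>L D vec_Q = base.expectation Q"
  unfolding D_def by (subst integral_distr[OF vector_measurable]) (auto simp: vec_Q_def branch_vector_def)

end

theorem theorem3p4:
  fixes M :: "'a measure"
    and Q :: "'a \<Rightarrow> real" and N :: "'a \<Rightarrow> enat" and C :: "nat \<Rightarrow> 'a \<Rightarrow> real"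
    and Qt :: "nat list \<Rightarrow> 'a \<Rightarrow> real" and Nt :: "nat list \<Rightarrow> 'a \<Rightarrow> enat"
    and Ct :: "nat list \<Rightarrow> 'a \<Rightarrow> real"
    and \<alpha> \<epsilon> :: real
  assumes "prob_space M"
    and "branch_vector Q N C \<in> measurable M branch_space"
    and "AE \<omega> in M. \<forall>j. 1 \<le> j \<and> enat j \<le> N \<omega> \<longrightarrow> 0 \<le> C j \<omega>"
    and "\<P>(\<omega> in M. \<bar>Q \<omega>\<bar> > 0) > 0"
    and "weighted_branching_tree M Q N C Qt Nt Ct"
    and "\<alpha> > 1"
    and "regularly_varying (- \<alpha>) (\<lambda>x. \<P>(\<omega> in M. enn2ereal (Z_sum N C \<omega>) > ereal x))"
    and "\<epsilon> > 0"
    and "integrable M (\<lambda>\<omega>. \<bar>Q \<omega>\<bar> powr (\<alpha> + \<epsilon>))"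
    and "rho M N C (\<alpha> + \<epsilon>) < \<infinity>"
    and "integral\<^sup>L M Q > 0"
    and "max (rho M N C 1) (rho M N C \<alpha>) < 1"
  shows "(\<lambda>x. \<P>(\<omega> in M. R_tree Qt Nt Ct \<omega> > x)) \<sim>[at_top]
         (\<lambda>x. (integral\<^sup>L M Q) powr \<alpha>
                / ((1 - enn2real (rho M N C 1)) powr \<alpha> * (1 - enn2real (rho M N C \<alpha>)))
              * \<P>(\<omega> in M. enn2ereal (Z_sum N C \<omega>) > ereal x))"
proof -
  interpret branching_model M Q N C Qt Nt Ct \<alpha> \<epsilon>
    using assms by (intro branching_model.intro branching_model_axioms.intro) auto
  have rho: "\<rho> \<beta> = enn2real (rho M N C \<beta>)" for \<beta>
    by (simp add: \<rho>_def weight_moment_eq_rho)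
  have G: "G x = \<P>(\<omega> in M. enn2ereal (Z_sum N C \<omega>) > ereal x)" for x
    by (simp add: G_def Z_def tail_eq)
  define k where "k = (integral\<^sup>L M Q) powr \<alpha> / ((1 - \<rho> 1) powr \<alpha> * (1 - \<rho> \<alpha>))"
  have k: "0 < k" unfolding k_def using assms(11) rho_bounds by simp
  have "((\<lambda>x. \<P>(f in T. x < tree_sum f) / G x) \<longlongrightarrow> (integral\<^sup>L M Q / (1 - \<rho> 1)) powr \<alpha> / (1 - \<rho> \<alpha>)) at_top"
    using tree_tail assms(11) by (simp add: expectation_Q)
  also have "(integral\<^sup>L M Q / (1 - \<rho> 1)) powr \<alpha> / (1 - \<rho> \<alpha>) = k"
    by (simp add: k_def powr_divide)
  finally have "((\<lambda>x. \<P>(f in T. x < tree_sum f) / G x / k) \<longlongrightarrow> k / k) at_top"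
    using k by (intro tendsto_divide tendsto_const) auto
  then have "(\<lambda>x. \<P>(f in T. x < tree_sum f)) \<sim>[at_top] (\<lambda>x. k * G x)"
    using k by (intro asymp_equivI') (simp add: mult.commute)
  then show ?thesis unfolding R_tree_tail k_def rho G .
qed

end
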